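(* Let $(B,g_B,J_B)$ and $(F,g_F,J_F)$ be two almost product non-degenerate semi-Riemannian manifolds, $b\in C^\infty(B\times F)$, and suppose $db=0$ at all points where $b=0$. Let $\widetilde R$ be the almost product curvature of the twisted product $(B\times_bF,J)$, $J=(J_B,J_F)$. For all $X,Y,Z,T\in\Gamma(TB)$ and $U,V,W,Q\in\Gamma(TF)$: (1) $\widetilde R(X,Y,Z,T)=\widetilde R_B(X,Y,Z,T)$; (2) $\widetilde R(X,Y,Z,W)=\widetilde R(Z,W,X,Y)=0$; (3) $\widetilde R(X,Y,V,W)=\widetilde R(V,W,X,Y)=0$; (4) $\widetilde R(X,V,Y,W)=\frac12bXY(b)g_F(V,W)-\frac12bg_B^*(\widetilde\nabla^\flat_XY,db)g_F(V,W)+\frac12bXJ_BY(b)g_F(V,J_FW)-\frac12bg_B^*(\widetilde\nabla^\flat_XY,db\circ J_B)g_F(V,J_FW)$; (5) $\widetilde R(X,V,W,U)=-\frac12\big(X(b)W(b)-bXW(b)\big)g_F(V,U)-\frac12\big(X(b)J_FW(b)-bXJ_FW(b)\big)g_F(V,J_FU)+\frac12\big(X(b)U(b)-bXU(b)\big)g_F(V,W)+\frac12\big(X(b)J_FU(b)-bXJ_FU(b)\big)g_F(V,J_FW)$; (6) $\widetilde R(W,U,X,V)=\frac14\big(2bWX(b)-X(b)W(b)-J_BX(b)J_FW(b)\big)g_F(U,V)+\frac14\big(2bWJ_BX(b)-X(b)J_FW(b)-J_BX(b)W(b)\big)g_F(U,J_FV)-\frac14\big(2bUX(b)-X(b)U(b)-J_BX(b)J_FU(b)\big)g_F(W,V)-\frac14\big(2bUJ_BX(b)-X(b)J_FU(b)-J_BX(b)U(b)\big)g_F(W,J_FV)-\frac14bX(b)\big(\mathcal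 K_F(U,V,W)-\mathcal K_F(W,V,U)-\mathcal K_F(U,J_FV,J_FW)+\mathcal K_F(W,J_FV,J_FU)\big)+\frac14bJ_BX(b)\big(\mathcal K_F(U,V,J_FW)-\mathcal K_F(W,V,J_FU)-\mathcal K_F(U,J_FV,W)+\mathcal K_F(W,J_FV,U)\big)$; (7) $\widetilde R(U,V,W,Q)=b^2\widetilde R_F(U,V,W,Q)+\frac14\big(b^2g_B^*(db,db)+g_F^*(db,db)\big)\big(g_F(U,W)g_F(V,Q)-g_F(V,W)g_F(U,Q)\big)+\frac14\big(b^2g_B^*(db\circ J_B,db\circ J_B)+g_F^*(db\circ J_F,db\circ J_F)\big)\big(g_F(U,J_FW)g_F(V,J_FQ)-g_F(V,J_FW)g_F(U,J_FQ)\big)+\frac14\big(b^2g_B^*(db\circ J_B,db)+g_F^*(db\circ J_F,db)\big)\big(g_F(U,J_FW)g_F(V,Q)-g_F(V,J_FW)g_F(U,Q)+g_F(U,W)g_F(V,J_FQ)-g_F(V,W)g_F(U,J_FQ)\big)$ $-\frac14\big(3U(b)W(b)-2bUW(b)+J_FU(b)J_FW(b)+2bg_F^*(\widetilde\nabla^\flat_UW,db)\big)g_F(V,Q)$ $-\frac14\big(3U(b)J_FW(b)-2bUJ_FW(b)+J_FU(b)W(b)+2bg_F^*(\widetilde\nabla^\flat_UW,db\circ J_F)\big)g_F(V,J_FQ)$ $-\frac14\big(3V(b)Q(b)-2bVQ(b)+J_FV(b)J_FQ(b)+2bg_F^*(\widetilde\nabla^\flat_VQ,db)\big)g_F(U,W)$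 $-\frac14\big(3V(b)J_FQ(b)-2bVJ_FQ(b)+J_FV(b)Q(b)+2bg_F^*(\widetilde\nabla^\flat_VQ,db\circ J_F)\big)g_F(U,J_FW)$ $+\frac14\big(3V(b)W(b)-2bVW(b)+J_FV(b)J_FW(b)+2bg_F^*(\widetilde\nabla^\flat_VW,db)\big)g_F(U,Q)$ $+\frac14\big(3V(b)J_FW(b)-2bVJ_FW(b)+J_FV(b)W(b)+2bg_F^*(\widetilde\nabla^\flat_VW,db\circ J_F)\big)g_F(U,J_FQ)$ $+\frac14\big(3U(b)Q(b)-2bUQ(b)+J_FU(b)J_FQ(b)+2bg_F^*(\widetilde\nabla^\flat_UQ,db)\big)g_F(V,W)$ $+\frac14\big(3U(b)J_FQ(b)-2bUJ_FQ(b)+J_FU(b)Q(b)+2bg_F^*(\widetilde\nabla^\flat_UQ,db\circ J_F)\big)g_F(V,J_FW)$ $+\frac14bQ(b)\big(\mathcal K_F(V,W,U)-\mathcal K_F(U,W,V)-\mathcal K_F(V,J_FW,J_FU)+\mathcal K_F(U,J_FW,J_FV)\big)$ $-\frac14bJ_FQ(b)\big(\mathcal K_F(V,W,J_FU)-\mathcal K_F(U,W,J_FV)-\mathcal K_F(V,J_FW,U)+\mathcal K_F(U,J_FW,V)\big)$ $-\frac14bW(b)\big(\mathcal K_F(V,Q,U)-\mathcal K_F(U,Q,V)-\mathcal K_F(V,J_FQ,J_FU)+\mathcal K_F(U,J_FQ,J_FV)\big)$ $+\frac14bJ_FW(b)\big(\mathcal K_F(V,Q,J_FU)-\mathcal K_F(U,Q,J_FV)-\mathcal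 K_F(V,J_FQ,U)+\mathcal K_F(U,J_FQ,V)\big)$.
   Context: A singular semi-Riemannian manifold $(M,g)$ is a smooth manifold with a smooth symmetric bilinear form $g$ on $TM$, possibly degenerate and of variable signature; it is non-degenerate if $g$ is non-degenerate everywhere. Its Koszul form is $\mathcal K(X,Y,Z)=\frac12\{X(g(Y,Z))+Y(g(Z,X))-Z(g(X,Y))-g(X,[Y,Z])+g(Y,[Z,X])+g(Z,[X,Y])\}$. It is almost product if equipped with a bundle endomorphism $J:TM\to TM$ with $J^2=\mathrm{id}$ and $g(JX,JY)=g(X,Y)$. The almost product Koszul form is $\widetilde{\mathcal K}(X,Y,Z)=\frac12[\mathcal K(X,Y,Z)+\mathcal K(X,JY,JZ)]$, and $(\widetilde\nabla^\flat_XY)(Z)=\widetilde{\mathcal K}(X,Y,Z)$. Contraction: let $T_p^\bullet M=\{g_p(v,\cdot):v\in T_pM\}\subset T_p^*M$ with inner product $g_p^\bullet(g_p(v,\cdot),g_p(w,\cdot))=g_p(v,w)$. For 1-forms $\omega,\tau$ with values in $T^\bullet M$, $\omega(\bullet)\tau(\bullet)$ is the function $p\mapsto g^\bullet_p(\omega_p,\tau_p)$ on the dense open set where the rank of $g$ is locally constant; it is called smooth if it extends (uniquely) to a smooth function on $M$, and then the same symbol denotes the extension. $(M,g,J)$ is almost product radical-stationary if $\widetilde{\mathcal K}(X,Y,\cdot)$ takes values in $T^\bullet M$ for all vector fields $X,Y$, and almost product semi-regular if moreover all $\widetilde{\mathcal K}(X,Y,\bullet)\widetilde{\mathcal K}(Z,T,\bullet)$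 are smooth. On an almost product semi-regular manifold the almost product curvature is $\widetilde R(X,Y,Z,T)=X(\widetilde{\mathcal K}(Y,Z,T))-Y(\widetilde{\mathcal K}(X,Z,T))-\widetilde{\mathcal K}([X,Y],Z,T)+\widetilde{\mathcal K}(X,Z,\bullet)\widetilde{\mathcal K}(Y,T,\bullet)-\widetilde{\mathcal K}(Y,Z,\bullet)\widetilde{\mathcal K}(X,T,\bullet)$. The twisted product $B\times_bF$ with twisting function $b:B\times F\to\mathbb R$ (smooth, possibly vanishing) is $B\times F$ with $g=\pi_B^*(g_B)+b^2\pi_F^*(g_F)$, $\pi_B,\pi_F$ the canonical projections; $J$ acts as $J_B$ on $TB$ and $J_F$ on $TF$. Under the hypotheses of the claim it is almost product semi-regular. Vector fields in $\Gamma(TB)$, $\Gamma(TF)$ are identified with their lifts to the product, and functions and tensors on the factors with their pullbacks. Subscripts $B$, $F$ denote objects of that factor. $g_B^*$, $g_F^*$ are the inverse metrics of $g_B$, $g_F$ applied to the restrictions of 1-forms to $TB$, resp. $TF$; in $g_B^*(\widetilde\nabla^\flat_XY,\cdot)$ one has $\widetilde\nabla^\flat_XY=\widetilde{\mathcal K}_B(X,Y,\cdot)$, and in $g_F^*(\widetilde\nabla^\flat_UW,\cdot)$ one has $\widetilde\nabla^\flat_UW=\widetilde{\mathcal K}_F(U,W,\cdot)$. For vector fields $A,C$ and $J_\ast\in\{J_B,J_F\}$: $AC(f)=A(C(f))$, $J_\ast C(f)=(J_\ast C)(f)$, $AJ_\ast C(f)=A((J_\ast C)(f))$, and $(db\circ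 J_\ast)(C)=(J_\ast C)(b)$. *)

theory Defs
  imports "HOL-Analysis.Analysis" "HOL-Library.Function_Algebras"
begin

instantiation "fun" :: (type, real_vector) real_vector
begin

definition "c *\<^sub>R f = (\<lambda>x. c *\<^sub>R f x)"

instance
  by standard (simp_all add: scaleR_fun_def fun_eq_iff scaleR_add_left scaleR_add_right)

end

section \<open>Smooth manifolds\<close>

text \<open>\<open>Ck_on\<close> is used on open subsets of finite-dimensional spaces only; there the continuity of
  all iterated directional derivatives is the usual notion of a \<open>C\<^sup>k\<close> map.\<close>

primrec Ck_on :: "nat \<Rightarrow> 'a::real_normed_vector set \<Rightarrow> ('a \<Rightarrow> 'b::real_normed_vector) \<Rightarrow> bool" where
  "Ck_on 0 S f \<longleftrightarrow> continuous_on S f"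
| "Ck_on (Suc k) S f \<longleftrightarrow>
     f differentiable_on S \<and> (\<forall>v. Ck_on k S (\<lambda>x. frechet_derivative f (at x) v))"

definition smooth_on :: "'a::real_normed_vector set \<Rightarrow> ('a \<Rightarrow> 'b::real_normed_vector) \<Rightarrow> bool" where
  "smooth_on S f \<longleftrightarrow> (\<forall>k. Ck_on k S f)"

text \<open>The underlying set of a manifold is a whole type; a chart is a pair of its domain and its
  coordinate map, whose values outside the domain are irrelevant.\<close>

type_synonym ('m, 'e) atlas = "('m set \<times> ('m \<Rightarrow> 'e)) set"

definition smooth_atlas ::
    "('m::topological_space, 'e::real_normed_vector) atlas \<Rightarrow> bool" where
  "smooth_atlas A \<longleftrightarrow>
     (\<forall>(U, \<phi>)\<in>A. open U \<and> open (\<phi> ` U) \<and> homeomorphism U (\<phi> ` U) \<phi> (inv_into U \<phi>)) \<and>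
     (\<Union>(U, \<phi>)\<in>A. U) = UNIV \<and>
     (\<forall>(U, \<phi>)\<in>A. \<forall>(V, \<psi>)\<in>A. smooth_on (\<phi> ` (U \<inter> V)) (\<psi> \<circ> inv_into U \<phi>))"

definition smooth_functions :: "('m, 'e::real_normed_vector) atlas \<Rightarrow> ('m \<Rightarrow> real) set" where
  "smooth_functions A = {f. \<forall>(U, \<phi>)\<in>A. smooth_on (\<phi> ` U) (f \<circ> inv_into U \<phi>)}"

text \<open>Tangent vectors are derivations of the algebra of smooth functions, extended by \<open>0\<close> to all
  functions so that equality of tangent vectors is equality of functions.\<close>

type_synonym 'm tvec = "('m \<Rightarrow> real) \<Rightarrow> real"
type_synonym 'm vfield = "'m \<Rightarrow> 'm tvec"

definition tangent_space :: "('m, 'e::real_normed_vector) atlas \<Rightarrow> 'm \<Rightarrow> 'm tvec set" where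
  "tangent_space A p = {v.
     (\<forall>f\<in>smooth_functions A. \<forall>h\<in>smooth_functions A.
        (\<forall>a c. v (a *\<^sub>R f + c *\<^sub>R h) = a * v f + c * v h) \<and>
        v (f * h) = f p * v h + h p * v f) \<and>
     (\<forall>f. f \<notin> smooth_functions A \<longrightarrow> v f = 0)}"

definition deriv_along :: "'m vfield \<Rightarrow> ('m \<Rightarrow> real) \<Rightarrow> 'm \<Rightarrow> real" where
  "deriv_along X f = (\<lambda>p. X p f)"

definition vector_fields :: "('m, 'e::real_normed_vector) atlas \<Rightarrow> 'm vfield set" where
  "vector_fields A = {X. (\<forall>p. X p \<in> tangent_space A p) \<and>
     (\<forall>f\<in>smooth_functions A. deriv_along X f \<in> smooth_functions A)}"

definition bracket :: "'m vfield \<Rightarrow> 'm vfield \<Rightarrow> 'm vfield" where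
  "bracket X Y = (\<lambda>p f. X p (deriv_along Y f) - Y p (deriv_along X f))"

text \<open>The differential at a point of a smooth map \<open>h\<close> into a manifold with atlas \<open>A\<close>.\<close>

definition pushforward :: "('n, 'f::real_normed_vector) atlas \<Rightarrow> ('m \<Rightarrow> 'n) \<Rightarrow> 'm tvec \<Rightarrow> 'n tvec" where
  "pushforward A h v = (\<lambda>f. if f \<in> smooth_functions A then v (f \<circ> h) else 0)"

definition prod_atlas :: "('m, 'e) atlas \<Rightarrow> ('n, 'f) atlas \<Rightarrow> ('m \<times> 'n, 'e \<times> 'f) atlas" where
  "prod_atlas A A' = {(U \<times> V, map_prod \<phi> \<psi>) | U \<phi> V \<psi>. (U, \<phi>) \<in> A \<and> (V, \<psi>) \<in> A'}"

section \<open>Almost product singular semi-Riemannian manifolds\<close>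

record ('m, 'e) almost_product =
  atlas :: "('m, 'e) atlas"
  metric :: "'m \<Rightarrow> 'm tvec \<Rightarrow> 'm tvec \<Rightarrow> real"
  endo :: "'m \<Rightarrow> 'm tvec \<Rightarrow> 'm tvec"

abbreviation tangent :: "('m, 'e::real_normed_vector) almost_product \<Rightarrow> 'm \<Rightarrow> 'm tvec set" where
  "tangent M \<equiv> tangent_space (atlas M)"

abbreviation vfields :: "('m, 'e::real_normed_vector) almost_product \<Rightarrow> 'm vfield set" where
  "vfields M \<equiv> vector_fields (atlas M)"

abbreviation smooth :: "('m, 'e::real_normed_vector) almost_product \<Rightarrow> ('m \<Rightarrow> real) set" where
  "smooth M \<equiv> smooth_functions (atlas M)"

definition g_of :: "('m, 'e) almost_product \<Rightarrow> 'm vfield \<Rightarrow> 'm vfield \<Rightarrow> 'm \<Rightarrow> real" where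
  "g_of M X Y = (\<lambda>p. metric M p (X p) (Y p))"

definition J_of :: "('m, 'e) almost_product \<Rightarrow> 'm vfield \<Rightarrow> 'm vfield" where
  "J_of M X = (\<lambda>p. endo M p (X p))"

text \<open>The sort \<open>{real_inner, heine_borel}\<close> of the model space expresses finite dimension; unlike
  \<open>euclidean_space\<close> it admits dimension \<open>0\<close>.\<close>

definition almost_product_manifold ::
    "('m::{t2_space, second_countable_topology}, 'e::{real_inner, heine_borel}) almost_product
      \<Rightarrow> bool" where
  "almost_product_manifold M \<longleftrightarrow>
     smooth_atlas (atlas M) \<and>
     (\<forall>p. \<forall>u\<in>tangent M p. \<forall>v\<in>tangent M p. \<forall>w\<in>tangent M p. \<forall>a c.
        metric M p (a *\<^sub>R u + c *\<^sub>R v) w = a * metric M p u w + c * metric M p v w) \<and>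
     (\<forall>p. \<forall>v\<in>tangent M p. \<forall>w\<in>tangent M p. metric M p v w = metric M p w v) \<and>
     (\<forall>X\<in>vfields M. \<forall>Y\<in>vfields M. g_of M X Y \<in> smooth M) \<and>
     (\<forall>p. \<forall>v\<in>tangent M p. endo M p v \<in> tangent M p \<and> endo M p (endo M p v) = v) \<and>
     (\<forall>p. \<forall>v\<in>tangent M p. \<forall>w\<in>tangent M p. \<forall>a c.
        endo M p (a *\<^sub>R v + c *\<^sub>R w) = a *\<^sub>R endo M p v + c *\<^sub>R endo M p w) \<and>
     (\<forall>X\<in>vfields M. J_of M X \<in> vfields M) \<and>
     (\<forall>p. \<forall>v\<in>tangent M p. \<forall>w\<in>tangent M p.
        metric M p (endo M p v) (endo M p w) = metric M p v w)"

definition nondegenerate :: "('m, 'e::real_normed_vector) almost_product \<Rightarrow> bool" where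
  "nondegenerate M \<longleftrightarrow>
     (\<forall>p. \<forall>v\<in>tangent M p. (\<forall>w\<in>tangent M p. metric M p v w = 0) \<longrightarrow> v = 0)"

definition koszul ::
    "('m, 'e) almost_product \<Rightarrow> 'm vfield \<Rightarrow> 'm vfield \<Rightarrow> 'm vfield \<Rightarrow> 'm \<Rightarrow> real" where
  "koszul M X Y Z = (\<lambda>p. 1/2 *
     (deriv_along X (g_of M Y Z) p + deriv_along Y (g_of M Z X) p - deriv_along Z (g_of M X Y) p
      - g_of M X (bracket Y Z) p + g_of M Y (bracket Z X) p + g_of M Z (bracket X Y) p))"

definition ap_koszul ::
    "('m, 'e) almost_product \<Rightarrow> 'm vfield \<Rightarrow> 'm vfield \<Rightarrow> 'm vfield \<Rightarrow> 'm \<Rightarrow> real" where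
  "ap_koszul M X Y Z = (\<lambda>p. 1/2 * (koszul M X Y Z p + koszul M X (J_of M Y) (J_of M Z) p))"

text \<open>The 1-form \<open>ap_koszul M X Y\<close> as a family of covectors: being tensorial in its last argument,
  it may be evaluated at a tangent vector by means of any vector field extending it.\<close>

definition nabla_flat ::
    "('m, 'e::real_normed_vector) almost_product \<Rightarrow> 'm vfield \<Rightarrow> 'm vfield
      \<Rightarrow> 'm \<Rightarrow> 'm tvec \<Rightarrow> real" where
  "nabla_flat M X Y = (\<lambda>p v. ap_koszul M X Y (SOME Z. Z \<in> vfields M \<and> Z p = v) p)"

section \<open>Contraction and curvature\<close>

definition flat ::
    "('m, 'e::real_normed_vector) almost_product \<Rightarrow> 'm \<Rightarrow> 'm tvec \<Rightarrow> 'm tvec \<Rightarrow> real" where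
  "flat M p v = (\<lambda>w. if w \<in> tangent M p then metric M p v w else 0)"

definition radical_annihilator ::
    "('m, 'e::real_normed_vector) almost_product \<Rightarrow> 'm \<Rightarrow> ('m tvec \<Rightarrow> real) set" where
  "radical_annihilator M p = flat M p ` tangent M p"

definition metric_rank :: "('m, 'e::real_normed_vector) almost_product \<Rightarrow> 'm \<Rightarrow> nat" where
  "metric_rank M p = dim (radical_annihilator M p)"

definition regular_points ::
    "('m::topological_space, 'e::real_normed_vector) almost_product \<Rightarrow> 'm set" where
  "regular_points M =
     {p. \<exists>U. open U \<and> p \<in> U \<and> (\<forall>x\<in>U. metric_rank M x = metric_rank M p)}"

text \<open>\<open>cometric M p\<close> is the inner product on \<open>radical_annihilator M p\<close>; the vector chosen by
  \<open>sharp\<close> is unique up to the radical of the metric, which does not affect the result. For a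
  nondegenerate metric the radical annihilator is the whole cotangent space and \<open>cometric\<close> is the
  inverse metric. Covectors are compared on the tangent space only; outside the radical annihilator
  the value is unspecified.\<close>

definition sharp ::
    "('m, 'e::real_normed_vector) almost_product \<Rightarrow> 'm \<Rightarrow> ('m tvec \<Rightarrow> real) \<Rightarrow> 'm tvec" where
  "sharp M p \<alpha> = (SOME v. v \<in> tangent M p \<and> (\<forall>w\<in>tangent M p. flat M p v w = \<alpha> w))"

definition cometric ::
    "('m, 'e::real_normed_vector) almost_product \<Rightarrow> 'm
      \<Rightarrow> ('m tvec \<Rightarrow> real) \<Rightarrow> ('m tvec \<Rightarrow> real) \<Rightarrow> real" where
  "cometric M p \<alpha> \<beta> = metric M p (sharp M p \<alpha>) (sharp M p \<beta>)"

text \<open>The unique smooth extension of the contraction from the dense open set of regular points.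
  The value is unspecified if no such extension exists, i.e. if the contraction is not smooth.\<close>

definition contraction ::
    "('m::topological_space, 'e::real_normed_vector) almost_product
      \<Rightarrow> ('m \<Rightarrow> 'm tvec \<Rightarrow> real) \<Rightarrow> ('m \<Rightarrow> 'm tvec \<Rightarrow> real) \<Rightarrow> 'm \<Rightarrow> real" where
  "contraction M \<omega> \<tau> =
     (THE f. f \<in> smooth M \<and> (\<forall>p\<in>regular_points M. f p = cometric M p (\<omega> p) (\<tau> p)))"

definition ap_curvature ::
    "('m::topological_space, 'e::real_normed_vector) almost_product
      \<Rightarrow> 'm vfield \<Rightarrow> 'm vfield \<Rightarrow> 'm vfield \<Rightarrow> 'm vfield \<Rightarrow> 'm \<Rightarrow> real" where
  "ap_curvature M X Y Z T = (\<lambda>p.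
     deriv_along X (ap_koszul M Y Z T) p - deriv_along Y (ap_koszul M X Z T) p
     - ap_koszul M (bracket X Y) Z T p
     + contraction M (nabla_flat M X Z) (nabla_flat M Y T) p
     - contraction M (nabla_flat M Y Z) (nabla_flat M X T) p)"

section \<open>Twisted products\<close>

abbreviation atlas_prod ::
    "('m, 'e) almost_product \<Rightarrow> ('n, 'f) almost_product \<Rightarrow> ('m \<times> 'n, 'e \<times> 'f) atlas" where
  "atlas_prod B F \<equiv> prod_atlas (atlas B) (atlas F)"

text \<open>The inclusions of the tangent spaces of the factors at \<open>fst x\<close> and \<open>snd x\<close> into the tangent
  space of the product at \<open>x\<close>, and the resulting lifts of vector fields.\<close>

definition incl_fst ::
    "('m, 'e::real_normed_vector) almost_product \<Rightarrow> ('n, 'f::real_normed_vector) almost_product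
      \<Rightarrow> 'm \<times> 'n \<Rightarrow> 'm tvec \<Rightarrow> ('m \<times> 'n) tvec" where
  "incl_fst B F x = pushforward (atlas_prod B F) (\<lambda>p. (p, snd x))"

definition incl_snd ::
    "('m, 'e::real_normed_vector) almost_product \<Rightarrow> ('n, 'f::real_normed_vector) almost_product
      \<Rightarrow> 'm \<times> 'n \<Rightarrow> 'n tvec \<Rightarrow> ('m \<times> 'n) tvec" where
  "incl_snd B F x = pushforward (atlas_prod B F) (\<lambda>q. (fst x, q))"

definition lift_fst ::
    "('m, 'e::real_normed_vector) almost_product \<Rightarrow> ('n, 'f::real_normed_vector) almost_product
      \<Rightarrow> 'm vfield \<Rightarrow> ('m \<times> 'n) vfield" where
  "lift_fst B F X = (\<lambda>x. incl_fst B F x (X (fst x)))"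

definition lift_snd ::
    "('m, 'e::real_normed_vector) almost_product \<Rightarrow> ('n, 'f::real_normed_vector) almost_product
      \<Rightarrow> 'n vfield \<Rightarrow> ('m \<times> 'n) vfield" where
  "lift_snd B F U = (\<lambda>x. incl_snd B F x (U (snd x)))"

definition twisted_product ::
    "('m, 'e::real_normed_vector) almost_product \<Rightarrow> ('n, 'f::real_normed_vector) almost_product
      \<Rightarrow> ('m \<times> 'n \<Rightarrow> real) \<Rightarrow> ('m \<times> 'n, 'e \<times> 'f) almost_product" where
  "twisted_product B F b = \<lparr>
     atlas = atlas_prod B F,
     metric = (\<lambda>x v w.
       metric B (fst x) (pushforward (atlas B) fst v) (pushforward (atlas B) fst w)
       + (b x)\<^sup>2 * metric F (snd x) (pushforward (atlas F) snd v) (pushforward (atlas F) snd w)),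
     endo = (\<lambda>x v.
       incl_fst B F x (endo B (fst x) (pushforward (atlas B) fst v))
       + incl_snd B F x (endo F (snd x) (pushforward (atlas F) snd v)))\<rparr>"

end

theory Submission
  imports Defs "Jordan_Normal_Form.Determinant"
begin

text \<open>Write \<open>\<K>\<close> for the almost product Koszul form of the twisted product. All formulas are obtained by
  inserting lifted fields into the definition of the curvature, so two things have to be
  understood: \<open>\<K>\<close> on lifted fields, and the contraction.

  Lifts from different factors commute, and the lift is compatible with brackets, \<open>J\<close> and the metrics of
  the factors; hence the Koszul formula expresses \<open>\<K>\<close> on lifted fields through the Koszul forms of
  the factors, \<open>b\<close> and \<open>db\<close> (\<open>ap_koszul_lift\<close>). Every term that involves the fibre carries a factor \<open>b\<close>: on
  the fibre directions the form \<open>\<K>(A, C, \<bullet>)\<close> is \<open>b \<gamma>\<close>, where \<open>\<gamma>\<close> is a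
  combination of \<open>b\<close> and \<open>db\<close>. As \<open>db\<close> vanishes wherever \<open>b\<close> does, so does \<open>\<gamma>\<close>. The inverse metric of the
  fibre directions is \<open>g\<^sub>F\<close> inverse divided by \<open>b\<^sup>2\<close>, and this cancels the two factors \<open>b\<close>: with horizontal parts
  \<open>\<alpha>, \<alpha>'\<close>, the contraction of two such forms is \<open>g\<^sub>B\<^sup>*(\<alpha>, \<alpha>') + g\<^sub>F\<^sup>*(\<gamma>, \<gamma>')\<close> at every regular point, and
  this expression is smooth everywhere (\<open>contraction_split\<close>). Regular points are dense, because the rank
  of the metric depends only on whether \<open>b\<close> vanishes. What remains are identities between
  polynomials in the values of the metrics, Koszul forms and derivatives of \<open>b\<close>, modulo metric
  compatibility and torsion-freeness of the Koszul form.

  Tangent vectors are derivations, so this needs the local theory of derivations: cutoff functions make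
  them local, and Hadamard's lemma shows that they are determined by their values on coordinates
  (\<open>tangent_coordinates\<close>). It follows that local frames exist, that expressions linear over the smooth functions
  depend on point values only (\<open>tensorial\<close>), and that a tangent vector of a product is determined by its values on
  pullbacks from the factors (\<open>tangent_prod_eqI\<close>). The last fact gives the splitting of the tangent
  space and all brackets of lifted fields. Smoothness of the inverse metric is Cramer's rule for the Gram
  matrix of a frame (\<open>ex_local_sharp\<close>).\<close>

text \<open>The symbol is kept for the inner product.\<close>

no_notation Matrix.scalar_prod (infix "\<bullet>" 70)

section \<open>Finite orthonormal bases\<close>

text \<open>Distinct orthonormal vectors have distance \<open>sqrt 2\<close>, so they cannot
  accumulate in the compact unit ball.\<close>

lemma finite_orthonormal:
  fixes S :: "'a::{real_inner, heine_borel} set"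
  assumes S: "\<And>e e'. e \<in> S \<Longrightarrow> e' \<in> S \<Longrightarrow> e \<bullet> e' = (if e = e' then 1 else 0)"
  shows "finite S"
proof (rule ccontr)
  assume "infinite S"
  have "S \<subseteq> cball 0 1"
    using S by (auto simp: norm_eq_sqrt_inner)
  have "compact (cball (0::'a) 1)"
    by (simp add: compact_eq_bounded_closed)
  then obtain x where "x islimpt S"
    using Heine_Borel_imp_Bolzano_Weierstrass[OF _ \<open>infinite S\<close> \<open>S \<subseteq> cball 0 1\<close>] by blast
  then have "infinite (S \<inter> ball x (1/2))"
    by (simp add: islimpt_eq_infinite_ball)
  then obtain e where e: "e \<in> S \<inter> ball x (1/2)"
    using infinite_imp_nonempty by blast
  from \<open>infinite (S \<inter> ball x (1/2))\<close> have "infinite ((S \<inter> ball x (1/2)) - {e})"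
    by simp
  then obtain e' where e': "e' \<in> S \<inter> ball x (1/2)" "e' \<noteq> e"
    using infinite_imp_nonempty by blast
  have "dist e e' < 1"
    using e e' by (auto intro: dist_triangle_half_r simp: dist_commute)
  then have "(norm (e - e'))\<^sup>2 < 1"
    by (simp add: dist_norm power_less_one_iff)
  moreover have "(norm (e - e'))\<^sup>2 = 2"
    using S[of e e] S[of e' e'] S[of e e'] S[of e' e] e e'
    by (simp add: power2_norm_eq_inner inner_diff)
  ultimately show False by simp
qed

text \<open>A maximal orthonormal set spans: the component of a vector orthogonal to it could be
  normalized and added.\<close>

lemma ex_orthonormal_basis:
  "\<exists>S::'a::{real_inner, heine_borel} set. finite S \<and>
     (\<forall>e\<in>S. \<forall>e'\<in>S. e \<bullet> e' = (if e = e' then 1 else 0)) \<and> (\<forall>x. (\<Sum>e\<in>S. (x \<bullet> e) *\<^sub>R e) = x)"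
proof -
  define ON where "ON = {S::'a set. \<forall>e\<in>S. \<forall>e'\<in>S. e \<bullet> e' = (if e = e' then 1 else 0)}"
  have "\<exists>M\<in>ON. \<forall>X\<in>ON. M \<subseteq> X \<longrightarrow> X = M"
  proof (rule Zorn_Lemma2, rule ballI)
    fix C assume C: "C \<in> chains ON"
    have "\<Union>C \<in> ON"
      unfolding ON_def
    proof (intro CollectI ballI)
      fix e e' assume "e \<in> \<Union>C" "e' \<in> \<Union>C"
      then obtain S S' where S: "S \<in> C" "S' \<in> C" "e \<in> S" "e' \<in> S'" by auto
      then have "S \<subseteq> S' \<or> S' \<subseteq> S" using C by (auto simp: chains_def chain_subset_def)
      then obtain R where "R \<in> C" "e \<in> R" "e' \<in> R" using S by blast
      moreover have "R \<in> ON" using C \<open>R \<in> C\<close> by (auto simp: chains_def)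
      ultimately show "e \<bullet> e' = (if e = e' then 1 else 0)" by (simp add: ON_def)
    qed
    then show "\<exists>y\<in>ON. \<forall>x\<in>C. x \<subseteq> y" by blast
  qed
  then obtain S where S: "S \<in> ON" and max: "\<And>X. X \<in> ON \<Longrightarrow> S \<subseteq> X \<Longrightarrow> X = S" by blast
  have orth: "\<And>e e'. e \<in> S \<Longrightarrow> e' \<in> S \<Longrightarrow> e \<bullet> e' = (if e = e' then 1 else 0)"
    using S by (simp add: ON_def)
  have fin: "finite S" using finite_orthonormal[OF orth] .
  have "(\<Sum>e\<in>S. (x \<bullet> e) *\<^sub>R e) = x" for x
  proof (rule ccontr)
    assume ne: "(\<Sum>e\<in>S. (x \<bullet> e) *\<^sub>R e) \<noteq> x"
    define y where "y = x - (\<Sum>e\<in>S. (x \<bullet> e) *\<^sub>R e)"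
    have "y \<noteq> 0" using ne by (simp add: y_def)
    have y: "y \<bullet> e = 0" if "e \<in> S" for e
    proof -
      have "(\<Sum>e'\<in>S. (x \<bullet> e') * (e' \<bullet> e)) = (\<Sum>e'\<in>S. if e' = e then x \<bullet> e' else 0)"
        using that by (intro sum.cong) (auto simp: orth)
      then show ?thesis
        using that fin by (simp add: y_def inner_diff_left inner_sum_left)
    qed
    define z where "z = y /\<^sub>R norm y"
    have zz: "z \<bullet> z = 1" using \<open>y \<noteq> 0\<close> by (simp add: z_def dot_square_norm power2_eq_square)
    have z: "z \<bullet> e = 0" "e \<bullet> z = 0" if "e \<in> S" for e
      using y[OF that] by (simp_all add: z_def inner_commute)
    have z_notin: "z \<notin> S" using z(1)[of z] zz by auto
    have "insert z S \<in> ON"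
      using orth z zz z_notin by (auto simp: ON_def)
    then have "z \<in> S" using max by blast
    then show False using z_notin by blast
  qed
  then show ?thesis using fin orth by blast
qed

definition onb :: "'a::{real_inner, heine_borel} set" where
  "onb = (SOME S. finite S \<and>
     (\<forall>e\<in>S. \<forall>e'\<in>S. e \<bullet> e' = (if e = e' then 1 else 0)) \<and> (\<forall>x. (\<Sum>e\<in>S. (x \<bullet> e) *\<^sub>R e) = x))"

lemma onb:
  "finite (onb :: 'a::{real_inner, heine_borel} set) \<and>
    (\<forall>e\<in>onb. \<forall>e'\<in>onb. e \<bullet> (e'::'a) = (if e = e' then 1 else 0)) \<and>
    (\<forall>x::'a. (\<Sum>e\<in>onb. (x \<bullet> e) *\<^sub>R e) = x)"
  unfolding onb_def by (rule someI_ex[OF ex_orthonormal_basis])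

lemma finite_onb [simp]: "finite onb"
  and onb_orthonormal: "e \<in> onb \<Longrightarrow> e' \<in> onb \<Longrightarrow> e \<bullet> e' = (if e = e' then 1 else 0)"
  and onb_expansion: "(\<Sum>e\<in>onb. (x \<bullet> e) *\<^sub>R e) = x"
  using onb by blast+

lemma linear_onb:
  fixes L :: "'a::{real_inner, heine_borel} \<Rightarrow> 'b::real_vector"
  assumes "linear L"
  shows "L x = (\<Sum>e\<in>onb. (x \<bullet> e) *\<^sub>R L e)"
proof -
  have "L x = L (\<Sum>e\<in>onb. (x \<bullet> e) *\<^sub>R e)" by (simp add: onb_expansion)
  also have "\<dots> = (\<Sum>e\<in>onb. (x \<bullet> e) *\<^sub>R L e)"
    using assms by (simp add: linear_sum linear_cmul)
  finally show ?thesis .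
qed

section \<open>Smooth maps between open sets\<close>

lemma Ck_on_imp_continuous_on: "Ck_on k S f \<Longrightarrow> continuous_on S f"
  by (cases k) (auto intro: differentiable_imp_continuous_on)

lemma Ck_on_SucD: "Ck_on (Suc k) S f \<Longrightarrow> Ck_on k S f"
proof (induction k arbitrary: f)
  case 0
  then show ?case by (simp add: differentiable_imp_continuous_on)
next
  case (Suc k)
  then show ?case by (metis Ck_on.simps(2))
qed

lemma Ck_on_has_derivative:
  assumes "open S" "Ck_on (Suc k) S f" "x \<in> S"
  shows "(f has_derivative frechet_derivative f (at x)) (at x)"
  using assms by (auto simp: differentiable_on_def frechet_derivative_works[symmetric]
      at_within_open[OF assms(3,1)])

lemma frechet_derivative_cong_open:
  assumes "open S" "x \<in> S" "\<And>y. y \<in> S \<Longrightarrow> f y = g y"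
  shows "frechet_derivative f (at x) = frechet_derivative g (at x)"
proof -
  have "(f has_derivative D) (at x) \<longleftrightarrow> (g has_derivative D) (at x)" for D
    using assms has_derivative_transform_within_open[of f D x UNIV S g]
      has_derivative_transform_within_open[of g D x UNIV S f] by auto
  then show ?thesis by (simp add: frechet_derivative_def)
qed

lemma Ck_on_cong:
  assumes "open S" "\<And>x. x \<in> S \<Longrightarrow> f x = g x" "Ck_on k S f"
  shows "Ck_on k S g"
  using assms(2,3)
proof (induction k arbitrary: f g)
  case 0
  then show ?case by (simp cong: continuous_on_cong)
next
  case (Suc k)
  have "g differentiable_on S"
    unfolding differentiable_on_def
  proof
    fix x assume x: "x \<in> S"
    from Ck_on_has_derivative[OF assms(1) Suc.prems(2) x]
    have "(g has_derivative frechet_derivative f (at x)) (at x)"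
      by (rule has_derivative_transform_within_open[OF _ assms(1) x]) (use Suc.prems in auto)
    then show "g differentiable at x within S"
      using differentiable_def differentiable_at_withinI by blast
  qed
  moreover have "Ck_on k S (\<lambda>x. frechet_derivative g (at x) v)" for v
    by (rule Suc.IH[of "\<lambda>x. frechet_derivative f (at x) v"])
      (use Suc.prems frechet_derivative_cong_open[OF assms(1)] in \<open>metis, simp\<close>)
  ultimately show ?case by simp
qed

lemma Ck_on_SucI:
  assumes "open S" "\<And>x. x \<in> S \<Longrightarrow> (f has_derivative f' x) (at x)"
    and "\<And>v. Ck_on k S (\<lambda>x. f' x v)"
  shows "Ck_on (Suc k) S f"
proof -
  have "f differentiable_on S"
    using assms(2) by (meson differentiable_at_imp_differentiable_on differentiable_def)
  moreover have "Ck_on k S (\<lambda>x. frechet_derivative f (at x) v)" for v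
    by (rule Ck_on_cong[OF assms(1) _ assms(3)[of v]])
      (use assms(2) frechet_derivative_at in metis)
  ultimately show ?thesis by simp
qed

lemma Ck_on_subset: "Ck_on k T f \<Longrightarrow> S \<subseteq> T \<Longrightarrow> Ck_on k S f"
  by (induction k arbitrary: f) (auto intro: continuous_on_subset differentiable_on_subset)

lemma Ck_on_local:
  assumes "\<And>x. x \<in> S \<Longrightarrow> \<exists>T. open T \<and> x \<in> T \<and> Ck_on k T f"
  shows "Ck_on k S f"
  using assms
proof (induction k arbitrary: f)
  case 0
  show ?case
    unfolding Ck_on.simps continuous_on_eq_continuous_within
  proof
    fix x assume "x \<in> S"
    then obtain T where "open T" "x \<in> T" "continuous_on T f" using 0 by auto
    then have "continuous (at x) f" by (simp add: continuous_on_eq_continuous_at)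
    then show "continuous (at x within S) f" by (rule continuous_at_imp_continuous_at_within)
  qed
next
  case (Suc k)
  have "f differentiable_on S"
    unfolding differentiable_on_def
  proof
    fix x assume "x \<in> S"
    then obtain T where "open T" "x \<in> T" "Ck_on (Suc k) T f" using Suc.prems by blast
    then show "f differentiable at x within S"
      using Ck_on_has_derivative differentiable_def differentiable_at_withinI by blast
  qed
  moreover have "Ck_on k S (\<lambda>x. frechet_derivative f (at x) v)" for v
    using Suc.prems by (intro Suc.IH) (metis Ck_on.simps(2))
  ultimately show ?case by simp
qed

lemma Ck_on_const: "Ck_on k S (\<lambda>x. c)"
  by (induction k arbitrary: c) auto

lemma Ck_on_bounded_linear:
  assumes "open S" "bounded_linear L" "Ck_on k S f"
  shows "Ck_on k S (\<lambda>x. L (f x))"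
  using assms(3)
proof (induction k arbitrary: f)
  case 0
  then show ?case
    using assms(2) by (simp add: bounded_linear.continuous_on)
next
  case (Suc k)
  show ?case
  proof (rule Ck_on_SucI[OF assms(1)])
    fix x assume "x \<in> S"
    from bounded_linear.has_derivative[OF assms(2) Ck_on_has_derivative[OF assms(1) Suc.prems this]]
    show "((\<lambda>x. L (f x)) has_derivative (\<lambda>v. L (frechet_derivative f (at x) v))) (at x)" .
  next
    fix v show "Ck_on k S (\<lambda>x. L (frechet_derivative f (at x) v))"
      using Suc by simp
  qed
qed

lemma Ck_on_id: "open S \<Longrightarrow> Ck_on k S (\<lambda>x. x)"
proof (induction k)
  case (Suc k)
  show ?case
    by (rule Ck_on_SucI[OF Suc.prems, where f' = "\<lambda>x v. v"])
      (auto intro: has_derivative_ident Ck_on_const)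
qed simp

lemma Ck_on_add:
  assumes "open S" "Ck_on k S f" "Ck_on k S g"
  shows "Ck_on k S (\<lambda>x. f x + g x)"
  using assms(2,3)
proof (induction k arbitrary: f g)
  case 0
  then show ?case by (simp add: continuous_on_add)
next
  case (Suc k)
  note D = Ck_on_has_derivative[OF assms(1)]
  show ?case
    by (rule Ck_on_SucI[OF assms(1)],
        rule has_derivative_add[OF D[OF Suc.prems(1)] D[OF Suc.prems(2)]])
      (use Suc in auto)
qed

lemma Ck_on_sum:
  assumes "open S" "\<And>i. i \<in> I \<Longrightarrow> Ck_on k S (f i)"
  shows "Ck_on k S (\<lambda>x. \<Sum>i\<in>I. f i x)"
  using assms(2)
  by (induction I rule: infinite_finite_induct) (auto intro: Ck_on_const Ck_on_add[OF assms(1)])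

lemma Ck_on_scaleR:
  assumes "open S" "Ck_on k S f" "Ck_on k S g"
  shows "Ck_on k S (\<lambda>x. f x *\<^sub>R g x)"
  using assms(2,3)
proof (induction k arbitrary: f g)
  case 0
  then show ?case by (simp add: continuous_on_scaleR)
next
  case (Suc k)
  note D = Ck_on_has_derivative[OF assms(1)]
  show ?case
  proof (rule Ck_on_SucI[OF assms(1)],
        rule has_derivative_scaleR[OF D[OF Suc.prems(1)] D[OF Suc.prems(2)]])
    fix v
    show "Ck_on k S (\<lambda>x. f x *\<^sub>R frechet_derivative g (at x) v + frechet_derivative f (at x) v *\<^sub>R g x)"
      using Suc.prems Suc.prems[THEN Ck_on_SucD] by (intro Ck_on_add[OF assms(1)] Suc.IH) auto
  qed
qed

lemma Ck_on_mult:
  fixes f g :: "'a::real_normed_vector \<Rightarrow> real"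
  assumes "open S" "Ck_on k S f" "Ck_on k S g"
  shows "Ck_on k S (\<lambda>x. f x * g x)"
  using Ck_on_scaleR[OF assms] by simp

lemma Ck_on_inverse:
  fixes f :: "'a::real_normed_vector \<Rightarrow> real"
  assumes "open S" "Ck_on k S f" "\<And>x. x \<in> S \<Longrightarrow> f x \<noteq> 0"
  shows "Ck_on k S (\<lambda>x. inverse (f x))"
  using assms(2)
proof (induction k)
  case 0
  then show ?case using assms(3) by (simp add: continuous_on_inverse)
next
  case (Suc k)
  have IH: "Ck_on k S (\<lambda>x. inverse (f x))" using Suc by (simp add: Ck_on_SucD del: Ck_on.simps)
  show ?case
  proof (rule Ck_on_SucI[OF assms(1)])
    fix x assume "x \<in> S"
    from Ck_on_has_derivative[OF assms(1) Suc.prems this] assms(3)[OF this]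
    show "((\<lambda>x. inverse (f x)) has_derivative
      (\<lambda>v. - 1 * (inverse (f x) * (frechet_derivative f (at x) v * inverse (f x))))) (at x)"
      by (auto intro!: derivative_eq_intros)
  next
    fix v
    show "Ck_on k S (\<lambda>x. - 1 * (inverse (f x) * (frechet_derivative f (at x) v * inverse (f x))))"
      using Suc.prems IH by (intro Ck_on_mult[OF assms(1)] Ck_on_const) auto
  qed
qed

text \<open>The derivative of a composition contains the derivative of the outer map in a direction that
  varies with the point; expanding that direction in an orthonormal basis reduces it to the iterated
  directional derivatives in fixed directions that \<open>Ck_on\<close> is about.\<close>

lemma Ck_on_compose:
  fixes g :: "'a::real_normed_vector \<Rightarrow> 'b::{real_inner, heine_borel}"
    and f :: "'b \<Rightarrow> 'c::real_normed_vector"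
  assumes "open S" "open T" "Ck_on k S g" "Ck_on k T f" "g ` S \<subseteq> T"
  shows "Ck_on k S (\<lambda>x. f (g x))"
  using assms(3,4)
proof (induction k arbitrary: f)
  case 0
  then show ?case using assms(5) by (auto intro: continuous_on_compose2)
next
  case (Suc k)
  note Dg = Ck_on_has_derivative[OF assms(1) Suc.prems(1)]
  note Df = Ck_on_has_derivative[OF assms(2) Suc.prems(2)]
  have gk: "Ck_on k S g" using Suc.prems(1) by (rule Ck_on_SucD)
  show ?case
  proof (rule Ck_on_SucI[OF assms(1)])
    fix x assume x: "x \<in> S"
    then have gx: "g x \<in> T" using assms(5) by auto
    have lin: "linear (frechet_derivative f (at (g x)))"
      using Df[OF gx] has_derivative_linear by blast
    have "((\<lambda>x. f (g x)) has_derivative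
        (\<lambda>v. frechet_derivative f (at (g x)) (frechet_derivative g (at x) v))) (at x)"
      using has_derivative_compose[OF Dg[OF x] Df[OF gx]] .
    also have "(\<lambda>v. frechet_derivative f (at (g x)) (frechet_derivative g (at x) v)) =
      (\<lambda>v. \<Sum>e\<in>onb. (frechet_derivative g (at x) v \<bullet> e) *\<^sub>R frechet_derivative f (at (g x)) e)"
      by (rule ext) (rule linear_onb[OF lin])
    finally show "((\<lambda>x. f (g x)) has_derivative
      (\<lambda>v. \<Sum>e\<in>onb. (frechet_derivative g (at x) v \<bullet> e) *\<^sub>R frechet_derivative f (at (g x)) e)) (at x)" .
  next
    fix v
    show "Ck_on k S (\<lambda>x. \<Sum>e\<in>onb.
        (frechet_derivative g (at x) v \<bullet> e) *\<^sub>R frechet_derivative f (at (g x)) e)"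
    proof (intro Ck_on_sum Ck_on_scaleR assms(1))
      fix e :: 'b
      show "Ck_on k S (\<lambda>x. frechet_derivative g (at x) v \<bullet> e)"
        using Suc.prems(1)
        by (intro Ck_on_bounded_linear[OF assms(1) bounded_linear_inner_left]) auto
      show "Ck_on k S (\<lambda>x. frechet_derivative f (at (g x)) e)"
        using Suc.prems(2) by (intro Suc.IH gk) auto
    qed
  qed
qed

lemma Ck_on_Pair:
  assumes "open S" "Ck_on k S f" "Ck_on k S g"
  shows "Ck_on k S (\<lambda>x. (f x, g x))"
proof -
  have "Ck_on k S (\<lambda>x. (f x, 0) + (0, g x))"
    by (intro Ck_on_add assms(1) Ck_on_bounded_linear[OF assms(1) _ assms(2)]
        Ck_on_bounded_linear[OF assms(1) _ assms(3)] bounded_linear_Pair bounded_linear_zero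
        bounded_linear_ident)
  then show ?thesis by simp
qed

lemma smooth_on_subset: "smooth_on T f \<Longrightarrow> S \<subseteq> T \<Longrightarrow> smooth_on S f"
  by (auto simp: smooth_on_def intro: Ck_on_subset)

lemma smooth_on_cong: "open S \<Longrightarrow> smooth_on S f \<Longrightarrow> (\<And>x. x \<in> S \<Longrightarrow> f x = g x) \<Longrightarrow> smooth_on S g"
  using Ck_on_cong unfolding smooth_on_def by blast

lemma smooth_on_local:
  "(\<And>x. x \<in> S \<Longrightarrow> \<exists>T. open T \<and> x \<in> T \<and> smooth_on T f) \<Longrightarrow> smooth_on S f"
  unfolding smooth_on_def by (intro allI Ck_on_local) meson

lemma smooth_on_const: "smooth_on S (\<lambda>x. c)"
  by (simp add: smooth_on_def Ck_on_const)

lemma smooth_on_id: "open S \<Longrightarrow> smooth_on S (\<lambda>x. x)"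
  by (simp add: smooth_on_def Ck_on_id)

lemma smooth_on_bounded_linear:
  "open S \<Longrightarrow> bounded_linear L \<Longrightarrow> smooth_on S f \<Longrightarrow> smooth_on S (\<lambda>x. L (f x))"
  by (simp add: smooth_on_def Ck_on_bounded_linear)

lemma smooth_on_add:
  "open S \<Longrightarrow> smooth_on S f \<Longrightarrow> smooth_on S g \<Longrightarrow> smooth_on S (\<lambda>x. f x + g x)"
  by (simp add: smooth_on_def Ck_on_add)

lemma smooth_on_sum:
  "open S \<Longrightarrow> (\<And>i. i \<in> I \<Longrightarrow> smooth_on S (f i)) \<Longrightarrow> smooth_on S (\<lambda>x. \<Sum>i\<in>I. f i x)"
  by (simp add: smooth_on_def Ck_on_sum)

lemma smooth_on_mult:
  fixes f g :: "'a::real_normed_vector \<Rightarrow> real"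
  shows "open S \<Longrightarrow> smooth_on S f \<Longrightarrow> smooth_on S g \<Longrightarrow> smooth_on S (\<lambda>x. f x * g x)"
  by (simp add: smooth_on_def Ck_on_mult)

lemma smooth_on_inverse:
  fixes f :: "'a::real_normed_vector \<Rightarrow> real"
  shows "open S \<Longrightarrow> smooth_on S f \<Longrightarrow> (\<And>x. x \<in> S \<Longrightarrow> f x \<noteq> 0) \<Longrightarrow> smooth_on S (\<lambda>x. inverse (f x))"
  by (simp add: smooth_on_def Ck_on_inverse)

lemma smooth_on_compose:
  fixes g :: "'a::real_normed_vector \<Rightarrow> 'b::{real_inner, heine_borel}"
    and f :: "'b \<Rightarrow> 'c::real_normed_vector"
  shows "open S \<Longrightarrow> open T \<Longrightarrow> smooth_on S g \<Longrightarrow> smooth_on T f \<Longrightarrow> g ` S \<subseteq> T \<Longrightarrow>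
    smooth_on S (\<lambda>x. f (g x))"
  unfolding smooth_on_def by (blast intro: Ck_on_compose)

lemma smooth_on_Pair:
  "open S \<Longrightarrow> smooth_on S f \<Longrightarrow> smooth_on S g \<Longrightarrow> smooth_on S (\<lambda>x. (f x, g x))"
  by (simp add: smooth_on_def Ck_on_Pair)

lemma smooth_on_has_derivative:
  "open S \<Longrightarrow> smooth_on S f \<Longrightarrow> x \<in> S \<Longrightarrow> (f has_derivative frechet_derivative f (at x)) (at x)"
  using Ck_on_has_derivative unfolding smooth_on_def by blast

lemma smooth_on_directional_derivative:
  "smooth_on S f \<Longrightarrow> smooth_on S (\<lambda>x. frechet_derivative f (at x) v)"
  unfolding smooth_on_def by (metis Ck_on.simps(2))

lemma smooth_on_imp_continuous_on: "smooth_on S f \<Longrightarrow> continuous_on S f"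
  unfolding smooth_on_def using Ck_on_imp_continuous_on by blast

section \<open>Cutoff functions\<close>

text \<open>The powers of \<open>1 / t\<close> make this family of functions closed under
  differentiation.\<close>

definition flat_exp :: "nat \<Rightarrow> real \<Rightarrow> real" where
  "flat_exp n t = (if t > 0 then (1/t)^n * exp (- (1/t)) else 0)"

lemma flat_exp_tendsto: "(flat_exp n \<longlongrightarrow> 0) (at 0)"
proof -
  have "((\<lambda>s::real. s ^ n / exp s) \<longlongrightarrow> 0) at_top"
    by (rule tendsto_power_div_exp_0)
  then have "((\<lambda>t::real. inverse t ^ n / exp (inverse t)) \<longlongrightarrow> 0) (at_right 0)"
    by (rule filterlim_compose[OF _ filterlim_inverse_at_top_right])
  then have "(flat_exp n \<longlongrightarrow> 0) (at_right 0)"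
    by (rule Lim_transform_eventually)
      (auto simp: eventually_at_right_field flat_exp_def exp_minus field_simps intro!: exI[of _ 1])
  moreover have "(flat_exp n \<longlongrightarrow> 0) (at_left 0)"
    by (rule Lim_transform_eventually[OF tendsto_const])
      (auto simp: eventually_at_left_field flat_exp_def intro!: exI[of _ "-1"])
  ultimately show ?thesis by (simp add: filterlim_split_at)
qed

lemma flat_exp_deriv:
  "(flat_exp n has_real_derivative (flat_exp (n + 2) t - real n * flat_exp (n + 1) t)) (at t)"
proof -
  consider "t > 0" | "t < 0" | "t = 0" by linarith
  then show ?thesis
  proof cases
    case 1
    have "((\<lambda>t. (1/t)^n * exp (- (1/t))) has_real_derivative
        (flat_exp (n + 2) t - real n * flat_exp (n + 1) t)) (at t)"
      using 1
      by (auto intro!: derivative_eq_intros simp: flat_exp_def field_simps power2_eq_square)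
        (metis One_nat_def Suc_pred neq0_conv power_Suc)
    then show ?thesis
      by (rule has_field_derivative_transform_within_open[where S = "{0<..}"])
        (use 1 in \<open>auto simp: flat_exp_def\<close>)
  next
    case 2
    have "((\<lambda>t. 0) has_real_derivative 0) (at t)" by simp
    then have "(flat_exp n has_real_derivative 0) (at t)"
      by (rule has_field_derivative_transform_within_open[where S = "{..<0}"])
        (use 2 in \<open>auto simp: flat_exp_def\<close>)
    then show ?thesis using 2 by (simp add: flat_exp_def)
  next
    case 3
    have "(\<lambda>t. (flat_exp n (0 + t) - flat_exp n 0) / t) \<midarrow>0\<rightarrow> 0"
      by (rule Lim_transform_eventually[OF flat_exp_tendsto[of "n + 1"]])
        (auto simp: flat_exp_def eventually_at_filter)
    then have "(flat_exp n has_real_derivative 0) (at 0)"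
      by (simp add: DERIV_def)
    then show ?thesis using 3 by (simp add: flat_exp_def)
  qed
qed

lemma smooth_on_flat_exp: "smooth_on UNIV (flat_exp n)"
proof -
  have "Ck_on k UNIV (flat_exp n)" for k
  proof (induction k arbitrary: n)
    case 0
    show ?case using flat_exp_deriv by (auto intro!: DERIV_isCont continuous_at_imp_continuous_on)
  next
    case (Suc k)
    show ?case
    proof (rule Ck_on_SucI)
      fix t :: real
      show "(flat_exp n has_derivative (\<lambda>v. v * (flat_exp (n + 2) t + (- real n) * flat_exp (n + 1) t))) (at t)"
        using flat_exp_deriv[of n t] unfolding has_field_derivative_def
        by (rule has_derivative_eq_rhs) (simp add: fun_eq_iff algebra_simps)
    next
      fix v
      show "Ck_on k UNIV (\<lambda>t. v * (flat_exp (n + 2) t + (- real n) * flat_exp (n + 1) t))"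
        by (intro Ck_on_mult Ck_on_add Ck_on_const Suc.IH open_UNIV)
    qed auto
  qed
  then show ?thesis by (simp add: smooth_on_def)
qed

text \<open>With \<open>h = flat_exp 0\<close> and \<open>s\<close> the squared distance to
  \<open>y0\<close>, the quotient of \<open>h (r\<^sup>2 - s)\<close> by \<open>h (r\<^sup>2 - s)
  + h (s - r\<^sup>2 / 4)\<close> works; the two arguments are never both nonpositive, so the
  denominator is positive.\<close>

lemma ex_cutoff:
  fixes y0 :: "'a::{real_inner, heine_borel}"
  assumes "r > 0"
  obtains \<theta> :: "'a \<Rightarrow> real" where "smooth_on UNIV \<theta>"
    "\<And>y. y \<in> ball y0 (r/2) \<Longrightarrow> \<theta> y = 1" "\<And>y. y \<notin> ball y0 r \<Longrightarrow> \<theta> y = 0"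
proof
  let ?h = "flat_exp 0"
  define s where "s y = (\<Sum>e\<in>onb. ((y - y0) \<bullet> e) * ((y - y0) \<bullet> e))" for y :: 'a
  define \<theta> where "\<theta> y = ?h (r\<^sup>2 + (-1) * s y) * inverse (?h (r\<^sup>2 + (-1) * s y) + ?h (s y + (- r\<^sup>2/4)))" for y
  have s: "s y = (dist y0 y)\<^sup>2" for y
  proof -
    have "(dist y0 y)\<^sup>2 = (y - y0) \<bullet> (y - y0)" by (subst dist_commute) (simp add: dist_norm power2_norm_eq_inner)
    also have "\<dots> = (y - y0) \<bullet> (\<Sum>e\<in>onb. ((y - y0) \<bullet> e) *\<^sub>R e)" by (simp add: onb_expansion)
    also have "\<dots> = s y" by (simp add: s_def inner_sum_right)
    finally show ?thesis by simp
  qed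
  have "smooth_on UNIV (\<lambda>y. y + - y0)"
    by (intro smooth_on_add smooth_on_id smooth_on_const open_UNIV)
  then have sm: "smooth_on UNIV s"
    unfolding s_def diff_conv_add_uminus
    by (intro smooth_on_sum smooth_on_mult open_UNIV smooth_on_bounded_linear[OF _ bounded_linear_inner_left])
  have nz: "?h (r\<^sup>2 + (-1) * x) + ?h (x + (- r\<^sup>2/4)) \<noteq> 0" for x
  proof -
    have "r\<^sup>2 > 0" using assms by simp
    then have "r\<^sup>2 + (-1) * x > 0 \<or> x + (- r\<^sup>2/4) > 0" by linarith
    moreover have "?h t \<ge> 0" "t > 0 \<Longrightarrow> ?h t > 0" for t by (auto simp: flat_exp_def)
    ultimately show ?thesis by (smt (verit))
  qed
  have h: "smooth_on UNIV (\<lambda>y. ?h (f y))" if "smooth_on UNIV f" for f :: "'a \<Rightarrow> real"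
    by (rule smooth_on_compose[OF _ _ that smooth_on_flat_exp]) auto
  show "smooth_on UNIV \<theta>"
    unfolding \<theta>_def
    by (intro smooth_on_mult smooth_on_inverse smooth_on_add h smooth_on_const sm open_UNIV nz)
  show "\<theta> y = 1" if "y \<in> ball y0 (r/2)" for y
  proof -
    have "dist y0 y < r/2" using that by simp
    then have "s y < (r/2)\<^sup>2" unfolding s by (simp add: power_strict_mono)
    then have "?h (s y + (- r\<^sup>2/4)) = 0" by (simp add: flat_exp_def power_divide)
    then show ?thesis using nz[of "s y"] by (simp add: \<theta>_def)
  qed
  show "\<theta> y = 0" if "y \<notin> ball y0 r" for y
  proof -
    have "dist y0 y \<ge> r" using that by simp
    then have "s y \<ge> r\<^sup>2" unfolding s using assms by (simp add: power_mono)
    then show ?thesis by (simp add: \<theta>_def flat_exp_def)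
  qed
qed

section \<open>Hadamard's lemma\<close>

lemma segment_in_ball:
  fixes y0 :: "'a::real_normed_vector"
  assumes "y \<in> ball y0 r" "t \<in> {0..1}"
  shows "y0 + t *\<^sub>R (y - y0) \<in> ball y0 r"
proof -
  have "\<bar>t\<bar> * norm (y - y0) \<le> 1 * norm (y - y0)" using assms(2) by (intro mult_right_mono) auto
  then show ?thesis using assms(1) by (simp add: dist_norm norm_minus_commute)
qed

lemma continuous_on_segment:
  fixes H :: "'a::real_normed_vector \<Rightarrow> 'b::real_normed_vector"
  assumes "continuous_on (ball y0 r) H"
  shows "continuous_on (ball y0 r \<times> {0..1}) (\<lambda>z. H (y0 + snd z *\<^sub>R (fst z - y0)))"
  by (rule continuous_on_compose2[OF assms])
    (auto intro!: continuous_intros segment_in_ball simp del: mem_ball)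

lemma continuous_on_segment':
  fixes H :: "'a::real_normed_vector \<Rightarrow> 'b::real_normed_vector"
  assumes "continuous_on (ball y0 r) H" "y \<in> ball y0 r"
  shows "continuous_on {0..1} (\<lambda>t. H (y0 + t *\<^sub>R (y - y0)))"
  by (rule continuous_on_compose2[OF assms(1)])
    (use assms(2) in \<open>auto intro!: continuous_intros segment_in_ball simp del: mem_ball\<close>)

text \<open>The dual space is a Banach space, and the inner product identifies it with the space at hand.
  The integral is therefore differentiated with respect to a parameter \<open>z\<close> in the dual; \<open>R\<close> is the identification.\<close>

lemma has_derivative_radial_integral:
  fixes H :: "'a::{real_inner, heine_borel} \<Rightarrow> real"
  assumes H: "Ck_on (Suc k) (ball y0 r) H" and y: "y \<in> ball y0 r"
  defines "D \<equiv> \<lambda>y. frechet_derivative H (at y)"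
  shows "((\<lambda>y. integral {0..1} (\<lambda>t. t ^ m * H (y0 + t *\<^sub>R (y - y0)))) has_derivative
    (\<lambda>v. \<Sum>e\<in>onb. (v \<bullet> e) * integral {0..1} (\<lambda>t. t ^ Suc m * D (y0 + t *\<^sub>R (y - y0)) e))) (at y)"
proof -
  define R :: "('a \<Rightarrow>\<^sub>L real) \<Rightarrow> 'a" where "R z = (\<Sum>e\<in>onb. blinfun_apply z e *\<^sub>R e)" for z
  have R: "bounded_linear R"
    unfolding R_def
    by (intro bounded_linear_sum bounded_linear_compose[OF bounded_linear_scaleR_left]
        blinfun.bounded_linear_left)
  have RL: "R (blinfun_inner_left y) = y" for y
    by (simp add: R_def onb_expansion inner_commute[of _ y])
  define ev where "ev e = Blinfun (\<lambda>w. R w \<bullet> e)" for e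
  have ev: "blinfun_apply (ev e) w = R w \<bullet> e" for e w
    unfolding ev_def
    by (subst bounded_linear_Blinfun_apply) (auto intro: bounded_linear_compose[OF bounded_linear_inner_left R])
  let ?D = D
  have D: "(H has_derivative D x) (at x)" if "x \<in> ball y0 r" for x
    unfolding D_def by (rule Ck_on_has_derivative[OF open_ball H that])
  have cont: "continuous_on (ball y0 r) H" "\<And>e. continuous_on (ball y0 r) (\<lambda>y. ?D y e)"
    using H Ck_on_imp_continuous_on by (blast, auto simp: D_def intro: Ck_on_imp_continuous_on)
  define U where "U = R -` ball y0 r"
  have "convex U" unfolding U_def
    using convex_linear_vimage[OF bounded_linear.linear[OF R] convex_ball] by simp
  have "open U" unfolding U_def
    by (rule open_vimage) (auto simp: linear_continuous_on R)
  define fx :: "('a \<Rightarrow>\<^sub>L real) \<Rightarrow> real \<Rightarrow> ('a \<Rightarrow>\<^sub>L real) \<Rightarrow>\<^sub>L real" where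
    "fx z t = (\<Sum>e\<in>onb. (t ^ Suc m * ?D (y0 + t *\<^sub>R (R z - y0)) e) *\<^sub>R ev e)" for z t
  have fx: "blinfun_apply (fx z t) w = (\<Sum>e\<in>onb. (R w \<bullet> e) * (t ^ Suc m * ?D (y0 + t *\<^sub>R (R z - y0)) e))" for z t w
    by (simp add: fx_def blinfun.sum_left blinfun.scaleR_left ev mult_ac)
  have contR: "continuous_on (U \<times> cbox 0 1) (\<lambda>x. h (y0 + snd x *\<^sub>R (R (fst x) - y0)))"
    if "continuous_on (ball y0 r) h" for h :: "'a \<Rightarrow> real"
  proof (rule continuous_on_compose2[OF that])
    show "continuous_on (U \<times> cbox 0 1) (\<lambda>x. y0 + snd x *\<^sub>R (R (fst x) - y0))"
      by (intro continuous_intros bounded_linear.continuous_on[OF R])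
    show "(\<lambda>x. y0 + snd x *\<^sub>R (R (fst x) - y0)) ` (U \<times> cbox 0 1) \<subseteq> ball y0 r"
      by (auto simp: U_def intro!: segment_in_ball simp del: mem_ball)
  qed
  have cfx: "continuous_on (U \<times> cbox 0 1) (\<lambda>(y, t). fx y t)"
    unfolding split_beta fx_def by (intro continuous_intros contR cont)
  define z where "z = blinfun_inner_left y"
  have z: "z \<in> U" "R z = y" using y RL by (auto simp: U_def z_def)
  have "((\<lambda>z. integral (cbox 0 1) (\<lambda>t. t ^ m * H (y0 + t *\<^sub>R (R z - y0)))) has_derivative
      blinfun_apply (integral (cbox 0 1) (fx z))) (at z within U)"
  proof (rule leibniz_rule[OF _ _ cfx z(1) \<open>convex U\<close>])
    fix z and t :: real assume zt: "z \<in> U" "t \<in> cbox 0 1"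
    then have seg: "y0 + t *\<^sub>R (R z - y0) \<in> ball y0 r" by (intro segment_in_ball) (auto simp: U_def)
    have lin: "linear (?D (y0 + t *\<^sub>R (R z - y0)))" by (rule has_derivative_linear[OF D[OF seg]])
    have "((\<lambda>z. y0 + t *\<^sub>R (R z - y0)) has_derivative (\<lambda>w. t *\<^sub>R R w)) (at z)"
      by (auto intro!: derivative_eq_intros bounded_linear.has_derivative[OF R])
    from has_derivative_compose[OF this D[OF seg]]
    have "((\<lambda>z. t ^ m * H (y0 + t *\<^sub>R (R z - y0))) has_derivative
        (\<lambda>w. t ^ m * ?D (y0 + t *\<^sub>R (R z - y0)) (t *\<^sub>R R w))) (at z)"
      by (rule has_derivative_mult_right)
    also have "(\<lambda>w. t ^ m * ?D (y0 + t *\<^sub>R (R z - y0)) (t *\<^sub>R R w)) = blinfun_apply (fx z t)"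
    proof
      fix w
      have "t ^ m * ?D (y0 + t *\<^sub>R (R z - y0)) (t *\<^sub>R R w) = t ^ Suc m * ?D (y0 + t *\<^sub>R (R z - y0)) (R w)"
        by (simp add: linear_cmul[OF lin])
      also have "\<dots> = fx z t w"
        by (subst linear_onb[OF lin]) (simp add: fx sum_distrib_left mult_ac)
      finally show "t ^ m * ?D (y0 + t *\<^sub>R (R z - y0)) (t *\<^sub>R R w) = fx z t w" .
    qed
    finally show "((\<lambda>z. t ^ m * H (y0 + t *\<^sub>R (R z - y0))) has_derivative blinfun_apply (fx z t))
        (at z within U)"
      by (rule has_derivative_at_withinI)
  next
    fix z assume "z \<in> U"
    then show "(\<lambda>t. t ^ m * H (y0 + t *\<^sub>R (R z - y0))) integrable_on cbox 0 1"
      using continuous_on_segment'[OF cont(1), of "R z"] unfolding U_def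
      by (intro integrable_continuous) (auto intro!: continuous_intros simp del: mem_ball)
  qed
  then have "((\<lambda>z. integral {0..1} (\<lambda>t. t ^ m * H (y0 + t *\<^sub>R (R z - y0)))) has_derivative
      blinfun_apply (integral {0..1} (fx z))) (at (blinfun_inner_left y))"
    using at_within_open[OF z(1) \<open>open U\<close>] by (simp add: cbox_interval z_def)
  from has_derivative_compose[OF bounded_linear_imp_has_derivative[OF bounded_linear_blinfun_inner_left] this]
  have "((\<lambda>y. integral {0..1} (\<lambda>t. t ^ m * H (y0 + t *\<^sub>R (y - y0)))) has_derivative
      (\<lambda>v. blinfun_apply (integral {0..1} (fx z)) (blinfun_inner_left v))) (at y)"
    by (simp add: RL)
  also have "(\<lambda>v. blinfun_apply (integral {0..1} (fx z)) (blinfun_inner_left v)) =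
      (\<lambda>v. \<Sum>e\<in>onb. (v \<bullet> e) * integral {0..1} (\<lambda>t. t ^ Suc m * ?D (y0 + t *\<^sub>R (y - y0)) e))"
  proof
    fix v
    have cD: "continuous_on {0..1} (\<lambda>t. ?D (y0 + t *\<^sub>R (y - y0)) e)" for e
      using continuous_on_segment'[OF cont(2) y] .
    have "continuous_on {0..1} (fx z)"
      unfolding fx_def z by (intro continuous_intros cD)
    then have "blinfun_apply (integral {0..1} (fx z)) (blinfun_inner_left v) =
        integral {0..1} (\<lambda>t. fx z t (blinfun_inner_left v))"
      by (intro blinfun_apply_integral integrable_continuous_interval)
    also have "\<dots> = (\<Sum>e\<in>onb. integral {0..1} (\<lambda>t. (v \<bullet> e) * (t ^ Suc m * ?D (y0 + t *\<^sub>R (y - y0)) e)))"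
      unfolding fx z RL
      by (intro integral_sum finite_onb integrable_continuous_interval continuous_intros cD)
    also have "\<dots> = (\<Sum>e\<in>onb. (v \<bullet> e) * integral {0..1} (\<lambda>t. t ^ Suc m * ?D (y0 + t *\<^sub>R (y - y0)) e))"
      by simp
    finally show "blinfun_apply (integral {0..1} (fx z)) (blinfun_inner_left v) =
      (\<Sum>e\<in>onb. (v \<bullet> e) * integral {0..1} (\<lambda>t. t ^ Suc m * ?D (y0 + t *\<^sub>R (y - y0)) e))" .
  qed
  finally show ?thesis .
qed

text \<open>Each differentiation brings out one more factor \<open>t\<close>; the weight \<open>t
  ^ m\<close> makes the statement inductive.\<close>

lemma Ck_on_radial_integral:
  fixes H :: "'a::{real_inner, heine_borel} \<Rightarrow> real"
  assumes "Ck_on k (ball y0 r) H"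
  shows "Ck_on k (ball y0 r) (\<lambda>y. integral {0..1} (\<lambda>t. t ^ m * H (y0 + t *\<^sub>R (y - y0))))"
  using assms
proof (induction k arbitrary: H m)
  case 0
  have "continuous_on (ball y0 r \<times> cbox 0 1) (\<lambda>(y, t). t ^ m * H (y0 + t *\<^sub>R (y - y0)))"
    using continuous_on_segment[of y0 r H] 0
    by (auto simp: split_beta intro!: continuous_intros)
  then show ?case using integral_continuous_on_param by (fastforce simp: cbox_interval)
next
  case (Suc k)
  show ?case
  proof (rule Ck_on_SucI[OF open_ball], erule has_derivative_radial_integral[OF Suc.prems])
    fix v
    show "Ck_on k (ball y0 r) (\<lambda>y. \<Sum>e\<in>onb. (v \<bullet> e) * integral {0..1}
        (\<lambda>t. t ^ Suc m * frechet_derivative H (at (y0 + t *\<^sub>R (y - y0))) e))"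
      using Suc.prems by (intro Ck_on_sum Ck_on_mult Ck_on_const open_ball Suc.IH) auto
  qed
qed

text \<open>The fundamental theorem of calculus along the segment from \<open>y0\<close> to
  \<open>y\<close>; the coefficients are the averages of the partial derivatives over it.\<close>

lemma Hadamard:
  fixes H :: "'a::{real_inner, heine_borel} \<Rightarrow> real"
  assumes H: "smooth_on (ball y0 r) H" and "r > 0"
  obtains G where "\<And>e. smooth_on (ball y0 r) (G e)"
    "\<And>y. y \<in> ball y0 r \<Longrightarrow> H y = H y0 + (\<Sum>e\<in>onb. ((y - y0) \<bullet> e) * G e y)"
    "\<And>e. G e y0 = frechet_derivative H (at y0) e"
proof
  let ?D = "\<lambda>y. frechet_derivative H (at y)"
  define G where "G e y = integral {0..1} (\<lambda>t. t ^ 0 * ?D (y0 + t *\<^sub>R (y - y0)) e)" for e y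
  show "smooth_on (ball y0 r) (G e)" for e
    using smooth_on_directional_derivative[OF H, of e] unfolding G_def smooth_on_def
    by (intro allI Ck_on_radial_integral[where m = 0]) auto
  show "G e y0 = ?D y0 e" for e
    by (simp add: G_def)
  fix y assume y: "y \<in> ball y0 r"
  have "((\<lambda>t. ?D (y0 + t *\<^sub>R (y - y0)) (y - y0)) has_integral
      H (y0 + 1 *\<^sub>R (y - y0)) - H (y0 + 0 *\<^sub>R (y - y0))) {0..1}"
  proof (rule fundamental_theorem_of_calculus)
    fix t :: real assume "t \<in> {0..1}"
    then have seg: "y0 + t *\<^sub>R (y - y0) \<in> ball y0 r" using y segment_in_ball by blast
    have lin: "linear (?D (y0 + t *\<^sub>R (y - y0)))"
      by (rule has_derivative_linear[OF smooth_on_has_derivative[OF open_ball H seg]])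
    have "((\<lambda>t. y0 + t *\<^sub>R (y - y0)) has_derivative (\<lambda>s. s *\<^sub>R (y - y0))) (at t)"
      by (auto intro!: derivative_eq_intros)
    from has_derivative_compose[OF this smooth_on_has_derivative[OF open_ball H seg]]
    show "((\<lambda>t. H (y0 + t *\<^sub>R (y - y0))) has_vector_derivative ?D (y0 + t *\<^sub>R (y - y0)) (y - y0)) (at t within {0..1})"
      by (simp add: has_vector_derivative_def linear_cmul[OF lin] has_derivative_at_withinI)
  qed auto
  then have "H y - H y0 = integral {0..1} (\<lambda>t. ?D (y0 + t *\<^sub>R (y - y0)) (y - y0))"
    by (simp add: integral_unique)
  also have "\<dots> = integral {0..1} (\<lambda>t. \<Sum>e\<in>onb. ((y - y0) \<bullet> e) * ?D (y0 + t *\<^sub>R (y - y0)) e)"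
  proof (rule integral_cong)
    fix t :: real assume "t \<in> {0..1}"
    then have seg: "y0 + t *\<^sub>R (y - y0) \<in> ball y0 r" using y segment_in_ball by blast
    have lin: "linear (?D (y0 + t *\<^sub>R (y - y0)))"
      by (rule has_derivative_linear[OF smooth_on_has_derivative[OF open_ball H seg]])
    show "?D (y0 + t *\<^sub>R (y - y0)) (y - y0) = (\<Sum>e\<in>onb. ((y - y0) \<bullet> e) * ?D (y0 + t *\<^sub>R (y - y0)) e)"
      by (subst linear_onb[OF lin]) simp
  qed
  also have "\<dots> = (\<Sum>e\<in>onb. ((y - y0) \<bullet> e) * G e y)"
  proof -
    have "continuous_on {0..1} (\<lambda>t. ?D (y0 + t *\<^sub>R (y - y0)) e)" for e
      using continuous_on_segment'[OF _ y]
        smooth_on_imp_continuous_on[OF smooth_on_directional_derivative[OF H]] by blast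
    then show ?thesis
      by (subst integral_sum) (auto simp: G_def intro!: integrable_continuous_interval continuous_intros)
  qed
  finally show "H y = H y0 + (\<Sum>e\<in>onb. ((y - y0) \<bullet> e) * G e y)" by simp
qed

section \<open>Smooth functions on a manifold\<close>

locale manifold =
  fixes A :: "('m::t2_space, 'e::{real_inner, heine_borel}) atlas"
  assumes smooth_atlas: "smooth_atlas A"
begin

lemma chart_open: "(U, \<phi>) \<in> A \<Longrightarrow> open U" "(U, \<phi>) \<in> A \<Longrightarrow> open (\<phi> ` U)"
  and chart_homeomorphism: "(U, \<phi>) \<in> A \<Longrightarrow> homeomorphism U (\<phi> ` U) \<phi> (inv_into U \<phi>)"
  and transition_smooth: "(U, \<phi>) \<in> A \<Longrightarrow> (V, \<psi>) \<in> A \<Longrightarrow>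
    smooth_on (\<phi> ` (U \<inter> V)) (\<psi> \<circ> inv_into U \<phi>)"
  using smooth_atlas unfolding smooth_atlas_def by blast+

lemma ex_chart: obtains U \<phi> where "(U, \<phi>) \<in> A" "p \<in> U"
  using smooth_atlas unfolding smooth_atlas_def by blast

lemma chart_inv: "(U, \<phi>) \<in> A \<Longrightarrow> p \<in> U \<Longrightarrow> inv_into U \<phi> (\<phi> p) = p"
  using chart_homeomorphism homeomorphism_apply1 by blast

lemma chart_inv2: "(U, \<phi>) \<in> A \<Longrightarrow> y \<in> \<phi> ` U \<Longrightarrow> \<phi> (inv_into U \<phi> y) = y"
  by (simp add: f_inv_into_f)

lemma chart_continuous: "(U, \<phi>) \<in> A \<Longrightarrow> continuous_on U \<phi>"
  and chart_continuous_inv: "(U, \<phi>) \<in> A \<Longrightarrow> continuous_on (\<phi> ` U) (inv_into U \<phi>)"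
  using chart_homeomorphism unfolding homeomorphism_def by blast+

lemma chart_image_open:
  assumes "(U, \<phi>) \<in> A" "open N" "N \<subseteq> U"
  shows "open (\<phi> ` N)"
proof -
  have "\<phi> ` N = \<phi> ` U \<inter> inv_into U \<phi> -` N"
    using assms chart_inv[OF assms(1)] by auto
  then show ?thesis
    using continuous_open_preimage[OF chart_continuous_inv[OF assms(1)] chart_open(2)[OF assms(1)] assms(2)]
    by simp
qed

lemma chart_preimage_open:
  assumes "(U, \<phi>) \<in> A" "open S"
  shows "open (U \<inter> \<phi> -` S)"
  using continuous_open_preimage[OF chart_continuous[OF assms(1)] chart_open(1)[OF assms(1)] assms(2)] .

lemma smooth_functions_chart:
  "f \<in> smooth_functions A \<Longrightarrow> (U, \<phi>) \<in> A \<Longrightarrow> smooth_on (\<phi> ` U) (f \<circ> inv_into U \<phi>)"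
  by (auto simp: smooth_functions_def)

text \<open>Transition maps are smooth, so one chart around each point suffices.\<close>

lemma smooth_functions_chartI:
  assumes "\<And>p. \<exists>U \<phi> N. (U, \<phi>) \<in> A \<and> open N \<and> p \<in> N \<and> N \<subseteq> U \<and> smooth_on (\<phi> ` N) (f \<circ> inv_into U \<phi>)"
  shows "f \<in> smooth_functions A"
proof -
  have "smooth_on (\<psi> ` V) (f \<circ> inv_into V \<psi>)" if V: "(V, \<psi>) \<in> A" for V \<psi>
  proof (rule smooth_on_local)
    fix y assume "y \<in> \<psi> ` V"
    then obtain p where p: "p \<in> V" "y = \<psi> p" by auto
    obtain U \<phi> N where U: "(U, \<phi>) \<in> A" and N: "open N" "p \<in> N" "N \<subseteq> U"
      and f: "smooth_on (\<phi> ` N) (f \<circ> inv_into U \<phi>)" using assms by blast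
    let ?W = "V \<inter> N"
    have W: "open (\<psi> ` ?W)" using chart_image_open[OF V] chart_open(1)[OF V] N by auto
    have "smooth_on (\<psi> ` ?W) (\<lambda>y. (f \<circ> inv_into U \<phi>) ((\<phi> \<circ> inv_into V \<psi>) y))"
    proof (rule smooth_on_compose[OF W chart_image_open[OF U N(1,3)] _ f])
      show "smooth_on (\<psi> ` ?W) (\<phi> \<circ> inv_into V \<psi>)"
        using transition_smooth[OF V U] by (rule smooth_on_subset) (use N in auto)
      show "(\<phi> \<circ> inv_into V \<psi>) ` \<psi> ` ?W \<subseteq> \<phi> ` N"
        using chart_inv[OF V] by auto
    qed
    then have "smooth_on (\<psi> ` ?W) (f \<circ> inv_into V \<psi>)"
      by (rule smooth_on_cong[OF W]) (use chart_inv[OF V] chart_inv[OF U] N in auto)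
    then show "\<exists>T. open T \<and> y \<in> T \<and> smooth_on T (f \<circ> inv_into V \<psi>)"
      using W p N by blast
  qed
  then show ?thesis by (auto simp: smooth_functions_def)
qed

lemma smooth_functions_localI:
  assumes "\<And>p. \<exists>N h. open N \<and> p \<in> N \<and> h \<in> smooth_functions A \<and> (\<forall>x\<in>N. f x = h x)"
  shows "f \<in> smooth_functions A"
proof (rule smooth_functions_chartI)
  fix p
  obtain U \<phi> where U: "(U, \<phi>) \<in> A" "p \<in> U" by (rule ex_chart)
  obtain N h where N: "open N" "p \<in> N" and h: "h \<in> smooth_functions A" "\<forall>x\<in>N. f x = h x"
    using assms by blast
  have o: "open (U \<inter> N)" using chart_open(1)[OF U(1)] N by auto
  have "smooth_on (\<phi> ` (U \<inter> N)) (h \<circ> inv_into U \<phi>)"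
    using smooth_functions_chart[OF h(1) U(1)] by (rule smooth_on_subset) auto
  then have "smooth_on (\<phi> ` (U \<inter> N)) (f \<circ> inv_into U \<phi>)"
    by (rule smooth_on_cong[OF chart_image_open[OF U(1) o Int_lower1]]) (use chart_inv[OF U(1)] h in auto)
  then show "\<exists>U \<phi> N. (U, \<phi>) \<in> A \<and> open N \<and> p \<in> N \<and> N \<subseteq> U \<and> smooth_on (\<phi> ` N) (f \<circ> inv_into U \<phi>)"
    using U N o by blast
qed

lemma smooth_functions_continuous:
  assumes "f \<in> smooth_functions A"
  shows "continuous_on UNIV f"
  unfolding continuous_on_eq_continuous_at[OF open_UNIV]
proof
  fix p
  obtain U \<phi> where U: "(U, \<phi>) \<in> A" "p \<in> U" by (rule ex_chart)
  have "continuous_on U (\<lambda>x. (f \<circ> inv_into U \<phi>) (\<phi> x))"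
    using smooth_on_imp_continuous_on[OF smooth_functions_chart[OF assms U(1)]] chart_continuous[OF U(1)]
    by (rule continuous_on_compose2) auto
  then have "continuous_on U f"
    by (rule continuous_on_eq) (simp add: chart_inv[OF U(1)])
  then show "continuous (at p) f"
    using U chart_open(1)[OF U(1)] by (simp add: continuous_on_eq_continuous_at)
qed

lemma smooth_const [simp]: "(\<lambda>x. c) \<in> smooth_functions A"
  by (simp add: smooth_functions_def o_def smooth_on_const)

lemma smooth_add:
  "f \<in> smooth_functions A \<Longrightarrow> h \<in> smooth_functions A \<Longrightarrow> (\<lambda>x. f x + h x) \<in> smooth_functions A"
  by (auto simp: smooth_functions_def o_def intro!: smooth_on_add chart_open)

lemma smooth_mult:
  "f \<in> smooth_functions A \<Longrightarrow> h \<in> smooth_functions A \<Longrightarrow> (\<lambda>x. f x * h x) \<in> smooth_functions A"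
  by (auto simp: smooth_functions_def o_def intro!: smooth_on_mult chart_open)

lemma smooth_uminus: "f \<in> smooth_functions A \<Longrightarrow> (\<lambda>x. - f x) \<in> smooth_functions A"
  using smooth_mult[of "\<lambda>x. -1" f] by simp

lemma smooth_diff:
  "f \<in> smooth_functions A \<Longrightarrow> h \<in> smooth_functions A \<Longrightarrow> (\<lambda>x. f x - h x) \<in> smooth_functions A"
  using smooth_add[of f "\<lambda>x. - h x"] by (simp add: smooth_uminus)

lemma smooth_sum:
  "(\<And>i. i \<in> I \<Longrightarrow> f i \<in> smooth_functions A) \<Longrightarrow> (\<lambda>x. \<Sum>i\<in>I. f i x) \<in> smooth_functions A"
  by (induction I rule: infinite_finite_induct) (auto intro: smooth_add)

lemma smooth_prod:
  "(\<And>i. i \<in> I \<Longrightarrow> f i \<in> smooth_functions A) \<Longrightarrow> (\<lambda>x. \<Prod>i\<in>I. f i x) \<in> smooth_functions A"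
  by (induction I rule: infinite_finite_induct) (auto intro: smooth_mult)

lemma smooth_power: "f \<in> smooth_functions A \<Longrightarrow> (\<lambda>x. f x ^ n) \<in> smooth_functions A"
  by (induction n) (auto intro: smooth_mult)

lemmas smooth_intros = smooth_const smooth_add smooth_mult smooth_uminus smooth_diff smooth_sum
  smooth_prod smooth_power

text \<open>A cutoff function turns a function that is smooth near a point into a globally smooth one with
  the same germ; one cutoff serves all functions that are smooth on the same chart domain.\<close>

lemma ex_extension:
  assumes U: "(U, \<phi>) \<in> A" and N0: "open N0" "p \<in> N0" "N0 \<subseteq> U"
  shows "\<exists>\<theta> N. \<theta> \<in> smooth_functions A \<and> open N \<and> p \<in> N \<and> N \<subseteq> N0 \<and> (\<forall>x\<in>N. \<theta> x = 1) \<and>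
    (\<forall>x. x \<notin> N0 \<longrightarrow> \<theta> x = 0) \<and>
    (\<forall>f. smooth_on (\<phi> ` N0) (f \<circ> inv_into U \<phi>) \<longrightarrow>
      (\<lambda>x. if x \<in> N0 then \<theta> x * f x else 0) \<in> smooth_functions A)"
proof -
  have o: "open (\<phi> ` N0)" using chart_image_open[OF U N0(1,3)] .
  then obtain r where r: "r > 0" "cball (\<phi> p) r \<subseteq> \<phi> ` N0"
    using N0 by (meson image_eqI open_contains_cball)
  obtain \<eta> :: "'e \<Rightarrow> real" where \<eta>: "smooth_on UNIV \<eta>" "\<And>y. y \<in> ball (\<phi> p) (r/2) \<Longrightarrow> \<eta> y = 1"
    "\<And>y. y \<notin> ball (\<phi> p) r \<Longrightarrow> \<eta> y = 0" using ex_cutoff[OF r(1), of "\<phi> p"] by blast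
  define \<theta> where "\<theta> x = (if x \<in> U then \<eta> (\<phi> x) else 0)" for x
  define K where "K = inv_into U \<phi> ` cball (\<phi> p) r"
  define N where "N = U \<inter> \<phi> -` ball (\<phi> p) (r/2)"
  have KN0: "K \<subseteq> N0"
    using r chart_inv[OF U] N0 by (auto simp: K_def subset_iff image_iff)
  have "compact (cball (\<phi> p) r)" by (simp add: compact_eq_bounded_closed)
  then have "compact K"
    unfolding K_def using r N0
    by (intro compact_continuous_image continuous_on_subset[OF chart_continuous_inv[OF U]]) auto
  then have "closed K" by (rule compact_imp_closed)
  have K0: "\<theta> x = 0" if "x \<notin> K" for x
  proof (cases "x \<in> U")
    case True
    then have "\<phi> x \<notin> cball (\<phi> p) r"
      using that chart_inv[OF U] unfolding K_def by (metis image_eqI)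
    then show ?thesis by (simp add: \<theta>_def \<eta>)
  qed (simp add: \<theta>_def)
  have main: "(\<lambda>x. if x \<in> N0 then \<theta> x * f x else 0) \<in> smooth_functions A"
    if f: "smooth_on (\<phi> ` N0) (f \<circ> inv_into U \<phi>)" for f
  proof (rule smooth_functions_chartI)
    fix q
    let ?f = "\<lambda>x. if x \<in> N0 then \<theta> x * f x else 0"
    show "\<exists>U \<phi> N. (U, \<phi>) \<in> A \<and> open N \<and> q \<in> N \<and> N \<subseteq> U \<and> smooth_on (\<phi> ` N) (?f \<circ> inv_into U \<phi>)"
    proof (cases "q \<in> N0")
      case True
      have "smooth_on (\<phi> ` N0) (\<lambda>y. \<eta> y * (f \<circ> inv_into U \<phi>) y)"
        using smooth_on_subset[OF \<eta>(1)] by (intro smooth_on_mult o f) auto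
      then have "smooth_on (\<phi> ` N0) (?f \<circ> inv_into U \<phi>)"
        by (rule smooth_on_cong[OF o]) (use N0 chart_inv[OF U] in \<open>auto simp: \<theta>_def\<close>)
      then show ?thesis using U True N0 by blast
    next
      case False
      obtain V \<psi> where V: "(V, \<psi>) \<in> A" "q \<in> V" by (rule ex_chart)
      have oV: "open (V - K)" using chart_open(1)[OF V(1)] \<open>closed K\<close> by auto
      have "smooth_on (\<psi> ` (V - K)) (?f \<circ> inv_into V \<psi>)"
        by (rule smooth_on_cong[OF chart_image_open[OF V(1) oV] smooth_on_const[of _ 0]])
          (use chart_inv[OF V(1)] K0 in auto)
      then show ?thesis using V oV False KN0 by blast
    qed
  qed
  have "\<theta> x = 0" if "x \<notin> N0" for x using that K0 KN0 by blast
  then have "\<theta> = (\<lambda>x. if x \<in> N0 then \<theta> x * 1 else 0)" by auto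
  then have "\<theta> \<in> smooth_functions A"
    using main[of "\<lambda>_. 1"] by (simp add: o_def smooth_on_const)
  have NN0: "N \<subseteq> N0"
  proof
    fix x assume x: "x \<in> N"
    then have "\<phi> x \<in> \<phi> ` N0" using r by (auto simp: N_def dist_commute subset_iff)
    then obtain z where "z \<in> N0" "\<phi> x = \<phi> z" by blast
    moreover have "x \<in> U" "z \<in> U" using x \<open>z \<in> N0\<close> N0 by (auto simp: N_def)
    ultimately show "x \<in> N0" using chart_inv[OF U] by metis
  qed
  show ?thesis
  proof (intro exI conjI ballI allI impI)
    show "open N" unfolding N_def by (rule chart_preimage_open[OF U open_ball])
    show "p \<in> N" using N0 r by (auto simp: N_def)
    show "\<theta> x = 1" if "x \<in> N" for x using that \<eta>(2) by (simp add: N_def \<theta>_def)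
    show "\<theta> x = 0" if "x \<notin> N0" for x using that K0 KN0 by blast
  qed (fact \<open>\<theta> \<in> smooth_functions A\<close> NN0 main)+
qed

lemma ex_bump:
  assumes "open N0" "p \<in> N0"
  shows "\<exists>\<theta> N. \<theta> \<in> smooth_functions A \<and> open N \<and> p \<in> N \<and> N \<subseteq> N0 \<and> (\<forall>x\<in>N. \<theta> x = 1) \<and>
    (\<forall>x. x \<notin> N0 \<longrightarrow> \<theta> x = 0)"
proof -
  obtain U \<phi> where U: "(U, \<phi>) \<in> A" "p \<in> U" by (rule ex_chart)
  have o: "open (N0 \<inter> U)" using chart_open(1)[OF U(1)] assms by auto
  have "p \<in> N0 \<inter> U" using assms U by auto
  from ex_extension[OF U(1) o this Int_lower2] show ?thesis
    by (elim exE conjE) (intro exI conjI, auto)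
qed

lemma ex_smooth_germ:
  assumes U: "(U, \<phi>) \<in> A" and N0: "open N0" "p \<in> N0" "N0 \<subseteq> U"
    and f: "smooth_on (\<phi> ` N0) (f \<circ> inv_into U \<phi>)"
  shows "\<exists>h N. h \<in> smooth_functions A \<and> open N \<and> p \<in> N \<and> N \<subseteq> N0 \<and> (\<forall>x\<in>N. h x = f x)"
proof -
  obtain \<theta> N where \<theta>: "open N" "p \<in> N" "N \<subseteq> N0" "\<forall>x\<in>N. \<theta> x = 1"
    and ext: "\<forall>f. smooth_on (\<phi> ` N0) (f \<circ> inv_into U \<phi>) \<longrightarrow>
      (\<lambda>x. if x \<in> N0 then \<theta> x * f x else 0) \<in> smooth_functions A"
    using ex_extension[OF U N0] by (elim exE conjE) (rule that)
  show ?thesis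
    by (intro exI conjI, rule ext[rule_format, OF f], (rule \<theta>(1-3))+) (use \<theta>(3,4) in auto)
qed

lemma ex_local_inverse:
  assumes f: "f \<in> smooth_functions A" and "f p \<noteq> 0"
  shows "\<exists>h N. h \<in> smooth_functions A \<and> open N \<and> p \<in> N \<and> (\<forall>x\<in>N. f x \<noteq> 0 \<and> h x = inverse (f x))"
proof -
  obtain U \<phi> where U: "(U, \<phi>) \<in> A" "p \<in> U" by (rule ex_chart)
  let ?N0 = "U \<inter> f -` (- {0})"
  have "open ?N0"
    using smooth_functions_continuous[OF f] chart_open(1)[OF U(1)]
    by (intro continuous_open_preimage continuous_on_subset[OF smooth_functions_continuous[OF f]]) auto
  have "smooth_on (\<phi> ` ?N0) (f \<circ> inv_into U \<phi>)"
    using smooth_functions_chart[OF f U(1)] by (rule smooth_on_subset) auto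
  then have "smooth_on (\<phi> ` ?N0) ((\<lambda>x. inverse (f x)) \<circ> inv_into U \<phi>)"
    using chart_image_open[OF U(1) \<open>open ?N0\<close>] chart_inv[OF U(1)]
    unfolding o_def by (intro smooth_on_inverse) auto
  moreover have "p \<in> ?N0" using U(2) assms(2) by auto
  ultimately obtain h N where "h \<in> smooth_functions A" "open N" "p \<in> N" "N \<subseteq> ?N0" "\<forall>x\<in>N. h x = inverse (f x)"
    using ex_smooth_germ[OF U(1) \<open>open ?N0\<close> _ Int_lower1, of p "\<lambda>x. inverse (f x)"] by meson
  then show ?thesis by (intro exI[of _ h] exI[of _ N]) auto
qed

section \<open>Tangent vectors\<close>

lemma tangent_spaceI:
  assumes "\<And>f h a c. f \<in> smooth_functions A \<Longrightarrow> h \<in> smooth_functions A \<Longrightarrow>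
      v (\<lambda>x. a * f x + c * h x) = a * v f + c * v h"
    and "\<And>f h. f \<in> smooth_functions A \<Longrightarrow> h \<in> smooth_functions A \<Longrightarrow>
      v (\<lambda>x. f x * h x) = f p * v h + h p * v f"
    and "\<And>f. f \<notin> smooth_functions A \<Longrightarrow> v f = 0"
  shows "v \<in> tangent_space A p"
  using assms by (simp add: tangent_space_def plus_fun_def scaleR_fun_def times_fun_def)

lemma tangent_lincomb: "v \<in> tangent_space A p \<Longrightarrow> f \<in> smooth_functions A \<Longrightarrow> h \<in> smooth_functions A \<Longrightarrow>
      v (\<lambda>x. a * f x + c * h x) = a * v f + c * v h"
  and tangent_mult: "v \<in> tangent_space A p \<Longrightarrow> f \<in> smooth_functions A \<Longrightarrow> h \<in> smooth_functions A \<Longrightarrow>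
      v (\<lambda>x. f x * h x) = f p * v h + h p * v f"
  and tangent_nonsmooth: "v \<in> tangent_space A p \<Longrightarrow> f \<notin> smooth_functions A \<Longrightarrow> v f = 0"
  by (simp_all add: tangent_space_def plus_fun_def scaleR_fun_def times_fun_def)

lemma tangent_add: "v \<in> tangent_space A p \<Longrightarrow> f \<in> smooth_functions A \<Longrightarrow> h \<in> smooth_functions A \<Longrightarrow>
      v (\<lambda>x. f x + h x) = v f + v h"
  and tangent_diff: "v \<in> tangent_space A p \<Longrightarrow> f \<in> smooth_functions A \<Longrightarrow> h \<in> smooth_functions A \<Longrightarrow>
      v (\<lambda>x. f x - h x) = v f - v h"
  and tangent_cmult: "v \<in> tangent_space A p \<Longrightarrow> f \<in> smooth_functions A \<Longrightarrow> v (\<lambda>x. a * f x) = a * v f"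
  using tangent_lincomb[of v p f h 1 1] tangent_lincomb[of v p f h 1 "-1"]
    tangent_lincomb[of v p f f a 0] by simp_all

lemma tangent_const: "v \<in> tangent_space A p \<Longrightarrow> v (\<lambda>x. c) = 0"
  using tangent_mult[of v p "\<lambda>x. 1" "\<lambda>x. 1"] tangent_cmult[of v p "\<lambda>x. 1" c] by simp

lemma tangent_sum:
  assumes "v \<in> tangent_space A p" "\<And>i. i \<in> I \<Longrightarrow> f i \<in> smooth_functions A"
  shows "v (\<lambda>x. \<Sum>i\<in>I. f i x) = (\<Sum>i\<in>I. v (f i))"
  using assms(2)
proof (induction I rule: infinite_finite_induct)
  case (insert i I)
  then show ?case using tangent_add[OF assms(1), of "f i" "\<lambda>x. \<Sum>i\<in>I. f i x"] by (simp add: smooth_sum)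
qed (simp_all add: tangent_const[OF assms(1)])

text \<open>A cutoff supported where \<open>f\<close> and \<open>h\<close> agree kills their
  difference; apply the Leibniz rule to the product.\<close>

lemma tangent_local:
  assumes v: "v \<in> tangent_space A p" and f: "f \<in> smooth_functions A" "h \<in> smooth_functions A"
    and N: "open N" "p \<in> N" "\<And>x. x \<in> N \<Longrightarrow> f x = h x"
  shows "v f = v h"
proof -
  obtain \<theta> N' where \<theta>: "\<theta> \<in> smooth_functions A" "open N'" "p \<in> N'" "N' \<subseteq> N" "\<forall>x\<in>N'. \<theta> x = 1"
    "\<forall>x. x \<notin> N \<longrightarrow> \<theta> x = 0" using ex_bump[OF N(1,2)] by (elim exE conjE) (rule that)
  have "(\<lambda>x. \<theta> x * (f x - h x)) = (\<lambda>x. 0)"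
  proof
    show "\<theta> x * (f x - h x) = 0" for x using \<theta>(6) N(3)[of x] by (cases "x \<in> N") auto
  qed
  then have "v (\<lambda>x. \<theta> x * (f x - h x)) = 0" using tangent_const[OF v] by simp
  moreover have "v (\<lambda>x. \<theta> x * (f x - h x)) = v f - v h"
    using \<theta> N f by (simp add: tangent_mult[OF v] smooth_diff tangent_diff[OF v])
  ultimately show ?thesis by simp
qed

lemma zero_tangent: "0 \<in> tangent_space A p"
  by (rule tangent_spaceI) (auto simp: zero_fun_def)

lemma add_tangent: "v \<in> tangent_space A p \<Longrightarrow> w \<in> tangent_space A p \<Longrightarrow> v + w \<in> tangent_space A p"
  by (rule tangent_spaceI)
    (auto simp: plus_fun_def tangent_lincomb tangent_mult tangent_nonsmooth algebra_simps)

lemma scaleR_tangent: "v \<in> tangent_space A p \<Longrightarrow> a *\<^sub>R v \<in> tangent_space A p"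
  by (rule tangent_spaceI)
    (auto simp: scaleR_fun_def tangent_lincomb tangent_mult tangent_nonsmooth algebra_simps)

lemma subspace_tangent: "subspace (tangent_space A p)"
  by (simp add: subspace_def zero_tangent add_tangent scaleR_tangent)

lemma sum_tangent: "(\<And>i. i \<in> I \<Longrightarrow> v i \<in> tangent_space A p) \<Longrightarrow> (\<Sum>i\<in>I. v i) \<in> tangent_space A p"
  using subspace_sum[OF subspace_tangent] .

lemma tangent_eqI:
  "v \<in> tangent_space A p \<Longrightarrow> w \<in> tangent_space A p \<Longrightarrow>
    (\<And>f. f \<in> smooth_functions A \<Longrightarrow> v f = w f) \<Longrightarrow> v = w"
  using tangent_nonsmooth by (metis ext)

lemma ex_coordinates:
  assumes U: "(U, \<phi>) \<in> A" "p \<in> U"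
  shows "\<exists>x N. open N \<and> p \<in> N \<and> N \<subseteq> U \<and> (\<forall>e. x e \<in> smooth_functions A) \<and>
    (\<forall>e. \<forall>q\<in>N. x e q = \<phi> q \<bullet> e)"
proof -
  obtain \<theta> N where \<theta>: "open N" "p \<in> N" "N \<subseteq> U" "\<forall>x\<in>N. \<theta> x = 1"
    and ext: "\<forall>f. smooth_on (\<phi> ` U) (f \<circ> inv_into U \<phi>) \<longrightarrow>
      (\<lambda>x. if x \<in> U then \<theta> x * f x else 0) \<in> smooth_functions A"
    using ex_extension[OF U(1) chart_open(1)[OF U(1)] U(2) subset_refl] by (elim exE conjE) (rule that)
  have "smooth_on (\<phi> ` U) ((\<lambda>q. \<phi> q \<bullet> e) \<circ> inv_into U \<phi>)" for e
  proof (rule smooth_on_cong[OF chart_open(2)[OF U(1)]])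
    show "smooth_on (\<phi> ` U) (\<lambda>y. y \<bullet> e)"
      using chart_open(2)[OF U(1)]
      by (intro smooth_on_bounded_linear[OF _ bounded_linear_inner_left] smooth_on_id)
  qed (simp add: chart_inv2[OF U(1)])
  then have "(\<lambda>q. if q \<in> U then \<theta> q * (\<phi> q \<bullet> e) else 0) \<in> smooth_functions A" for e
    by (rule ext[rule_format])
  then show ?thesis
    by (intro exI[of _ "\<lambda>e q. if q \<in> U then \<theta> q * (\<phi> q \<bullet> e) else 0"] exI[of _ N]) (use \<theta> in auto)
qed

text \<open>By Hadamard's lemma every smooth function is, near \<open>p\<close>, a constant plus a combination of the
  coordinates centred at \<open>p\<close> with smooth coefficients, so the Leibniz rule leaves only the values of
  a derivation on the coordinates.\<close>

lemma tangent_coordinates: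
  assumes U: "(U, \<phi>) \<in> A" "p \<in> U"
    and x: "\<And>e. x e \<in> smooth_functions A" "open N" "p \<in> N" "\<And>e q. q \<in> N \<Longrightarrow> x e q = \<phi> q \<bullet> e"
    and v: "v \<in> tangent_space A p" and f: "f \<in> smooth_functions A"
  shows "v f = (\<Sum>e\<in>onb. v (x e) * frechet_derivative (f \<circ> inv_into U \<phi>) (at (\<phi> p)) e)"
proof -
  let ?H = "f \<circ> inv_into U \<phi>"
  have o: "open (\<phi> ` U)" using chart_open(2)[OF U(1)] .
  obtain r where r: "r > 0" "ball (\<phi> p) r \<subseteq> \<phi> ` U"
    using o U(2) by (meson image_eqI open_contains_ball)
  obtain G where G: "\<And>e. smooth_on (ball (\<phi> p) r) (G e)"
    "\<And>y. y \<in> ball (\<phi> p) r \<Longrightarrow> ?H y = ?H (\<phi> p) + (\<Sum>e\<in>onb. ((y - \<phi> p) \<bullet> e) * G e y)"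
    "\<And>e. G e (\<phi> p) = frechet_derivative ?H (at (\<phi> p)) e"
    using Hadamard[OF smooth_on_subset[OF smooth_functions_chart[OF f U(1)] r(2)] r(1)] by blast
  define N1 where "N1 = U \<inter> \<phi> -` ball (\<phi> p) r"
  have N1: "open N1" "p \<in> N1" "N1 \<subseteq> U"
    using chart_preimage_open[OF U(1) open_ball] U r by (auto simp: N1_def)
  have N1_image: "\<phi> ` N1 \<subseteq> ball (\<phi> p) r" by (auto simp: N1_def)
  have "\<forall>e. \<exists>h N'. h \<in> smooth_functions A \<and> open N' \<and> p \<in> N' \<and> (\<forall>q\<in>N'. h q = G e (\<phi> q))"
  proof
    fix e
    have "smooth_on (\<phi> ` N1) ((\<lambda>q. G e (\<phi> q)) \<circ> inv_into U \<phi>)"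
      by (rule smooth_on_cong[OF chart_image_open[OF U(1) N1(1,3)] smooth_on_subset[OF G(1) N1_image]])
        (use chart_inv[OF U(1)] N1(3) in auto)
    from ex_smooth_germ[OF U(1) N1 this]
    show "\<exists>h N'. h \<in> smooth_functions A \<and> open N' \<and> p \<in> N' \<and> (\<forall>q\<in>N'. h q = G e (\<phi> q))"
      by (elim exE conjE) (intro exI conjI)
  qed
  then obtain g N' where g: "\<And>e. g e \<in> smooth_functions A" "\<And>e. open (N' e)" "\<And>e. p \<in> N' e"
    "\<And>e q. q \<in> N' e \<Longrightarrow> g e q = G e (\<phi> q)" by metis
  let ?N = "N \<inter> N1 \<inter> (\<Inter>e\<in>onb. N' e)"
  let ?f = "\<lambda>q. f p + (\<Sum>e\<in>onb. (x e q - x e p) * g e q)"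
  have "v f = v ?f"
  proof (rule tangent_local[OF v f])
    show "?f \<in> smooth_functions A" by (intro smooth_intros x g)
    show "open ?N" using x N1 g by (intro open_Int open_INT) auto
    show "p \<in> ?N" using x N1 g by auto
    fix q assume q: "q \<in> ?N"
    then have "q \<in> U" "\<phi> q \<in> ball (\<phi> p) r" by (auto simp: N1_def)
    then have "f q = f p + (\<Sum>e\<in>onb. ((\<phi> q - \<phi> p) \<bullet> e) * G e (\<phi> q))"
      using G(2)[of "\<phi> q"] U chart_inv[OF U(1)] by simp
    also have "\<dots> = ?f q"
      using q x(3) by (intro arg_cong2[where f = "(+)"] sum.cong) (auto simp: x g inner_diff_left)
    finally show "f q = ?f q" .
  qed
  also have "\<dots> = (\<Sum>e\<in>onb. v (\<lambda>q. (x e q - x e p) * g e q))"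
    by (subst tangent_add[OF v])
      (auto simp: tangent_const[OF v] intro!: tangent_sum[OF v] smooth_intros x g)
  also have "\<dots> = (\<Sum>e\<in>onb. v (x e) * g e p)"
    by (intro sum.cong refl, subst tangent_mult[OF v])
      (auto simp: tangent_diff[OF v] tangent_const[OF v] x g smooth_diff mult.commute)
  finally show ?thesis using g(3,4) G(3) by simp
qed

section \<open>Vector fields\<close>

lemma vector_field_tangent: "X \<in> vector_fields A \<Longrightarrow> X p \<in> tangent_space A p"
  and vector_field_smooth: "X \<in> vector_fields A \<Longrightarrow> f \<in> smooth_functions A \<Longrightarrow>
    deriv_along X f \<in> smooth_functions A"
  by (simp_all add: vector_fields_def)

lemma vector_fieldI:
  "(\<And>p. X p \<in> tangent_space A p) \<Longrightarrow>
    (\<And>f. f \<in> smooth_functions A \<Longrightarrow> (\<lambda>p. X p f) \<in> smooth_functions A) \<Longrightarrow> X \<in> vector_fields A"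
  by (simp add: vector_fields_def deriv_along_def)

lemma vector_field_smooth': "X \<in> vector_fields A \<Longrightarrow> f \<in> smooth_functions A \<Longrightarrow>
    (\<lambda>p. X p f) \<in> smooth_functions A"
  using vector_field_smooth by (simp add: deriv_along_def)

lemma add_vector_field:
  "X \<in> vector_fields A \<Longrightarrow> Y \<in> vector_fields A \<Longrightarrow> (\<lambda>p. X p + Y p) \<in> vector_fields A"
  by (rule vector_fieldI)
    (blast intro: add_tangent vector_field_tangent,
      simp add: plus_fun_def smooth_add vector_field_smooth')

lemma mult_vector_field:
  "a \<in> smooth_functions A \<Longrightarrow> X \<in> vector_fields A \<Longrightarrow> (\<lambda>p. a p *\<^sub>R X p) \<in> vector_fields A"
  by (rule vector_fieldI)
    (blast intro: scaleR_tangent vector_field_tangent,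
      simp add: scaleR_fun_def smooth_mult vector_field_smooth')

lemma zero_vector_field: "(\<lambda>p. 0) \<in> vector_fields A"
  by (rule vector_fieldI) (rule zero_tangent, simp add: zero_fun_def)

lemma sum_vector_field:
  "(\<And>i. i \<in> I \<Longrightarrow> X i \<in> vector_fields A) \<Longrightarrow> (\<lambda>p. \<Sum>i\<in>I. X i p) \<in> vector_fields A"
  by (induction I rule: infinite_finite_induct) (auto intro: zero_vector_field add_vector_field)

lemma bracket_vector_field:
  assumes "X \<in> vector_fields A" "Y \<in> vector_fields A"
  shows "bracket X Y \<in> vector_fields A"
proof (rule vector_fieldI)
  note t = vector_field_tangent[OF assms(1)] vector_field_tangent[OF assms(2)]
  note s = vector_field_smooth'[OF assms(1)] vector_field_smooth'[OF assms(2)]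
  note s' = smooth_intros s
  show "bracket X Y p \<in> tangent_space A p" for p
  proof (rule tangent_spaceI)
    fix f h a c assume fh: "f \<in> smooth_functions A" "h \<in> smooth_functions A"
    show "bracket X Y p (\<lambda>x. a * f x + c * h x) = a * bracket X Y p f + c * bracket X Y p h"
      using fh by (simp add: bracket_def deriv_along_def tangent_lincomb[OF t(1)] tangent_lincomb[OF t(2)] s
        algebra_simps)
    show "bracket X Y p (\<lambda>x. f x * h x) = f p * bracket X Y p h + h p * bracket X Y p f"
      using fh by (simp add: bracket_def deriv_along_def tangent_mult[OF t(1)] tangent_mult[OF t(2)] s'
        tangent_add[OF t(1)] tangent_add[OF t(2)] algebra_simps)
  next
    fix f assume f: "f \<notin> smooth_functions A"
    then have "deriv_along Y f = (\<lambda>x. 0)" "deriv_along X f = (\<lambda>x. 0)"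
      by (simp_all add: deriv_along_def tangent_nonsmooth[OF t(1)] tangent_nonsmooth[OF t(2)])
    then show "bracket X Y p f = 0" by (simp add: bracket_def tangent_const[OF t(1)] tangent_const[OF t(2)])
  qed
  show "(\<lambda>p. bracket X Y p f) \<in> smooth_functions A" if "f \<in> smooth_functions A" for f
    using that by (simp add: bracket_def deriv_along_def s')
qed

text \<open>The coordinate fields, cut off outside a chart, form a frame near the given point; \<open>x e\<close> are the
  coordinates.\<close>

lemma ex_frame:
  "\<exists>N x E. open N \<and> p \<in> N \<and> (\<forall>e. x e \<in> smooth_functions A) \<and> (\<forall>e. E e \<in> vector_fields A) \<and>
    (\<forall>q\<in>N. \<forall>v\<in>tangent_space A q. v = (\<Sum>e\<in>onb. v (x e) *\<^sub>R E (e::'e) q)) \<and>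
    (\<forall>q\<in>N. \<forall>e\<in>onb. \<forall>e'\<in>onb. E e q (x e') = (if e = e' then 1 else 0))"
proof -
  obtain U \<phi> where U: "(U, \<phi>) \<in> A" "p \<in> U" by (rule ex_chart)
  obtain \<theta> N1 where \<theta>_ex: "open N1" "p \<in> N1" "N1 \<subseteq> U" "\<forall>x\<in>N1. \<theta> x = 1"
    "\<forall>f. smooth_on (\<phi> ` U) (f \<circ> inv_into U \<phi>) \<longrightarrow>
      (\<lambda>x. if x \<in> U then \<theta> x * f x else 0) \<in> smooth_functions A"
    using ex_extension[OF U(1) chart_open(1)[OF U(1)] U(2) subset_refl] by (elim exE conjE) (rule that)
  note \<theta> = \<theta>_ex[rule_format]
  obtain x N2 where x_ex: "open N2" "p \<in> N2" "N2 \<subseteq> U" "\<forall>e. x e \<in> smooth_functions A"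
    "\<forall>e. \<forall>q\<in>N2. x e q = \<phi> q \<bullet> e" using ex_coordinates[OF U] by (elim exE conjE) (rule that)
  note x = x_ex[rule_format]
  let ?D = "\<lambda>f q. frechet_derivative (f \<circ> inv_into U \<phi>) (at (\<phi> q))"
  define E where "E e q f = (if f \<in> smooth_functions A \<and> q \<in> U then \<theta> q * ?D f q e else 0)" for e q f
  have hd: "(f \<circ> inv_into U \<phi> has_derivative ?D f q) (at (\<phi> q))"
    if "f \<in> smooth_functions A" "q \<in> U" for f q
    using smooth_on_has_derivative[OF chart_open(2)[OF U(1)] smooth_functions_chart[OF that(1) U(1)]] that
    by blast
  have Dlin: "?D (\<lambda>x. a * f x + c * h x) q e = a * ?D f q e + c * ?D h q e"
    if "f \<in> smooth_functions A" "h \<in> smooth_functions A" "q \<in> U" for f h a c q e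
  proof -
    have "((\<lambda>x. a * f x + c * h x) \<circ> inv_into U \<phi> has_derivative
        (\<lambda>e. a * ?D f q e + c * ?D h q e)) (at (\<phi> q))"
      using hd[of f q] hd[of h q] that unfolding o_def by (auto intro!: derivative_eq_intros)
    from frechet_derivative_at[OF this] show ?thesis by metis
  qed
  have Dmult: "?D (\<lambda>x. f x * h x) q e = f q * ?D h q e + h q * ?D f q e"
    if "f \<in> smooth_functions A" "h \<in> smooth_functions A" "q \<in> U" for f h q e
  proof -
    have "((\<lambda>x. f x * h x) \<circ> inv_into U \<phi> has_derivative
        (\<lambda>e. f q * ?D h q e + h q * ?D f q e)) (at (\<phi> q))"
      using hd[of f q] hd[of h q] that chart_inv[OF U(1)] unfolding o_def
      by (auto intro!: derivative_eq_intros simp: mult.commute)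
    from frechet_derivative_at[OF this] show ?thesis by metis
  qed
  have E: "E e \<in> vector_fields A" for e
  proof (rule vector_fieldI)
    show "E e q \<in> tangent_space A q" for q
      by (rule tangent_spaceI)
        (auto simp: E_def smooth_add smooth_mult Dlin Dmult algebra_simps)
    fix f assume f: "f \<in> smooth_functions A"
    have "smooth_on (\<phi> ` U) ((\<lambda>q. ?D f q e) \<circ> inv_into U \<phi>)"
      by (rule smooth_on_cong[OF chart_open(2)[OF U(1)]
            smooth_on_directional_derivative[OF smooth_functions_chart[OF f U(1)], of e]])
        (simp add: chart_inv2[OF U(1)])
    from \<theta>(5)[OF this] show "(\<lambda>q. E e q f) \<in> smooth_functions A"
      using f by (simp add: E_def)
  qed
  have E_eq: "E e q f = ?D f q e" if "q \<in> N1" "f \<in> smooth_functions A" for e q f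
    using that \<theta>(3,4) by (auto simp: E_def)
  let ?N = "N1 \<inter> N2"
  have "v = (\<Sum>e\<in>onb. v (x e) *\<^sub>R E e q)" if q: "q \<in> ?N" and v: "v \<in> tangent_space A q" for q v
  proof (rule tangent_eqI[OF v])
    show "(\<Sum>e\<in>onb. v (x e) *\<^sub>R E e q) \<in> tangent_space A q"
      by (intro sum_tangent scaleR_tangent vector_field_tangent E)
    fix f assume f: "f \<in> smooth_functions A"
    have "v f = (\<Sum>e\<in>onb. v (x e) * E e q f)"
      using tangent_coordinates[OF U(1) _ x(4,1) _ x(5) v f] q x(3) E_eq[OF _ f] by auto
    also have "\<dots> = (\<Sum>e\<in>onb. v (x e) *\<^sub>R E e q) f"
      by (induction rule: finite_induct[OF finite_onb]) (auto simp: zero_fun_def plus_fun_def scaleR_fun_def)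
    finally show "v f = (\<Sum>e\<in>onb. v (x e) *\<^sub>R E e q) f" .
  qed
  moreover have "E e q (x e') = (if e = e' then 1 else 0)"
    if q: "q \<in> ?N" and e: "e \<in> onb" "e' \<in> onb" for q e e'
  proof -
    have o: "open (\<phi> ` ?N)" by (rule chart_image_open[OF U(1)]) (use \<theta> x in auto)
    have "((\<lambda>y. y \<bullet> e') has_derivative (\<lambda>v. v \<bullet> e')) (at (\<phi> q))"
      by (auto intro!: derivative_eq_intros)
    then have "(x e' \<circ> inv_into U \<phi> has_derivative (\<lambda>v. v \<bullet> e')) (at (\<phi> q))"
      by (rule has_derivative_transform_within_open[OF _ o])
        (use q x(3,5) chart_inv[OF U(1)] in auto)
    from frechet_derivative_at[OF this] have "?D (x e') q e = e \<bullet> e'" by metis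
    then show ?thesis using E_eq[of q "x e'"] q x(4) onb_orthonormal[OF e] by simp
  qed
  moreover have "open ?N" "p \<in> ?N" using \<theta> x by auto
  ultimately show ?thesis
    using x(4) E by (intro exI[of _ ?N] exI[of _ x] exI[of _ E] conjI ballI allI)
qed

text \<open>Combine the frame fields with constant coefficients.\<close>

lemma ex_vector_field:
  assumes "v \<in> tangent_space A p"
  shows "\<exists>X\<in>vector_fields A. X p = v"
proof -
  obtain N x E where "p \<in> N" and E: "\<forall>e. E e \<in> vector_fields A"
    and N: "\<forall>q\<in>N. \<forall>v\<in>tangent_space A q. v = (\<Sum>e\<in>onb. v (x e) *\<^sub>R E (e::'e) q)"
    using ex_frame[of p] by (elim exE conjE) (rule that)
  show ?thesis
  proof (rule bexI)
    show "(\<lambda>p. \<Sum>e\<in>onb. v (x e) *\<^sub>R E e p) \<in> vector_fields A"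
      using mult_vector_field[OF smooth_const] E by (intro sum_vector_field) blast
    show "(\<Sum>e\<in>onb. v (x e) *\<^sub>R E e p) = v" using N[rule_format, OF \<open>p \<in> N\<close> assms] by simp
  qed
qed

end

section \<open>Product manifolds\<close>

locale manifold_product =
  B: manifold "atlas B" + F: manifold "atlas F"
  for B :: "('m::t2_space, 'e::{real_inner, heine_borel}) almost_product"
    and F :: "('n::t2_space, 'f::{real_inner, heine_borel}) almost_product"
begin

lemma prod_chart_inv:
  assumes "(U, \<phi>) \<in> atlas B" "(V, \<psi>) \<in> atlas F" "z \<in> \<phi> ` U \<times> \<psi> ` V"
  shows "inv_into (U \<times> V) (map_prod \<phi> \<psi>) z = (inv_into U \<phi> (fst z), inv_into V \<psi> (snd z))"
proof (rule inv_into_f_eq)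
  have "inj_on \<phi> U" "inj_on \<psi> V"
    using B.chart_inv[OF assms(1)] F.chart_inv[OF assms(2)] by (metis inj_on_inverseI)+
  then show "inj_on (map_prod \<phi> \<psi>) (U \<times> V)" by (rule map_prod_inj_on)
  show "(inv_into U \<phi> (fst z), inv_into V \<psi> (snd z)) \<in> U \<times> V"
    using assms(3) by (auto intro: inv_into_into)
  show "map_prod \<phi> \<psi> (inv_into U \<phi> (fst z), inv_into V \<psi> (snd z)) = z"
    using assms(3) by (auto simp: f_inv_into_f)
qed

lemma map_prod_image: "map_prod \<phi> \<psi> ` (U \<times> V) = \<phi> ` U \<times> \<psi> ` V"
  by auto

lemma smooth_atlas_prod: "smooth_atlas (atlas_prod B F)"
  unfolding smooth_atlas_def
proof (intro conjI)
  show "(\<Union>(U, \<phi>)\<in>atlas_prod B F. U) = UNIV"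
  proof (intro Set.set_eqI iffI UNIV_I)
    fix z :: "'m \<times> 'n"
    obtain U \<phi> where U: "(U, \<phi>) \<in> atlas B" "fst z \<in> U" by (rule B.ex_chart)
    obtain V \<psi> where V: "(V, \<psi>) \<in> atlas F" "snd z \<in> V" by (rule F.ex_chart)
    have "(U \<times> V, map_prod \<phi> \<psi>) \<in> atlas_prod B F" "z \<in> U \<times> V"
      using U V by (auto simp: prod_atlas_def mem_Times_iff)
    then show "z \<in> (\<Union>(U, \<phi>)\<in>atlas_prod B F. U)" by blast
  qed
  show "\<forall>(W, \<zeta>)\<in>atlas_prod B F. open W \<and> open (\<zeta> ` W) \<and> homeomorphism W (\<zeta> ` W) \<zeta> (inv_into W \<zeta>)"
  proof safe
    fix W \<zeta> assume "(W, \<zeta>) \<in> atlas_prod B F"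
    then obtain U \<phi> V \<psi> where [simp]: "W = U \<times> V" "\<zeta> = map_prod \<phi> \<psi>"
      and U: "(U, \<phi>) \<in> atlas B" and V: "(V, \<psi>) \<in> atlas F"
      by (auto simp: prod_atlas_def)
    show "open W" using B.chart_open(1)[OF U] F.chart_open(1)[OF V] by (simp add: open_Times)
    show "open (\<zeta> ` W)" using B.chart_open(2)[OF U] F.chart_open(2)[OF V]
      by (simp add: open_Times map_prod_image)
    have "continuous_on (U \<times> V) (\<lambda>z. (\<phi> (fst z), \<psi> (snd z)))"
      by (intro continuous_on_Pair continuous_on_compose2[OF B.chart_continuous[OF U]]
          continuous_on_compose2[OF F.chart_continuous[OF V]] continuous_on_fst continuous_on_snd
          continuous_on_id) auto
    then have c1: "continuous_on W \<zeta>" by (simp add: map_prod_def split_beta)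
    have "continuous_on (\<phi> ` U \<times> \<psi> ` V) (\<lambda>z. (inv_into U \<phi> (fst z), inv_into V \<psi> (snd z)))"
      by (intro continuous_on_Pair continuous_on_compose2[OF B.chart_continuous_inv[OF U]]
          continuous_on_compose2[OF F.chart_continuous_inv[OF V]] continuous_on_fst continuous_on_snd
          continuous_on_id) auto
    then have c2: "continuous_on (\<zeta> ` W) (inv_into W \<zeta>)"
      unfolding \<open>W = U \<times> V\<close> \<open>\<zeta> = map_prod \<phi> \<psi>\<close> map_prod_image
      by (rule continuous_on_eq) (simp add: prod_chart_inv[OF U V])
    show "homeomorphism W (\<zeta> ` W) \<zeta> (inv_into W \<zeta>)"
      by (rule homeomorphismI[OF c1 c2])
        (auto simp: prod_chart_inv[OF U V] B.chart_inv[OF U] F.chart_inv[OF V])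
  qed
  show "\<forall>(W, \<zeta>)\<in>atlas_prod B F. \<forall>(W', \<zeta>')\<in>atlas_prod B F.
      smooth_on (\<zeta> ` (W \<inter> W')) (\<zeta>' \<circ> inv_into W \<zeta>)"
  proof safe
    fix W \<zeta> W' \<zeta>' assume "(W, \<zeta>) \<in> atlas_prod B F" "(W', \<zeta>') \<in> atlas_prod B F"
    then obtain U \<phi> V \<psi> U' \<phi>' V' \<psi>' where [simp]: "W = U \<times> V" "\<zeta> = map_prod \<phi> \<psi>"
        "W' = U' \<times> V'" "\<zeta>' = map_prod \<phi>' \<psi>'"
      and U: "(U, \<phi>) \<in> atlas B" and V: "(V, \<psi>) \<in> atlas F"
      and U': "(U', \<phi>') \<in> atlas B" and V': "(V', \<psi>') \<in> atlas F"
      by (auto simp: prod_atlas_def)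
    let ?S = "\<phi> ` (U \<inter> U')" and ?T = "\<psi> ` (V \<inter> V')"
    have S: "open ?S" using B.chart_open(1)[OF U] B.chart_open(1)[OF U']
      by (intro B.chart_image_open[OF U]) auto
    have T: "open ?T" using F.chart_open(1)[OF V] F.chart_open(1)[OF V']
      by (intro F.chart_image_open[OF V]) auto
    have ST: "open (?S \<times> ?T)" using S T by (simp add: open_Times)
    have "smooth_on (?S \<times> ?T) (\<lambda>z. ((\<phi>' \<circ> inv_into U \<phi>) (fst z), (\<psi>' \<circ> inv_into V \<psi>) (snd z)))"
      by (intro smooth_on_Pair ST smooth_on_compose[OF ST S _ B.transition_smooth[OF U U']]
          smooth_on_compose[OF ST T _ F.transition_smooth[OF V V']] smooth_on_id
          smooth_on_bounded_linear[OF ST bounded_linear_fst] smooth_on_bounded_linear[OF ST bounded_linear_snd])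
        auto
    then have "smooth_on (?S \<times> ?T) (\<zeta>' \<circ> inv_into W \<zeta>)"
    proof (rule smooth_on_cong[OF ST])
      fix z assume "z \<in> ?S \<times> ?T"
      then have "z \<in> \<phi> ` U \<times> \<psi> ` V" by auto
      then show "((\<phi>' \<circ> inv_into U \<phi>) (fst z), (\<psi>' \<circ> inv_into V \<psi>) (snd z)) = (\<zeta>' \<circ> inv_into W \<zeta>) z"
        by (simp add: prod_chart_inv[OF U V])
    qed
    moreover have "\<zeta> ` (W \<inter> W') = ?S \<times> ?T"
      by (simp add: Times_Int_Times map_prod_image)
    ultimately show "smooth_on (\<zeta> ` (W \<inter> W')) (\<zeta>' \<circ> inv_into W \<zeta>)" by simp
  qed
qed

sublocale P: manifold "atlas_prod B F"
  by unfold_locales (rule smooth_atlas_prod)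

abbreviation "SP \<equiv> smooth_functions (atlas_prod B F)"

lemma prod_chart: "(U, \<phi>) \<in> atlas B \<Longrightarrow> (V, \<psi>) \<in> atlas F \<Longrightarrow> (U \<times> V, map_prod \<phi> \<psi>) \<in> atlas_prod B F"
  by (auto simp: prod_atlas_def)

lemma smooth_prodI:
  assumes "\<And>p q. \<exists>U \<phi> V \<psi> M N. (U, \<phi>) \<in> atlas B \<and> (V, \<psi>) \<in> atlas F \<and> open M \<and> p \<in> M \<and> M \<subseteq> U \<and>
    open N \<and> q \<in> N \<and> N \<subseteq> V \<and>
    smooth_on (\<phi> ` M \<times> \<psi> ` N) (\<lambda>z. f (inv_into U \<phi> (fst z), inv_into V \<psi> (snd z)))"
  shows "f \<in> SP"
proof (rule P.smooth_functions_chartI)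
  fix x :: "'m \<times> 'n"
  obtain U \<phi> V \<psi> M N where c: "(U, \<phi>) \<in> atlas B" "(V, \<psi>) \<in> atlas F" "open M" "fst x \<in> M" "M \<subseteq> U"
    "open N" "snd x \<in> N" "N \<subseteq> V"
    "smooth_on (\<phi> ` M \<times> \<psi> ` N) (\<lambda>z. f (inv_into U \<phi> (fst z), inv_into V \<psi> (snd z)))"
    using assms[of "fst x" "snd x"] by (elim exE conjE) (rule that)
  have o: "open (\<phi> ` M \<times> \<psi> ` N)"
    using B.chart_image_open[OF c(1,3,5)] F.chart_image_open[OF c(2,6,8)] by (rule open_Times)
  have "smooth_on (\<phi> ` M \<times> \<psi> ` N) (f \<circ> inv_into (U \<times> V) (map_prod \<phi> \<psi>))"
  proof (rule smooth_on_cong[OF o c(9)])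
    fix z assume "z \<in> \<phi> ` M \<times> \<psi> ` N"
    then have "z \<in> \<phi> ` U \<times> \<psi> ` V" using c(5,8) by auto
    then show "f (inv_into U \<phi> (fst z), inv_into V \<psi> (snd z)) = (f \<circ> inv_into (U \<times> V) (map_prod \<phi> \<psi>)) z"
      by (simp add: prod_chart_inv[OF c(1,2)])
  qed
  moreover have "open (M \<times> N)" "x \<in> M \<times> N" "M \<times> N \<subseteq> U \<times> V"
    using c by (auto simp: open_Times mem_Times_iff)
  ultimately show "\<exists>U \<phi> N. (U, \<phi>) \<in> atlas_prod B F \<and> open N \<and> x \<in> N \<and> N \<subseteq> U \<and>
      smooth_on (\<phi> ` N) (f \<circ> inv_into U \<phi>)"
    using prod_chart[OF c(1,2)] by (metis map_prod_image)
qed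

lemma smooth_prod_chart:
  assumes f: "f \<in> SP" and U: "(U, \<phi>) \<in> atlas B" and V: "(V, \<psi>) \<in> atlas F"
  shows "smooth_on (\<phi> ` U \<times> \<psi> ` V) (\<lambda>z. f (inv_into U \<phi> (fst z), inv_into V \<psi> (snd z)))"
proof -
  have o: "open (\<phi> ` U \<times> \<psi> ` V)" using B.chart_open(2)[OF U] F.chart_open(2)[OF V] by (rule open_Times)
  have "smooth_on (\<phi> ` U \<times> \<psi> ` V) (f \<circ> inv_into (U \<times> V) (map_prod \<phi> \<psi>))"
    using P.smooth_functions_chart[OF f prod_chart[OF U V]] by (simp add: map_prod_image)
  then show ?thesis
    by (rule smooth_on_cong[OF o]) (simp add: prod_chart_inv[OF U V])
qed

lemma smooth_pullback_fst:
  assumes a: "a \<in> smooth B"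
  shows "(\<lambda>x. a (fst x)) \<in> SP"
proof (rule smooth_prodI)
  fix p q
  obtain U \<phi> where U: "(U, \<phi>) \<in> atlas B" "p \<in> U" by (rule B.ex_chart)
  obtain V \<psi> where V: "(V, \<psi>) \<in> atlas F" "q \<in> V" by (rule F.ex_chart)
  have o: "open (\<phi> ` U \<times> \<psi> ` V)" using B.chart_open(2)[OF U(1)] F.chart_open(2)[OF V(1)] by (rule open_Times)
  have "smooth_on (\<phi> ` U \<times> \<psi> ` V) (\<lambda>z. (a \<circ> inv_into U \<phi>) (fst z))"
    by (rule smooth_on_compose[OF o B.chart_open(2)[OF U(1)]
          smooth_on_bounded_linear[OF o bounded_linear_fst smooth_on_id[OF o]]
          B.smooth_functions_chart[OF a U(1)]]) auto
  note sm = this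
  show "\<exists>U \<phi> V \<psi> M N. (U, \<phi>) \<in> atlas B \<and> (V, \<psi>) \<in> atlas F \<and> open M \<and> p \<in> M \<and> M \<subseteq> U \<and>
    open N \<and> q \<in> N \<and> N \<subseteq> V \<and>
    smooth_on (\<phi> ` M \<times> \<psi> ` N) (\<lambda>z. a (fst (inv_into U \<phi> (fst z), inv_into V \<psi> (snd z))))"
    by (rule exI[of _ U], rule exI[of _ \<phi>], rule exI[of _ V], rule exI[of _ \<psi>],
        rule exI[of _ U], rule exI[of _ V])
      (use sm U V B.chart_open(1)[OF U(1)] F.chart_open(1)[OF V(1)] in \<open>auto simp: o_def\<close>)
qed

lemma smooth_pullback_snd:
  assumes a: "a \<in> smooth F"
  shows "(\<lambda>x. a (snd x)) \<in> SP"
proof (rule smooth_prodI)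
  fix p q
  obtain U \<phi> where U: "(U, \<phi>) \<in> atlas B" "p \<in> U" by (rule B.ex_chart)
  obtain V \<psi> where V: "(V, \<psi>) \<in> atlas F" "q \<in> V" by (rule F.ex_chart)
  have o: "open (\<phi> ` U \<times> \<psi> ` V)" using B.chart_open(2)[OF U(1)] F.chart_open(2)[OF V(1)] by (rule open_Times)
  have "smooth_on (\<phi> ` U \<times> \<psi> ` V) (\<lambda>z. (a \<circ> inv_into V \<psi>) (snd z))"
    by (rule smooth_on_compose[OF o F.chart_open(2)[OF V(1)]
          smooth_on_bounded_linear[OF o bounded_linear_snd smooth_on_id[OF o]]
          F.smooth_functions_chart[OF a V(1)]]) auto
  note sm = this
  show "\<exists>U \<phi> V \<psi> M N. (U, \<phi>) \<in> atlas B \<and> (V, \<psi>) \<in> atlas F \<and> open M \<and> p \<in> M \<and> M \<subseteq> U \<and>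
    open N \<and> q \<in> N \<and> N \<subseteq> V \<and>
    smooth_on (\<phi> ` M \<times> \<psi> ` N) (\<lambda>z. a (snd (inv_into U \<phi> (fst z), inv_into V \<psi> (snd z))))"
    by (rule exI[of _ U], rule exI[of _ \<phi>], rule exI[of _ V], rule exI[of _ \<psi>],
        rule exI[of _ U], rule exI[of _ V])
      (use sm U V B.chart_open(1)[OF U(1)] F.chart_open(1)[OF V(1)] in \<open>auto simp: o_def\<close>)
qed

lemma smooth_slice_fst:
  assumes f: "f \<in> SP"
  shows "(\<lambda>p. f (p, q)) \<in> smooth B"
proof -
  obtain V \<psi> where V: "(V, \<psi>) \<in> atlas F" "q \<in> V" by (rule F.ex_chart)
  have "smooth_on (\<phi> ` U) ((\<lambda>p. f (p, q)) \<circ> inv_into U \<phi>)" if U: "(U, \<phi>) \<in> atlas B" for U \<phi>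
  proof -
    note oU = B.chart_open(2)[OF U]
    have o: "open (\<phi> ` U \<times> \<psi> ` V)" using oU F.chart_open(2)[OF V(1)] by (rule open_Times)
    have "smooth_on (\<phi> ` U) (\<lambda>y. (\<lambda>z. f (inv_into U \<phi> (fst z), inv_into V \<psi> (snd z))) (y, \<psi> q))"
      by (rule smooth_on_compose[OF oU o smooth_on_Pair[OF oU smooth_on_id[OF oU] smooth_on_const]
            smooth_prod_chart[OF f U V(1)]]) (use V in auto)
    then show ?thesis by (simp add: o_def F.chart_inv[OF V])
  qed
  then show ?thesis by (auto simp: smooth_functions_def)
qed

lemma smooth_slice_snd:
  assumes f: "f \<in> SP"
  shows "(\<lambda>q. f (p, q)) \<in> smooth F"
proof -
  obtain U \<phi> where U: "(U, \<phi>) \<in> atlas B" "p \<in> U" by (rule B.ex_chart)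
  have "smooth_on (\<psi> ` V) ((\<lambda>q. f (p, q)) \<circ> inv_into V \<psi>)" if V: "(V, \<psi>) \<in> atlas F" for V \<psi>
  proof -
    note oV = F.chart_open(2)[OF V]
    have o: "open (\<phi> ` U \<times> \<psi> ` V)" using B.chart_open(2)[OF U(1)] oV by (rule open_Times)
    have "smooth_on (\<psi> ` V) (\<lambda>y. (\<lambda>z. f (inv_into U \<phi> (fst z), inv_into V \<psi> (snd z))) (\<phi> p, y))"
      by (rule smooth_on_compose[OF oV o smooth_on_Pair[OF oV smooth_on_const smooth_on_id[OF oV]]
            smooth_prod_chart[OF f U(1) V]]) (use U in auto)
    then show ?thesis by (simp add: o_def B.chart_inv[OF U])
  qed
  then show ?thesis by (auto simp: smooth_functions_def)
qed

lemma incl_fst_apply: "f \<in> SP \<Longrightarrow> incl_fst B F x v f = v (\<lambda>p. f (p, snd x))"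
  by (simp add: incl_fst_def pushforward_def o_def)

lemma incl_snd_apply: "f \<in> SP \<Longrightarrow> incl_snd B F x v f = v (\<lambda>q. f (fst x, q))"
  by (simp add: incl_snd_def pushforward_def o_def)

lemma incl_fst_tangent:
  assumes v: "v \<in> tangent B (fst x)"
  shows "incl_fst B F x v \<in> tangent_space (atlas_prod B F) x"
  by (rule P.tangent_spaceI)
    (simp_all add: incl_fst_apply P.smooth_add P.smooth_mult smooth_slice_fst B.tangent_lincomb[OF v]
      B.tangent_mult[OF v], simp add: incl_fst_def pushforward_def)

lemma incl_snd_tangent:
  assumes v: "v \<in> tangent F (snd x)"
  shows "incl_snd B F x v \<in> tangent_space (atlas_prod B F) x"
  by (rule P.tangent_spaceI)
    (simp_all add: incl_snd_apply P.smooth_add P.smooth_mult smooth_slice_snd F.tangent_lincomb[OF v]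
      F.tangent_mult[OF v], simp add: incl_snd_def pushforward_def)

text \<open>In a chart the derivative along a lifted field is a combination of partial derivatives whose
  coefficients are smooth functions on the factor.\<close>

lemma lift_fst_smooth:
  assumes X: "X \<in> vfields B" and f: "f \<in> SP"
  shows "deriv_along (lift_fst B F X) f \<in> SP"
proof (rule smooth_prodI)
  fix p q
  obtain U \<phi> where U: "(U, \<phi>) \<in> atlas B" "p \<in> U" by (rule B.ex_chart)
  obtain V \<psi> where V: "(V, \<psi>) \<in> atlas F" "q \<in> V" by (rule F.ex_chart)
  obtain x N where x_ex: "open N" "p \<in> N" "N \<subseteq> U" "\<forall>e. x e \<in> smooth B" "\<forall>e. \<forall>q\<in>N. x e q = \<phi> q \<bullet> e"
    using B.ex_coordinates[OF U] by (elim exE conjE) (rule that)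
  note x = x_ex[rule_format]
  let ?H = "\<lambda>z. f (inv_into U \<phi> (fst z), inv_into V \<psi> (snd z))"
  let ?D = "\<lambda>z. frechet_derivative ?H (at z)"
  note H = smooth_prod_chart[OF f U(1) V(1)]
  note oN = B.chart_image_open[OF U(1) x(1,3)] and oV = F.chart_open(2)[OF V(1)]
  have o: "open (\<phi> ` U \<times> \<psi> ` V)" using B.chart_open(2)[OF U(1)] oV by (rule open_Times)
  have o': "open (\<phi> ` N \<times> \<psi> ` V)" using oN oV by (rule open_Times)
  have sub: "\<phi> ` N \<times> \<psi> ` V \<subseteq> \<phi> ` U \<times> \<psi> ` V" using x(3) by auto
  have "smooth_on (\<phi> ` N \<times> \<psi> ` V)
      (\<lambda>z. \<Sum>e\<in>onb. ((\<lambda>p. X p (x e)) \<circ> inv_into U \<phi>) (fst z) * ?D z (e, 0))"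
  proof (intro smooth_on_sum smooth_on_mult o')
    fix e
    show "smooth_on (\<phi> ` N \<times> \<psi> ` V) (\<lambda>z. ((\<lambda>p. X p (x e)) \<circ> inv_into U \<phi>) (fst z))"
      by (rule smooth_on_compose[OF o' B.chart_open(2)[OF U(1)]
            smooth_on_bounded_linear[OF o' bounded_linear_fst smooth_on_id[OF o']]
            B.smooth_functions_chart[OF B.vector_field_smooth'[OF X x(4)] U(1)]]) (use x(3) in auto)
    show "smooth_on (\<phi> ` N \<times> \<psi> ` V) (\<lambda>z. ?D z (e, 0))"
      by (rule smooth_on_subset[OF smooth_on_directional_derivative[OF H] sub])
  qed
  then have "smooth_on (\<phi> ` N \<times> \<psi> ` V)
      (\<lambda>z. deriv_along (lift_fst B F X) f (inv_into U \<phi> (fst z), inv_into V \<psi> (snd z)))"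
  proof (rule smooth_on_cong[OF o'])
    fix z assume z: "z \<in> \<phi> ` N \<times> \<psi> ` V"
    then obtain p' q' where pq: "p' \<in> N" "q' \<in> V" "z = (\<phi> p', \<psi> q')" by auto
    then have p'U: "p' \<in> U" using x(3) by auto
    have inv: "inv_into U \<phi> (fst z) = p'" "inv_into V \<psi> (snd z) = q'"
      using pq p'U B.chart_inv[OF U(1)] F.chart_inv[OF V(1)] by auto
    have "((\<lambda>y. (y, \<psi> q')) has_derivative (\<lambda>e. (e, 0))) (at (\<phi> p'))"
      by (auto intro!: derivative_eq_intros)
    moreover have "(?H has_derivative ?D (\<phi> p', \<psi> q')) (at (\<phi> p', \<psi> q'))"
      by (rule smooth_on_has_derivative[OF o H]) (use p'U pq in auto)
    ultimately have "((\<lambda>y. ?H (y, \<psi> q')) has_derivative (\<lambda>e. ?D (\<phi> p', \<psi> q') (e, 0))) (at (\<phi> p'))"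
      using has_derivative_compose by blast
    then have "((\<lambda>p. f (p, q')) \<circ> inv_into U \<phi> has_derivative (\<lambda>e. ?D (\<phi> p', \<psi> q') (e, 0))) (at (\<phi> p'))"
      using F.chart_inv[OF V(1) pq(2)] by (simp add: o_def)
    note fd = frechet_derivative_at[OF this]
    have D: "frechet_derivative ((\<lambda>p. f (p, q')) \<circ> inv_into U \<phi>) (at (\<phi> p')) e = ?D z (e, 0)" for e
      unfolding pq(3) by (rule fun_cong[OF fd, symmetric])
    have "deriv_along (lift_fst B F X) f (p', q') = X p' (\<lambda>p. f (p, q'))"
      using f by (simp add: deriv_along_def lift_fst_def incl_fst_apply)
    also have "\<dots> = (\<Sum>e\<in>onb. X p' (x e) * ?D z (e, 0))"
      using B.tangent_coordinates[OF U(1) p'U x(4) x(1) pq(1) x(5) B.vector_field_tangent[OF X]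
          smooth_slice_fst[OF f]] by (simp add: D)
    finally show "(\<Sum>e\<in>onb. ((\<lambda>p. X p (x e)) \<circ> inv_into U \<phi>) (fst z) * ?D z (e, 0)) =
        deriv_along (lift_fst B F X) f (inv_into U \<phi> (fst z), inv_into V \<psi> (snd z))"
      by (simp add: inv)
  qed
  note sm = this
  show "\<exists>U \<phi> V \<psi> M N. (U, \<phi>) \<in> atlas B \<and> (V, \<psi>) \<in> atlas F \<and> open M \<and> p \<in> M \<and> M \<subseteq> U \<and>
    open N \<and> q \<in> N \<and> N \<subseteq> V \<and> smooth_on (\<phi> ` M \<times> \<psi> ` N)
      (\<lambda>z. deriv_along (lift_fst B F X) f (inv_into U \<phi> (fst z), inv_into V \<psi> (snd z)))"
    by (rule exI[of _ U], rule exI[of _ \<phi>], rule exI[of _ V], rule exI[of _ \<psi>],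
        rule exI[of _ N], rule exI[of _ V])
      (use sm U V x(1-3) F.chart_open(1)[OF V(1)] in \<open>simp\<close>)
qed

lemma lift_snd_smooth:
  assumes X: "X \<in> vfields F" and f: "f \<in> SP"
  shows "deriv_along (lift_snd B F X) f \<in> SP"
proof (rule smooth_prodI)
  fix p q
  obtain U \<phi> where U: "(U, \<phi>) \<in> atlas B" "p \<in> U" by (rule B.ex_chart)
  obtain V \<psi> where V: "(V, \<psi>) \<in> atlas F" "q \<in> V" by (rule F.ex_chart)
  obtain x N where x_ex: "open N" "q \<in> N" "N \<subseteq> V" "\<forall>e. x e \<in> smooth F" "\<forall>e. \<forall>q\<in>N. x e q = \<psi> q \<bullet> e"
    using F.ex_coordinates[OF V] by (elim exE conjE) (rule that)
  note x = x_ex[rule_format]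
  let ?H = "\<lambda>z. f (inv_into U \<phi> (fst z), inv_into V \<psi> (snd z))"
  let ?D = "\<lambda>z. frechet_derivative ?H (at z)"
  note H = smooth_prod_chart[OF f U(1) V(1)]
  note oN = F.chart_image_open[OF V(1) x(1,3)] and oU = B.chart_open(2)[OF U(1)]
  have o: "open (\<phi> ` U \<times> \<psi> ` V)" using oU F.chart_open(2)[OF V(1)] by (rule open_Times)
  have o': "open (\<phi> ` U \<times> \<psi> ` N)" using oU oN by (rule open_Times)
  have sub: "\<phi> ` U \<times> \<psi> ` N \<subseteq> \<phi> ` U \<times> \<psi> ` V" using x(3) by auto
  have "smooth_on (\<phi> ` U \<times> \<psi> ` N)
      (\<lambda>z. \<Sum>e\<in>onb. ((\<lambda>p. X p (x e)) \<circ> inv_into V \<psi>) (snd z) * ?D z (0, e))"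
  proof (intro smooth_on_sum smooth_on_mult o')
    fix e
    show "smooth_on (\<phi> ` U \<times> \<psi> ` N) (\<lambda>z. ((\<lambda>p. X p (x e)) \<circ> inv_into V \<psi>) (snd z))"
      by (rule smooth_on_compose[OF o' F.chart_open(2)[OF V(1)]
            smooth_on_bounded_linear[OF o' bounded_linear_snd smooth_on_id[OF o']]
            F.smooth_functions_chart[OF F.vector_field_smooth'[OF X x(4)] V(1)]]) (use x(3) in auto)
    show "smooth_on (\<phi> ` U \<times> \<psi> ` N) (\<lambda>z. ?D z (0, e))"
      by (rule smooth_on_subset[OF smooth_on_directional_derivative[OF H] sub])
  qed
  then have "smooth_on (\<phi> ` U \<times> \<psi> ` N)
      (\<lambda>z. deriv_along (lift_snd B F X) f (inv_into U \<phi> (fst z), inv_into V \<psi> (snd z)))"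
  proof (rule smooth_on_cong[OF o'])
    fix z assume z: "z \<in> \<phi> ` U \<times> \<psi> ` N"
    then obtain p' q' where pq: "p' \<in> U" "q' \<in> N" "z = (\<phi> p', \<psi> q')" by auto
    then have q'V: "q' \<in> V" using x(3) by auto
    have inv: "inv_into U \<phi> (fst z) = p'" "inv_into V \<psi> (snd z) = q'"
      using pq q'V B.chart_inv[OF U(1)] F.chart_inv[OF V(1)] by auto
    have "((\<lambda>y. (\<phi> p', y)) has_derivative (\<lambda>e. (0, e))) (at (\<psi> q'))"
      by (auto intro!: derivative_eq_intros)
    moreover have "(?H has_derivative ?D (\<phi> p', \<psi> q')) (at (\<phi> p', \<psi> q'))"
      by (rule smooth_on_has_derivative[OF o H]) (use q'V pq in auto)
    ultimately have "((\<lambda>y. ?H (\<phi> p', y)) has_derivative (\<lambda>e. ?D (\<phi> p', \<psi> q') (0, e))) (at (\<psi> q'))"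
      using has_derivative_compose by blast
    then have "((\<lambda>q. f (p', q)) \<circ> inv_into V \<psi> has_derivative (\<lambda>e. ?D (\<phi> p', \<psi> q') (0, e))) (at (\<psi> q'))"
      using B.chart_inv[OF U(1) pq(1)] by (simp add: o_def)
    note fd = frechet_derivative_at[OF this]
    have D: "frechet_derivative ((\<lambda>q. f (p', q)) \<circ> inv_into V \<psi>) (at (\<psi> q')) e = ?D z (0, e)" for e
      unfolding pq(3) by (rule fun_cong[OF fd, symmetric])
    have "deriv_along (lift_snd B F X) f (p', q') = X q' (\<lambda>q. f (p', q))"
      using f by (simp add: deriv_along_def lift_snd_def incl_snd_apply)
    also have "\<dots> = (\<Sum>e\<in>onb. X q' (x e) * ?D z (0, e))"
      using F.tangent_coordinates[OF V(1) q'V x(4) x(1) pq(2) x(5) F.vector_field_tangent[OF X]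
          smooth_slice_snd[OF f]] by (simp add: D)
    finally show "(\<Sum>e\<in>onb. ((\<lambda>p. X p (x e)) \<circ> inv_into V \<psi>) (snd z) * ?D z (0, e)) =
        deriv_along (lift_snd B F X) f (inv_into U \<phi> (fst z), inv_into V \<psi> (snd z))"
      by (simp add: inv)
  qed
  note sm = this
  show "\<exists>U \<phi> V \<psi> M N. (U, \<phi>) \<in> atlas B \<and> (V, \<psi>) \<in> atlas F \<and> open M \<and> p \<in> M \<and> M \<subseteq> U \<and>
    open N \<and> q \<in> N \<and> N \<subseteq> V \<and> smooth_on (\<phi> ` M \<times> \<psi> ` N)
      (\<lambda>z. deriv_along (lift_snd B F X) f (inv_into U \<phi> (fst z), inv_into V \<psi> (snd z)))"
    by (rule exI[of _ U], rule exI[of _ \<phi>], rule exI[of _ V], rule exI[of _ \<psi>],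
        rule exI[of _ U], rule exI[of _ N])
      (use sm U V x(1-3) B.chart_open(1)[OF U(1)] in \<open>simp\<close>)
qed

lemma lift_fst_vector_field: "X \<in> vfields B \<Longrightarrow> lift_fst B F X \<in> vector_fields (atlas_prod B F)"
  using lift_fst_smooth
  by (auto simp: vector_fields_def lift_fst_def intro: incl_fst_tangent)

lemma lift_snd_vector_field: "X \<in> vfields F \<Longrightarrow> lift_snd B F X \<in> vector_fields (atlas_prod B F)"
  using lift_snd_smooth
  by (auto simp: vector_fields_def lift_snd_def intro: incl_snd_tangent)

text \<open>Near a point the coordinates of the product are sums of pullbacks from the factors, so these
  pullbacks determine a tangent vector.\<close>

lemma tangent_prod_eqI:
  assumes v: "v \<in> tangent_space (atlas_prod B F) x" and w: "w \<in> tangent_space (atlas_prod B F) x"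
    and fst: "\<And>a. a \<in> smooth B \<Longrightarrow> v (\<lambda>x. a (fst x)) = w (\<lambda>x. a (fst x))"
    and snd: "\<And>a. a \<in> smooth F \<Longrightarrow> v (\<lambda>x. a (snd x)) = w (\<lambda>x. a (snd x))"
  shows "v = w"
proof (rule P.tangent_eqI[OF v w])
  fix f assume f: "f \<in> SP"
  obtain U \<phi> where U: "(U, \<phi>) \<in> atlas B" "fst x \<in> U" by (rule B.ex_chart)
  obtain V \<psi> where V: "(V, \<psi>) \<in> atlas F" "snd x \<in> V" by (rule F.ex_chart)
  obtain y M where y_ex: "open M" "fst x \<in> M" "M \<subseteq> U" "\<forall>e. y e \<in> smooth B" "\<forall>e. \<forall>q\<in>M. y e q = \<phi> q \<bullet> e"
    using B.ex_coordinates[OF U] by (elim exE conjE) (rule that)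
  note y = y_ex[rule_format]
  obtain z N where z_ex: "open N" "snd x \<in> N" "N \<subseteq> V" "\<forall>e. z e \<in> smooth F" "\<forall>e. \<forall>q\<in>N. z e q = \<psi> q \<bullet> e"
    using F.ex_coordinates[OF V] by (elim exE conjE) (rule that)
  note z = z_ex[rule_format]
  let ?x = "\<lambda>e u. y (fst e) (fst u) + z (snd e) (snd u)"
  have pb: "(\<lambda>u. y (fst e) (fst u)) \<in> SP" "(\<lambda>u. z (snd e) (snd u)) \<in> SP" for e
    using smooth_pullback_fst[OF y(4)] smooth_pullback_snd[OF z(4)] by auto
  have xs: "?x e \<in> SP" for e using pb by (rule P.smooth_add)
  have W: "(U \<times> V, map_prod \<phi> \<psi>) \<in> atlas_prod B F" "x \<in> U \<times> V"
    using U V prod_chart by (auto simp: mem_Times_iff)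
  have oMN: "open (M \<times> N)" "x \<in> M \<times> N" using y z by (auto simp: open_Times mem_Times_iff)
  have xe: "?x e u = map_prod \<phi> \<psi> u \<bullet> e" if "u \<in> M \<times> N" for e u
    using that y(5) z(5) by (auto simp: inner_prod_def)
  have "v (?x e) = w (?x e)" for e
    using P.tangent_add[OF v pb[of e]] P.tangent_add[OF w pb[of e]] fst[OF y(4)] snd[OF z(4)] by simp
  then show "v f = w f"
    using P.tangent_coordinates[OF W xs oMN xe v f] P.tangent_coordinates[OF W xs oMN xe w f] by simp
qed

abbreviation proj_fst :: "('m \<times> 'n) tvec \<Rightarrow> 'm tvec" where "proj_fst \<equiv> pushforward (atlas B) fst"
abbreviation proj_snd :: "('m \<times> 'n) tvec \<Rightarrow> 'n tvec" where "proj_snd \<equiv> pushforward (atlas F) snd"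

lemma proj_fst_tangent:
  assumes v: "v \<in> tangent_space (atlas_prod B F) x"
  shows "proj_fst v \<in> tangent B (fst x)"
  by (rule B.tangent_spaceI)
    (simp_all add: pushforward_def o_def B.smooth_add B.smooth_mult P.tangent_lincomb[OF v]
      P.tangent_mult[OF v] smooth_pullback_fst)

lemma proj_snd_tangent:
  assumes v: "v \<in> tangent_space (atlas_prod B F) x"
  shows "proj_snd v \<in> tangent F (snd x)"
  by (rule F.tangent_spaceI)
    (simp_all add: pushforward_def o_def F.smooth_add F.smooth_mult P.tangent_lincomb[OF v]
      P.tangent_mult[OF v] smooth_pullback_snd)

lemma incl_apply_pullback:
  "a \<in> smooth B \<Longrightarrow> incl_fst B F x v (\<lambda>x. a (fst x)) = v a"
  "u \<in> tangent B (fst x) \<Longrightarrow> c \<in> smooth F \<Longrightarrow> incl_fst B F x u (\<lambda>x. c (snd x)) = 0"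
  "w \<in> tangent F (snd x) \<Longrightarrow> a \<in> smooth B \<Longrightarrow> incl_snd B F x w (\<lambda>x. a (fst x)) = 0"
  "c \<in> smooth F \<Longrightarrow> incl_snd B F x z (\<lambda>x. c (snd x)) = z c"
  by (simp_all add: incl_fst_apply incl_snd_apply smooth_pullback_fst smooth_pullback_snd
      B.tangent_const F.tangent_const)

lemma proj_incl:
  "v \<in> tangent B (fst x) \<Longrightarrow> proj_fst (incl_fst B F x v) = v"
  "v \<in> tangent B (fst x) \<Longrightarrow> proj_snd (incl_fst B F x v) = 0"
  "w \<in> tangent F (snd x) \<Longrightarrow> proj_fst (incl_snd B F x w) = 0"
  "w \<in> tangent F (snd x) \<Longrightarrow> proj_snd (incl_snd B F x w) = w"
  by (auto simp: fun_eq_iff pushforward_def o_def incl_apply_pullback zero_fun_def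
      dest: B.tangent_nonsmooth F.tangent_nonsmooth)

lemma proj_linear:
  "proj_fst (v + w) = proj_fst v + proj_fst w" "proj_fst (a *\<^sub>R v) = a *\<^sub>R proj_fst v"
  "proj_snd (v + w) = proj_snd v + proj_snd w" "proj_snd (a *\<^sub>R v) = a *\<^sub>R proj_snd v"
  by (auto simp: fun_eq_iff pushforward_def plus_fun_def scaleR_fun_def)

lemma incl_linear:
  "incl_fst B F x (v + v') = incl_fst B F x v + incl_fst B F x v'"
  "incl_fst B F x (a *\<^sub>R v) = a *\<^sub>R incl_fst B F x v" "incl_fst B F x 0 = 0"
  "incl_snd B F x (w + w') = incl_snd B F x w + incl_snd B F x w'"
  "incl_snd B F x (a *\<^sub>R w) = a *\<^sub>R incl_snd B F x w" "incl_snd B F x 0 = 0"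
  by (auto simp: fun_eq_iff incl_fst_def incl_snd_def pushforward_def plus_fun_def scaleR_fun_def zero_fun_def)

lemma tangent_prod_split:
  assumes v: "v \<in> tangent_space (atlas_prod B F) x"
  shows "v = incl_fst B F x (proj_fst v) + incl_snd B F x (proj_snd v)"
proof (rule tangent_prod_eqI[OF v])
  note t = proj_fst_tangent[OF v] proj_snd_tangent[OF v]
  show "incl_fst B F x (proj_fst v) + incl_snd B F x (proj_snd v) \<in> tangent_space (atlas_prod B F) x"
    by (intro P.add_tangent incl_fst_tangent incl_snd_tangent t)
  show "v (\<lambda>x. a (fst x)) = (incl_fst B F x (proj_fst v) + incl_snd B F x (proj_snd v)) (\<lambda>x. a (fst x))"
    if "a \<in> smooth B" for a
    using that t by (simp add: plus_fun_def incl_apply_pullback) (simp add: pushforward_def o_def)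
  show "v (\<lambda>x. c (snd x)) = (incl_fst B F x (proj_fst v) + incl_snd B F x (proj_snd v)) (\<lambda>x. c (snd x))"
    if "c \<in> smooth F" for c
    using that t by (simp add: plus_fun_def incl_apply_pullback) (simp add: pushforward_def o_def)
qed

section \<open>Lifted vector fields\<close>

abbreviation "lB \<equiv> lift_fst B F"
abbreviation "lF \<equiv> lift_snd B F"

lemma deriv_lift_pullback:
  "a \<in> smooth B \<Longrightarrow> deriv_along (lB X) (\<lambda>x. a (fst x)) = (\<lambda>x. deriv_along X a (fst x))"
  "X \<in> vfields B \<Longrightarrow> c \<in> smooth F \<Longrightarrow> deriv_along (lB X) (\<lambda>x. c (snd x)) = (\<lambda>x. 0)"
  "V \<in> vfields F \<Longrightarrow> a \<in> smooth B \<Longrightarrow> deriv_along (lF V) (\<lambda>x. a (fst x)) = (\<lambda>x. 0)"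
  "c \<in> smooth F \<Longrightarrow> deriv_along (lF V) (\<lambda>x. c (snd x)) = (\<lambda>x. deriv_along V c (snd x))"
  by (simp_all add: fun_eq_iff deriv_along_def lift_fst_def lift_snd_def incl_apply_pullback
      B.vector_field_tangent F.vector_field_tangent)

lemma bracket_apply: "bracket X Y x f = deriv_along X (deriv_along Y f) x - deriv_along Y (deriv_along X f) x"
  by (simp add: bracket_def deriv_along_def)

lemma deriv_lift_const:
  "X \<in> vfields B \<Longrightarrow> deriv_along (lB X) (\<lambda>x. c) = (\<lambda>x. 0)"
  "V \<in> vfields F \<Longrightarrow> deriv_along (lF V) (\<lambda>x. c) = (\<lambda>x. 0)"
  using P.tangent_const[OF P.vector_field_tangent[OF lift_fst_vector_field]]
    P.tangent_const[OF P.vector_field_tangent[OF lift_snd_vector_field]]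
  by (auto simp: deriv_along_def)

lemma bracket_lift_fst:
  assumes "X \<in> vfields B" "Y \<in> vfields B"
  shows "bracket (lB X) (lB Y) = lB (bracket X Y)"
proof
  fix x
  have br: "bracket X Y \<in> vfields B" using assms by (rule B.bracket_vector_field)
  show "bracket (lB X) (lB Y) x = lB (bracket X Y) x"
  proof (rule tangent_prod_eqI)
    show "bracket (lB X) (lB Y) x \<in> tangent_space (atlas_prod B F) x"
      "lB (bracket X Y) x \<in> tangent_space (atlas_prod B F) x"
      using assms br P.bracket_vector_field lift_fst_vector_field P.vector_field_tangent by blast+
    fix a assume a: "a \<in> smooth B"
    show "bracket (lB X) (lB Y) x (\<lambda>x. a (fst x)) = lB (bracket X Y) x (\<lambda>x. a (fst x))"
      using assms a br B.vector_field_smooth[OF _ a]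
      by (simp add: bracket_apply deriv_lift_pullback)
        (simp add: bracket_apply lift_fst_def incl_apply_pullback)
  next
    fix c assume c: "c \<in> smooth F"
    show "bracket (lB X) (lB Y) x (\<lambda>x. c (snd x)) = lB (bracket X Y) x (\<lambda>x. c (snd x))"
      using assms c br
      by (simp add: bracket_apply deriv_lift_pullback deriv_lift_const)
        (simp add: lift_fst_def incl_apply_pullback B.vector_field_tangent)
  qed
qed

lemma bracket_lift_snd:
  assumes "V \<in> vfields F" "W \<in> vfields F"
  shows "bracket (lF V) (lF W) = lF (bracket V W)"
proof
  fix x
  have br: "bracket V W \<in> vfields F" using assms by (rule F.bracket_vector_field)
  show "bracket (lF V) (lF W) x = lF (bracket V W) x"
  proof (rule tangent_prod_eqI)
    show "bracket (lF V) (lF W) x \<in> tangent_space (atlas_prod B F) x"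
      "lF (bracket V W) x \<in> tangent_space (atlas_prod B F) x"
      using assms br P.bracket_vector_field lift_snd_vector_field P.vector_field_tangent by blast+
    fix c assume c: "c \<in> smooth F"
    show "bracket (lF V) (lF W) x (\<lambda>x. c (snd x)) = lF (bracket V W) x (\<lambda>x. c (snd x))"
      using assms c br F.vector_field_smooth[OF _ c]
      by (simp add: bracket_apply deriv_lift_pullback)
        (simp add: bracket_apply lift_snd_def incl_apply_pullback)
  next
    fix a assume a: "a \<in> smooth B"
    show "bracket (lF V) (lF W) x (\<lambda>x. a (fst x)) = lF (bracket V W) x (\<lambda>x. a (fst x))"
      using assms a br
      by (simp add: bracket_apply deriv_lift_pullback deriv_lift_const)
        (simp add: lift_snd_def incl_apply_pullback F.vector_field_tangent)
  qed
qed

text \<open>The mixed bracket is a derivation that kills all pullbacks from both factors.\<close>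

lemma bracket_lift_mixed:
  assumes X: "X \<in> vfields B" and V: "V \<in> vfields F"
  shows "bracket (lB X) (lF V) = (\<lambda>x. 0)"
proof
  fix x
  show "bracket (lB X) (lF V) x = 0"
  proof (rule tangent_prod_eqI)
    show "bracket (lB X) (lF V) x \<in> tangent_space (atlas_prod B F) x"
      using X V P.bracket_vector_field lift_fst_vector_field lift_snd_vector_field P.vector_field_tangent
      by blast
    show "(0::('m \<times> 'n) tvec) \<in> tangent_space (atlas_prod B F) x" by (rule P.zero_tangent)
    fix a assume a: "a \<in> smooth B"
    show "bracket (lB X) (lF V) x (\<lambda>x. a (fst x)) = 0 (\<lambda>x. a (fst x))"
      using X V a B.vector_field_smooth[OF X a]
      by (simp add: bracket_apply deriv_lift_pullback deriv_lift_const zero_fun_def)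
  next
    fix c assume c: "c \<in> smooth F"
    show "bracket (lB X) (lF V) x (\<lambda>x. c (snd x)) = 0 (\<lambda>x. c (snd x))"
      using X V c F.vector_field_smooth[OF V c]
      by (simp add: bracket_apply deriv_lift_pullback deriv_lift_const zero_fun_def)
  qed
qed

lemma deriv_lift_commute:
  assumes "X \<in> vfields B" "V \<in> vfields F"
  shows "deriv_along (lF V) (deriv_along (lB X) f) = deriv_along (lB X) (deriv_along (lF V) f)"
proof
  fix x
  show "deriv_along (lF V) (deriv_along (lB X) f) x = deriv_along (lB X) (deriv_along (lF V) f) x"
    using fun_cong[OF fun_cong[OF bracket_lift_mixed[OF assms]], of x f]
    by (simp add: bracket_apply zero_fun_def)
qed

end

section \<open>Inverting a matrix of smooth functions\<close>

context manifold
begin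

lemma smooth_det:
  assumes "\<And>i j. i < n \<Longrightarrow> j < n \<Longrightarrow> (\<lambda>x. a x i j) \<in> smooth_functions A"
  shows "(\<lambda>x. Determinant.det (Matrix.mat n n (\<lambda>(i, j). a x i j))) \<in> smooth_functions A"
proof -
  have "(\<lambda>x. Determinant.det (Matrix.mat n n (\<lambda>(i, j). a x i j))) =
    (\<lambda>x. \<Sum>\<pi>\<in>{\<pi>. \<pi> permutes {0..<n}}. signof \<pi> * (\<Prod>i\<in>{0..<n}. a x i (\<pi> i)))"
    by (auto simp: Determinant.det_def fun_eq_iff permutes_in_image intro!: sum.cong prod.cong)
  also have "\<dots> \<in> smooth_functions A"
    by (intro smooth_sum smooth_mult smooth_const smooth_prod assms)
      (auto simp: permutes_in_image)
  finally show ?thesis .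
qed

text \<open>Cramer's rule: the entries of the adjugate matrix and the determinant are polynomials
  in the entries, and the determinant is nonzero near \<open>p\<close>.\<close>

lemma ex_smooth_matrix_inverse_nat:
  fixes n :: nat
  assumes a: "\<And>i j. i < n \<Longrightarrow> j < n \<Longrightarrow> a i j \<in> smooth_functions A"
    and inj: "\<And>c. (\<And>i. i < n \<Longrightarrow> (\<Sum>j<n. a i j p * c j) = 0) \<Longrightarrow> (\<And>j. j < n \<Longrightarrow> c j = 0)"
  shows "\<exists>N G. open N \<and> p \<in> N \<and> (\<forall>i<n. \<forall>j<n. G i j \<in> smooth_functions A) \<and>
    (\<forall>q\<in>N. \<forall>i<n. \<forall>k<n. (\<Sum>j<n. a i j q * G j k q) = (if i = k then 1 else 0))"
proof -
  define M where "M x = Matrix.mat n n (\<lambda>(i, j). a i j x)" for x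
  have M: "M x \<in> carrier_mat n n" for x by (simp add: M_def)
  have "Determinant.det (M p) \<noteq> 0"
  proof
    assume "Determinant.det (M p) = 0"
    then obtain v where v: "v \<in> carrier_vec n" "v \<noteq> 0\<^sub>v n" "M p *\<^sub>v v = 0\<^sub>v n"
      using det_0_iff_vec_prod_zero[OF M] by blast
    have "(\<Sum>j<n. a i j p * vec_index v j) = 0" if "i < n" for i
    proof -
      have "vec_index (M p *\<^sub>v v) i = (\<Sum>j<n. a i j p * vec_index v j)"
        using that v(1) by (auto simp: M_def scalar_prod_def lessThan_atLeast0 intro!: sum.cong)
      then show ?thesis using v(3) that by simp
    qed
    then have "vec_index v j = 0" if "j < n" for j using inj that by blast
    then have "v = 0\<^sub>v n" using v(1) by (intro eq_vecI) auto
    then show False using v(2) by simp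
  qed
  moreover have "(\<lambda>x. Determinant.det (M x)) \<in> smooth_functions A"
    unfolding M_def by (rule smooth_det) (rule a)
  ultimately obtain d N where d: "d \<in> smooth_functions A" "open N" "p \<in> N"
    "\<forall>x\<in>N. Determinant.det (M x) \<noteq> 0 \<and> d x = inverse (Determinant.det (M x))"
    using ex_local_inverse[of "\<lambda>x. Determinant.det (M x)" p] by blast
  define G where "G i j x = d x * index_mat (adj_mat (M x)) (i, j)" for i j x
  have "G i j \<in> smooth_functions A" if ij: "i < n" "j < n" for i j
  proof -
    have "(\<lambda>x. Determinant.det (Matrix.mat (n - 1) (n - 1)
        (\<lambda>(i', j'). a (if i' < j then i' else Suc i') (if j' < i then j' else Suc j') x))) \<in> smooth_functions A"
      by (rule smooth_det) (auto intro!: a)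
    moreover have "mat_delete (M x) j i = Matrix.mat (n - 1) (n - 1)
        (\<lambda>(i', j'). a (if i' < j then i' else Suc i') (if j' < i then j' else Suc j') x)" for x
      by (rule eq_matI) (auto simp: mat_delete_def M_def)
    ultimately have "(\<lambda>x. Determinant.det (mat_delete (M x) j i)) \<in> smooth_functions A" by simp
    moreover have "G i j = (\<lambda>x. d x * ((-1) ^ (j + i) * Determinant.det (mat_delete (M x) j i)))"
      using ij M by (auto simp: G_def adj_mat_def cofactor_def fun_eq_iff M_def)
    ultimately show ?thesis by (simp only: smooth_mult smooth_const d(1))
  qed
  moreover have "(\<Sum>j<n. a i j q * G j k q) = (if i = k then 1 else 0)"
    if q: "q \<in> N" and ik: "i < n" "k < n" for q i k
  proof -
    have c: "adj_mat (M q) \<in> carrier_mat n n" using adj_mat(1)[OF M] .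
    have "(\<Sum>j<n. a i j q * index_mat (adj_mat (M q)) (j, k)) = index_mat (M q * adj_mat (M q)) (i, k)"
      using ik c by (auto simp: M_def scalar_prod_def lessThan_atLeast0 intro!: sum.cong)
    also have "\<dots> = Determinant.det (M q) * (if i = k then 1 else 0)"
      using ik by (simp add: adj_mat(2)[OF M])
    finally have "(\<Sum>j<n. a i j q * index_mat (adj_mat (M q)) (j, k)) =
      Determinant.det (M q) * (if i = k then 1 else 0)" .
    moreover have "(\<Sum>j<n. a i j q * G j k q) = d q * (\<Sum>j<n. a i j q * index_mat (adj_mat (M q)) (j, k))"
      by (simp add: G_def sum_distrib_left mult_ac)
    ultimately show ?thesis using d(4) q by auto
  qed
  ultimately show ?thesis using d(2,3) by blast
qed

lemma ex_smooth_matrix_inverse: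
  assumes I: "finite I" and a: "\<And>i j. i \<in> I \<Longrightarrow> j \<in> I \<Longrightarrow> a i j \<in> smooth_functions A"
    and inj: "\<And>c. (\<And>i. i \<in> I \<Longrightarrow> (\<Sum>j\<in>I. a i j p * c j) = 0) \<Longrightarrow> (\<And>j. j \<in> I \<Longrightarrow> c j = 0)"
  shows "\<exists>N G. open N \<and> p \<in> N \<and> (\<forall>i\<in>I. \<forall>j\<in>I. G i j \<in> smooth_functions A) \<and>
    (\<forall>q\<in>N. \<forall>i\<in>I. \<forall>k\<in>I. (\<Sum>j\<in>I. a i j q * G j k q) = (if i = k then 1 else 0))"
proof -
  let ?n = "card I"
  obtain f where f: "bij_betw f {..<?n} I"
    using ex_bij_betw_nat_finite[OF I] by (auto simp: lessThan_atLeast0)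
  define g where "g = inv_into {..<?n} f"
  have g: "bij_betw g I {..<?n}" unfolding g_def by (rule bij_betw_inv_into[OF f])
  have fI: "f i \<in> I" if "i < ?n" for i using f that by (auto simp: bij_betw_def)
  have gI: "g i < ?n" if "i \<in> I" for i using g that by (auto simp: bij_betw_def)
  have gf: "g (f i) = i" if "i < ?n" for i unfolding g_def using bij_betw_inv_into_left[OF f] that by simp
  have fg: "f (g i) = i" if "i \<in> I" for i unfolding g_def using bij_betw_inv_into_right[OF f] that by simp
  have reidx: "(\<Sum>j<?n. h (f j)) = (\<Sum>j\<in>I. h j)" for h :: "_ \<Rightarrow> real"
    by (rule sum.reindex_bij_betw[OF f])
  have "\<exists>N G. open N \<and> p \<in> N \<and> (\<forall>i<?n. \<forall>j<?n. G i j \<in> smooth_functions A) \<and>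
    (\<forall>q\<in>N. \<forall>i<?n. \<forall>k<?n. (\<Sum>j<?n. a (f i) (f j) q * G j k q) = (if i = k then 1 else 0))"
  proof (rule ex_smooth_matrix_inverse_nat)
    show "a (f i) (f j) \<in> smooth_functions A" if "i < ?n" "j < ?n" for i j using that by (intro a fI)
    fix c j assume c: "\<And>i. i < ?n \<Longrightarrow> (\<Sum>j<?n. a (f i) (f j) p * c j) = 0" and j: "j < ?n"
    have "(\<Sum>j\<in>I. a i j p * c (g j)) = 0" if "i \<in> I" for i
      using c[OF gI[OF that]] reidx[of "\<lambda>j. a i j p * c (g j)"] by (simp add: gf fg that)
    from inj[OF this, of "f j"] show "c j = 0" using fI[OF j] gf[OF j] by simp
  qed
  then obtain N G where G: "open N" "p \<in> N" "\<forall>i<?n. \<forall>j<?n. G i j \<in> smooth_functions A"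
    "\<forall>q\<in>N. \<forall>i<?n. \<forall>k<?n. (\<Sum>j<?n. a (f i) (f j) q * G j k q) = (if i = k then 1 else 0)"
    by (elim exE conjE) (rule that)
  have "(\<Sum>j\<in>I. a i j q * G (g j) (g k) q) = (if i = k then 1 else 0)"
    if "q \<in> N" "i \<in> I" "k \<in> I" for q i k
  proof -
    have "(\<Sum>j\<in>I. a i j q * G (g j) (g k) q) = (\<Sum>j<?n. a (f (g i)) (f j) q * G j (g k) q)"
      using reidx[of "\<lambda>j. a i j q * G (g j) (g k) q"] by (simp add: gf fg that)
    also have "\<dots> = (if g i = g k then 1 else 0)"
      using G(4) that gI by blast
    also have "\<dots> = (if i = k then 1 else 0)" using fg that by metis
    finally show ?thesis .
  qed
  then show ?thesis
    using G(1-3) gI by (intro exI[of _ N] exI[of _ "\<lambda>i j. G (g i) (g j)"]) auto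
qed

end

section \<open>The metric of an almost product manifold\<close>

lemma scaleR_fun_apply: "(a *\<^sub>R f) x = a *\<^sub>R f x"
  by (simp add: scaleR_fun_def)

text \<open>Only the values on the tangent space matter; a covector is arbitrary
  elsewhere.\<close>

definition covector :: "('m, 'e::real_normed_vector) almost_product \<Rightarrow> 'm \<Rightarrow> ('m tvec \<Rightarrow> real) \<Rightarrow> bool" where
  "covector M p \<alpha> \<longleftrightarrow> (\<forall>u\<in>tangent M p. \<forall>v\<in>tangent M p. \<forall>a c.
     \<alpha> (a *\<^sub>R u + c *\<^sub>R v) = a * \<alpha> u + c * \<alpha> v)"

text \<open>The vector \<open>u\<close> is a metric dual of the covector \<open>\<alpha>\<close>; it is unique only up to the radical.\<close>

definition metric_dual ::
    "('m, 'e::real_normed_vector) almost_product \<Rightarrow> 'm \<Rightarrow> 'm tvec \<Rightarrow> ('m tvec \<Rightarrow> real) \<Rightarrow> bool" where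
  "metric_dual M p u \<alpha> \<longleftrightarrow> u \<in> tangent M p \<and> (\<forall>w\<in>tangent M p. metric M p u w = \<alpha> w)"

locale ap_manifold =
  fixes M :: "('m::{t2_space, second_countable_topology}, 'e::{real_inner, heine_borel}) almost_product"
  assumes apm: "almost_product_manifold M"

sublocale ap_manifold \<subseteq> manifold "atlas M"
  using apm by unfold_locales (simp add: almost_product_manifold_def)

context ap_manifold
begin

lemma metric_lincomb_left:
  "u \<in> tangent M p \<Longrightarrow> v \<in> tangent M p \<Longrightarrow> w \<in> tangent M p \<Longrightarrow>
    metric M p (a *\<^sub>R u + c *\<^sub>R v) w = a * metric M p u w + c * metric M p v w"
  and metric_sym: "v \<in> tangent M p \<Longrightarrow> w \<in> tangent M p \<Longrightarrow> metric M p v w = metric M p w v"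
  and g_of_smooth: "X \<in> vfields M \<Longrightarrow> Y \<in> vfields M \<Longrightarrow> g_of M X Y \<in> smooth M"
  and endo_tangent: "v \<in> tangent M p \<Longrightarrow> endo M p v \<in> tangent M p"
  and endo_endo: "v \<in> tangent M p \<Longrightarrow> endo M p (endo M p v) = v"
  and endo_lincomb: "v \<in> tangent M p \<Longrightarrow> w \<in> tangent M p \<Longrightarrow>
    endo M p (a *\<^sub>R v + c *\<^sub>R w) = a *\<^sub>R endo M p v + c *\<^sub>R endo M p w"
  and J_of_vector_field: "X \<in> vfields M \<Longrightarrow> J_of M X \<in> vfields M"
  and metric_endo: "v \<in> tangent M p \<Longrightarrow> w \<in> tangent M p \<Longrightarrow>
    metric M p (endo M p v) (endo M p w) = metric M p v w"
proof -
  note c1 = apm[unfolded almost_product_manifold_def, THEN conjunct2]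
  note c2 = c1[THEN conjunct2, THEN conjunct2]
  note c3 = c2[THEN conjunct2, THEN conjunct2]
  show "u \<in> tangent M p \<Longrightarrow> v \<in> tangent M p \<Longrightarrow> w \<in> tangent M p \<Longrightarrow>
    metric M p (a *\<^sub>R u + c *\<^sub>R v) w = a * metric M p u w + c * metric M p v w"
    by (rule c1[THEN conjunct1, rule_format])
  show "v \<in> tangent M p \<Longrightarrow> w \<in> tangent M p \<Longrightarrow> metric M p v w = metric M p w v"
    by (rule c1[THEN conjunct2, THEN conjunct1, rule_format])
  show "X \<in> vfields M \<Longrightarrow> Y \<in> vfields M \<Longrightarrow> g_of M X Y \<in> smooth M"
    by (rule c2[THEN conjunct1, rule_format])
  show "v \<in> tangent M p \<Longrightarrow> endo M p v \<in> tangent M p"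
    "v \<in> tangent M p \<Longrightarrow> endo M p (endo M p v) = v"
    using c2[THEN conjunct2, THEN conjunct1] by blast+
  show "v \<in> tangent M p \<Longrightarrow> w \<in> tangent M p \<Longrightarrow>
    endo M p (a *\<^sub>R v + c *\<^sub>R w) = a *\<^sub>R endo M p v + c *\<^sub>R endo M p w"
    by (rule c3[THEN conjunct1, rule_format])
  show "X \<in> vfields M \<Longrightarrow> J_of M X \<in> vfields M"
    by (rule c3[THEN conjunct2, THEN conjunct1, rule_format])
  show "v \<in> tangent M p \<Longrightarrow> w \<in> tangent M p \<Longrightarrow>
    metric M p (endo M p v) (endo M p w) = metric M p v w"
    by (rule c3[THEN conjunct2, THEN conjunct2, rule_format])
qed

lemma metric_lincomb_right:
  "u \<in> tangent M p \<Longrightarrow> v \<in> tangent M p \<Longrightarrow> w \<in> tangent M p \<Longrightarrow>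
    metric M p w (a *\<^sub>R u + c *\<^sub>R v) = a * metric M p w u + c * metric M p w v"
  by (simp add: metric_sym[of w] add_tangent scaleR_tangent metric_lincomb_left)

lemma metric_endo_left: "v \<in> tangent M p \<Longrightarrow> w \<in> tangent M p \<Longrightarrow>
    metric M p (endo M p v) w = metric M p v (endo M p w)"
  using metric_endo[of "endo M p v" p w] by (simp add: endo_tangent endo_endo)

lemma covector_lincomb:
  "covector M p \<alpha> \<Longrightarrow> u \<in> tangent M p \<Longrightarrow> v \<in> tangent M p \<Longrightarrow> \<alpha> (a *\<^sub>R u + c *\<^sub>R v) = a * \<alpha> u + c * \<alpha> v"
  by (simp add: covector_def)

lemma covector_zero: "covector M p \<alpha> \<Longrightarrow> \<alpha> 0 = 0"
  using covector_lincomb[of p \<alpha> 0 0 0 0] by (simp add: zero_tangent)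

lemma covector_sum:
  assumes "covector M p \<alpha>" "\<And>i. i \<in> I \<Longrightarrow> v i \<in> tangent M p"
  shows "\<alpha> (\<Sum>i\<in>I. c i *\<^sub>R v i) = (\<Sum>i\<in>I. c i * \<alpha> (v i))"
  using assms(2)
proof (induction I rule: infinite_finite_induct)
  case (insert i I)
  then have "(\<Sum>i\<in>I. c i *\<^sub>R v i) \<in> tangent M p" by (intro sum_tangent scaleR_tangent) auto
  then show ?case
    unfolding sum.insert[OF insert(1,2)]
    using insert covector_lincomb[OF assms(1), of "v i" "\<Sum>i\<in>I. c i *\<^sub>R v i" "c i" 1]
    by (simp only: scaleR_one mult_1 insertI1 insert_iff simp_thms)
qed (simp_all add: covector_zero[OF assms(1)])

lemma covector_metric: "u \<in> tangent M p \<Longrightarrow> covector M p (metric M p u)"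
  "u \<in> tangent M p \<Longrightarrow> covector M p (\<lambda>v. metric M p v u)"
  by (simp_all add: covector_def metric_lincomb_right metric_lincomb_left)

lemma metric_dual_metric: "u \<in> tangent M p \<Longrightarrow> metric_dual M p u (metric M p u)"
  by (simp add: metric_dual_def)

lemma metric_dual_lincomb:
  "metric_dual M p u \<alpha> \<Longrightarrow> metric_dual M p v \<beta> \<Longrightarrow>
    metric_dual M p (a *\<^sub>R u + c *\<^sub>R v) (\<lambda>w. a * \<alpha> w + c * \<beta> w)"
  by (simp add: metric_dual_def metric_lincomb_left add_tangent scaleR_tangent)

text \<open>Different choices of metric duals differ by elements of the radical, which the metric does not see.\<close>

lemma cometric_eq:
  assumes "metric_dual M p u \<alpha>" "metric_dual M p v \<beta>"
  shows "cometric M p \<alpha> \<beta> = metric M p u v"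
proof -
  have sharp: "metric_dual M p (sharp M p \<alpha>) \<alpha>" if "metric_dual M p u \<alpha>" for u \<alpha>
  proof -
    have "\<exists>v. v \<in> tangent M p \<and> (\<forall>w\<in>tangent M p. flat M p v w = \<alpha> w)"
      using that by (auto simp: metric_dual_def flat_def)
    then have "sharp M p \<alpha> \<in> tangent M p \<and> (\<forall>w\<in>tangent M p. flat M p (sharp M p \<alpha>) w = \<alpha> w)"
      unfolding sharp_def by (rule someI_ex)
    then show ?thesis by (auto simp: metric_dual_def flat_def)
  qed
  note s = sharp[OF assms(1)] sharp[OF assms(2)]
  have "cometric M p \<alpha> \<beta> = metric M p u (sharp M p \<beta>)"
    using s assms by (simp add: cometric_def metric_dual_def)
  also have "\<dots> = metric M p (sharp M p \<beta>) u" using s assms by (simp add: metric_dual_def metric_sym)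
  also have "\<dots> = metric M p v u" using s assms by (simp add: metric_dual_def)
  also have "\<dots> = metric M p u v" using assms by (simp add: metric_dual_def metric_sym)
  finally show ?thesis .
qed

lemma cometric_dual: "metric_dual M p u \<alpha> \<Longrightarrow> metric_dual M p v \<beta> \<Longrightarrow> cometric M p \<alpha> \<beta> = \<beta> u"
  using cometric_eq[of p u \<alpha> v \<beta>] metric_sym[of u p v] by (simp add: metric_dual_def)

end

locale nondegenerate_ap_manifold = ap_manifold M
  for M :: "('m::{t2_space, second_countable_topology}, 'e::{real_inner, heine_borel}) almost_product" +
  assumes nondegenerate: "nondegenerate M"
begin

lemma metric_nondegenerate:
  "v \<in> tangent M p \<Longrightarrow> (\<And>w. w \<in> tangent M p \<Longrightarrow> metric M p v w = 0) \<Longrightarrow> v = 0"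
  using nondegenerate by (simp add: nondegenerate_def)

text \<open>The Gram matrix of a local frame is invertible, and its inverse, by Cramer's rule, is smooth.\<close>

lemma ex_local_sharp:
  "\<exists>N G E. open N \<and> p \<in> N \<and> (\<forall>e. E e \<in> vfields M) \<and> (\<forall>e\<in>onb. \<forall>e'\<in>onb. G e e' \<in> smooth M) \<and>
    (\<forall>q\<in>N. \<forall>\<alpha>. covector M q \<alpha> \<longrightarrow> metric_dual M q
      (\<Sum>e\<in>onb. (\<Sum>e'\<in>onb. G e e' q * \<alpha> (E e' q)) *\<^sub>R E (e::'e) q) \<alpha>)"
proof -
  obtain N x E where N: "open N" "p \<in> N" and xs: "\<forall>e. x e \<in> smooth M" and E': "\<forall>e. E e \<in> vfields M"
    and frame: "\<forall>q\<in>N. \<forall>v\<in>tangent M q. v = (\<Sum>e\<in>onb. v (x e) *\<^sub>R E (e::'e) q)"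
    and coord: "\<forall>q\<in>N. \<forall>e\<in>onb. \<forall>e'\<in>onb. E e q (x e') = (if e = e' then 1 else 0)"
    using ex_frame[of p] by (elim exE conjE) (rule that)
  have E: "E e \<in> vfields M" and Et: "E e q \<in> tangent M q" for e q
    using E' vector_field_tangent by auto
  have "\<exists>N' G. open N' \<and> p \<in> N' \<and> (\<forall>e\<in>onb. \<forall>e'\<in>onb. G e e' \<in> smooth M) \<and>
    (\<forall>q\<in>N'. \<forall>i\<in>onb. \<forall>k\<in>onb. (\<Sum>j\<in>onb. g_of M (E i) (E j) q * G j k q) = (if i = k then 1 else 0))"
  proof (rule ex_smooth_matrix_inverse[OF finite_onb])
    show "g_of M (E i) (E j) \<in> smooth M" for i j by (intro g_of_smooth E)
    fix c :: "'e \<Rightarrow> real" and j :: 'e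
    assume c: "\<And>i. i \<in> onb \<Longrightarrow> (\<Sum>j\<in>onb. g_of M (E i) (E j) p * c j) = 0" and j: "j \<in> onb"
    let ?v = "\<Sum>j\<in>onb. c j *\<^sub>R E j p"
    have v: "?v \<in> tangent M p" by (intro sum_tangent scaleR_tangent Et)
    have vE: "metric M p ?v (E i p) = 0" if "i \<in> onb" for i
      using c[OF that] covector_sum[OF covector_metric(2)[OF Et[of i p]], of onb "\<lambda>j. E j p" c]
      by (simp add: Et g_of_def metric_sym[of "E i p"] mult.commute)
    have "?v = 0"
    proof (rule metric_nondegenerate[OF v])
      fix w assume w: "w \<in> tangent M p"
      have "metric M p ?v w = metric M p ?v (\<Sum>e\<in>onb. w (x e) *\<^sub>R E e p)"
        using frame N(2) w by metis
      also have "\<dots> = 0"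
        by (simp add: covector_sum[OF covector_metric(1)[OF v]] Et vE)
      finally show "metric M p ?v w = 0" .
    qed
    then have "?v (x j) = 0" by (simp add: zero_fun_def)
    moreover have "?v (x j) = (\<Sum>i\<in>onb. c i * E i p (x j))"
      by (induction rule: finite_induct[OF finite_onb]) (auto simp: zero_fun_def plus_fun_def scaleR_fun_def)
    moreover have "\<dots> = (\<Sum>i\<in>onb. if i = j then c i else 0)"
      using coord N(2) j by (intro sum.cong) auto
    ultimately show "c j = 0" using j by simp
  qed
  then obtain N' G where G: "open N'" "p \<in> N'" "\<forall>e\<in>onb. \<forall>e'\<in>onb. G e e' \<in> smooth M"
    and inv: "\<forall>q\<in>N'. \<forall>i\<in>onb. \<forall>k\<in>onb. (\<Sum>j\<in>onb. g_of M (E i) (E j) q * G j k q) = (if i = k then 1 else 0)"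
    by (elim exE conjE) (rule that)
  have "metric_dual M q (\<Sum>e\<in>onb. (\<Sum>e'\<in>onb. G e e' q * \<alpha> (E e' q)) *\<^sub>R E e q) \<alpha>"
    if q: "q \<in> N \<inter> N'" and \<alpha>: "covector M q \<alpha>" for q \<alpha>
    unfolding metric_dual_def
  proof
    let ?u = "\<Sum>e\<in>onb. (\<Sum>e'\<in>onb. G e e' q * \<alpha> (E e' q)) *\<^sub>R E e q"
    show u: "?u \<in> tangent M q" by (intro sum_tangent scaleR_tangent Et)
    have uE: "metric M q ?u (E i q) = \<alpha> (E i q)" if i: "i \<in> onb" for i
    proof -
      have "metric M q ?u (E i q) = (\<Sum>e\<in>onb. (\<Sum>e'\<in>onb. G e e' q * \<alpha> (E e' q)) * g_of M (E i) (E e) q)"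
        by (subst covector_sum[OF covector_metric(2)[OF Et]]) (auto simp: Et g_of_def metric_sym[of "E i q"])
      also have "\<dots> = (\<Sum>e'\<in>onb. (\<Sum>e\<in>onb. g_of M (E i) (E e) q * G e e' q) * \<alpha> (E e' q))"
        by (subst sum_distrib_right, subst sum.swap) (simp add: sum_distrib_left sum_distrib_right mult_ac)
      also have "\<dots> = (\<Sum>e'\<in>onb. if e' = i then \<alpha> (E e' q) else 0)"
        using inv q i by (intro sum.cong) auto
      finally show ?thesis using i by simp
    qed
    show "\<forall>w\<in>tangent M q. metric M q ?u w = \<alpha> w"
    proof
      fix w assume w: "w \<in> tangent M q"
      then have *: "w = (\<Sum>e\<in>onb. w (x e) *\<^sub>R E e q)" using frame q by blast
      have "metric M q ?u (\<Sum>e\<in>onb. w (x e) *\<^sub>R E e q) = (\<Sum>e\<in>onb. w (x e) * \<alpha> (E e q))"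
        by (simp add: covector_sum[OF covector_metric(1)[OF u]] Et uE)
      also have "\<dots> = \<alpha> (\<Sum>e\<in>onb. w (x e) *\<^sub>R E e q)"
        by (simp add: covector_sum[OF \<alpha>] Et)
      finally show "metric M q ?u w = \<alpha> w" using * by simp
    qed
  qed
  then show ?thesis
    using N G E by (intro exI[of _ "N \<inter> N'"] exI[of _ G] exI[of _ E]) auto
qed

lemma ex_metric_dual:
  assumes "covector M p \<alpha>"
  shows "\<exists>u. metric_dual M p u \<alpha>"
  using ex_local_sharp[of p] assms by blast

text \<open>Smoothness of the inverse metric, in the form needed for families of covectors over another
  manifold that is mapped to \<open>M\<close> by \<open>h\<close>.\<close>

lemma cometric_smooth:
  fixes P :: "('k::t2_space, 'd::{real_inner, heine_borel}) atlas"
  assumes P: "manifold P" and h: "\<And>a. a \<in> smooth M \<Longrightarrow> (\<lambda>x. a (h x)) \<in> smooth_functions P" "continuous_on UNIV h"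
    and co: "\<And>x. covector M (h x) (\<alpha> x)" "\<And>x. covector M (h x) (\<beta> x)"
    and sm: "\<And>Z. Z \<in> vfields M \<Longrightarrow> (\<lambda>x. \<alpha> x (Z (h x))) \<in> smooth_functions P"
      "\<And>Z. Z \<in> vfields M \<Longrightarrow> (\<lambda>x. \<beta> x (Z (h x))) \<in> smooth_functions P"
  shows "(\<lambda>x. cometric M (h x) (\<alpha> x) (\<beta> x)) \<in> smooth_functions P"
proof -
  interpret P: manifold P by (rule P)
  show ?thesis
  proof (rule P.smooth_functions_localI)
    fix x0
    obtain N G E where N: "open N" "h x0 \<in> N" and E: "\<forall>e. E e \<in> vfields M"
      and G: "\<forall>e\<in>onb. \<forall>e'\<in>onb. G e e' \<in> smooth M"
      and dual: "\<forall>q\<in>N. \<forall>\<alpha>. covector M q \<alpha> \<longrightarrow> metric_dual M q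
      (\<Sum>e\<in>onb. (\<Sum>e'\<in>onb. G e e' q * \<alpha> (E e' q)) *\<^sub>R E (e::'e) q) \<alpha>"
      using ex_local_sharp[of "h x0"] by (elim exE conjE) (rule that)
    let ?f = "\<lambda>x. \<Sum>e\<in>onb. (\<Sum>e'\<in>onb. G e e' (h x) * \<alpha> x (E e' (h x))) * \<beta> x (E e (h x))"
    have "?f \<in> smooth_functions P"
      using E G by (intro P.smooth_sum P.smooth_mult h(1) sm) auto
    moreover have "cometric M (h x) (\<alpha> x) (\<beta> x) = ?f x" if x: "h x \<in> N" for x
    proof -
      have d: "metric_dual M (h x) (\<Sum>e\<in>onb. (\<Sum>e'\<in>onb. G e e' (h x) * \<alpha> x (E e' (h x))) *\<^sub>R E e (h x)) (\<alpha> x)"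
        using dual x co by blast
      obtain u where u: "metric_dual M (h x) u (\<beta> x)" using ex_metric_dual[OF co(2)] by blast
      show ?thesis
        unfolding cometric_dual[OF d u]
        by (rule covector_sum[OF co(2)]) (use E vector_field_tangent in auto)
    qed
    moreover have "open (h -` N)" using h(2) N(1) by (rule open_vimage[rotated])
    ultimately show "\<exists>N h'. open N \<and> x0 \<in> N \<and> h' \<in> smooth_functions P \<and>
        (\<forall>x\<in>N. cometric M (h x) (\<alpha> x) (\<beta> x) = h' x)"
      using N(2) by (intro exI[of _ "h -` N"] exI[of _ ?f]) auto
  qed
qed

end

section \<open>Contraction\<close>

lemma dim_range_lincomb:
  fixes w :: "'i \<Rightarrow> 'v::real_vector"
  assumes I: "finite I" and indep: "\<And>c. (\<Sum>i\<in>I. c i *\<^sub>R w i) = 0 \<Longrightarrow> \<forall>i\<in>I. c i = 0"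
  shows "dim (range (\<lambda>c. \<Sum>i\<in>I. c i *\<^sub>R w i)) = card I"
proof -
  have inj: "inj_on w I"
  proof (rule inj_onI, rule ccontr)
    fix i j assume ij: "i \<in> I" "j \<in> I" "w i = w j" "i \<noteq> j"
    have "(\<Sum>k\<in>I. (if k = i then 1 else if k = j then -1 else 0) *\<^sub>R w k) =
      (\<Sum>k\<in>I. if k = i then w k else 0) + (\<Sum>k\<in>I. if k = j then - w k else 0)"
      unfolding sum.distrib[symmetric] by (intro sum.cong) (use ij in auto)
    also have "\<dots> = 0" using I ij by (simp add: sum.delta)
    finally have "\<forall>k\<in>I. (if k = i then 1 else if k = j then -1 else 0) = (0::real)" by (rule indep)
    then show False using ij by auto
  qed
  have reidx: "(\<Sum>i\<in>I. c (w i) *\<^sub>R w i) = (\<Sum>v\<in>w ` I. c v *\<^sub>R v)" for c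
    by (simp add: sum.reindex[OF inj])
  have "independent (w ` I)"
    unfolding independent_explicit_finite_subsets
  proof (intro allI impI ballI)
    fix T u v assume T: "T \<subseteq> w ` I" "finite T" and s: "(\<Sum>v\<in>T. u v *\<^sub>R v) = 0" and v: "v \<in> T"
    have "(\<Sum>v\<in>w ` I. (if v \<in> T then u v else 0) *\<^sub>R v) = (\<Sum>v\<in>T. u v *\<^sub>R v)"
      using T I by (intro sum.mono_neutral_cong_right) auto
    then have "(\<Sum>i\<in>I. (if w i \<in> T then u (w i) else 0) *\<^sub>R w i) = 0"
      using s reidx[of "\<lambda>v. if v \<in> T then u v else 0"] by simp
    then have "\<forall>i\<in>I. (if w i \<in> T then u (w i) else 0) = 0" by (rule indep)
    moreover obtain i where "i \<in> I" "v = w i" using v T by auto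
    ultimately show "u v = 0" using v by auto
  qed
  moreover have "range (\<lambda>c. \<Sum>i\<in>I. c i *\<^sub>R w i) = span (w ` I)"
  proof
    show "range (\<lambda>c. \<Sum>i\<in>I. c i *\<^sub>R w i) \<subseteq> span (w ` I)"
      by (intro subsetI, elim rangeE) (simp add: span_sum span_scale span_base)
    have "span (w ` I) = range (\<lambda>c. \<Sum>v\<in>w ` I. c v *\<^sub>R v)"
      using I by (intro span_finite) auto
    also have "\<dots> \<subseteq> range (\<lambda>c. \<Sum>i\<in>I. c i *\<^sub>R w i)"
      by (auto simp: reidx[symmetric] intro: rangeI[of "\<lambda>c. \<Sum>i\<in>I. c i *\<^sub>R w i" "\<lambda>i. _ (w i)"])
    finally show "span (w ` I) \<subseteq> range (\<lambda>c. \<Sum>i\<in>I. c i *\<^sub>R w i)" .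
  qed
  ultimately show ?thesis
    using card_image[OF inj] by (simp add: dim_span dim_eq_card_independent)
qed

context manifold
begin

text \<open>Two continuous functions that agree on a dense set are equal, so the smooth extension of the
  contraction is unique.\<close>

lemma contraction_eqI:
  assumes M: "atlas M = A" and dense: "closure (regular_points M) = UNIV"
    and f: "f \<in> smooth_functions A" "\<And>p. f p = cometric M p (\<omega> p) (\<tau> p)"
  shows "contraction M \<omega> \<tau> = f"
  unfolding contraction_def M
proof (rule the_equality)
  show "f \<in> smooth_functions A \<and> (\<forall>p\<in>regular_points M. f p = cometric M p (\<omega> p) (\<tau> p))"
    using f by blast
  fix h assume h: "h \<in> smooth_functions A \<and> (\<forall>p\<in>regular_points M. h p = cometric M p (\<omega> p) (\<tau> p))"
  have "closed {p. h p = f p}"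
    using h f(1) smooth_functions_continuous by (intro closed_Collect_eq) auto
  moreover have "regular_points M \<subseteq> {p. h p = f p}" using h f by auto
  ultimately have "closure (regular_points M) \<subseteq> {p. h p = f p}" by (rule closure_minimal[rotated])
  then show "h = f" using dense by auto
qed

text \<open>For \<open>L\<close> the map \<open>flat\<close> of a metric, this computes the rank: the tangent space has the
  dimension of the model space.\<close>

lemma dim_image_tangent:
  assumes lin: "\<And>u v a c. u \<in> tangent_space A p \<Longrightarrow> v \<in> tangent_space A p \<Longrightarrow> L (a *\<^sub>R u + c *\<^sub>R v) = a *\<^sub>R L u + c *\<^sub>R L v"
    and inj: "\<And>v. v \<in> tangent_space A p \<Longrightarrow> L v = 0 \<Longrightarrow> v = 0"
  shows "dim (L ` tangent_space A p) = card (onb :: 'e set)"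
proof -
  obtain N x E where "p \<in> N" and E': "\<forall>e. E e \<in> vector_fields A"
    and frame: "\<forall>q\<in>N. \<forall>v\<in>tangent_space A q. v = (\<Sum>e\<in>onb. v (x e) *\<^sub>R E (e::'e) q)"
    and coord: "\<forall>q\<in>N. \<forall>e\<in>onb. \<forall>e'\<in>onb. E e q (x e') = (if e = e' then 1 else 0)"
    using ex_frame[of p] by (elim exE conjE) (rule that)
  have Et: "E e p \<in> tangent_space A p" for e using E' vector_field_tangent by auto
  have t: "(\<Sum>e\<in>onb. c e *\<^sub>R E e p) \<in> tangent_space A p" for c
    by (intro sum_tangent scaleR_tangent Et)
  have L0: "L 0 = 0" using lin[of 0 0 0 0] by (simp add: zero_tangent)
  have Lsum: "L (\<Sum>e\<in>J. c e *\<^sub>R E e p) = (\<Sum>e\<in>J. c e *\<^sub>R L (E e p))" if "finite J" for c J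
    using that
  proof induction
    case (insert e J)
    have "(\<Sum>e\<in>J. c e *\<^sub>R E e p) \<in> tangent_space A p" by (intro sum_tangent scaleR_tangent Et)
    then show ?case
      unfolding sum.insert[OF insert(1,2)]
      using insert lin[OF Et, of "\<Sum>e\<in>J. c e *\<^sub>R E e p" "c e" e 1]
      by (simp only: scaleR_one)
  next
    case empty
    show ?case unfolding sum.empty by (rule L0)
  qed
  have "L ` tangent_space A p = range (\<lambda>c. \<Sum>e\<in>onb. c e *\<^sub>R L (E e p))"
  proof (rule equalityI; rule subsetI)
    fix y assume "y \<in> L ` tangent_space A p"
    then obtain v where v: "v \<in> tangent_space A p" "y = L v" by auto
    then have "y = L (\<Sum>e\<in>onb. v (x e) *\<^sub>R E e p)" using frame \<open>p \<in> N\<close> by metis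
    then show "y \<in> range (\<lambda>c. \<Sum>e\<in>onb. c e *\<^sub>R L (E e p))" by (simp add: Lsum)
  next
    fix y assume "y \<in> range (\<lambda>c. \<Sum>e\<in>onb. c e *\<^sub>R L (E e p))"
    then obtain c where "y = L (\<Sum>e\<in>onb. c e *\<^sub>R E e p)" by (auto simp: Lsum)
    then show "y \<in> L ` tangent_space A p" using t by blast
  qed
  moreover have "dim (range (\<lambda>c. \<Sum>e\<in>onb. c e *\<^sub>R L (E e p))) = card (onb :: 'e set)"
  proof (rule dim_range_lincomb[OF finite_onb], rule ballI)
    fix c j assume c: "(\<Sum>e\<in>onb. c e *\<^sub>R L (E e p)) = 0" and j: "j \<in> (onb :: 'e set)"
    then have "(\<Sum>e\<in>onb. c e *\<^sub>R E e p) = 0" using inj[OF t] Lsum[OF finite_onb] by metis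
    then have "(\<Sum>e\<in>onb. c e *\<^sub>R E e p) (x j) = 0" by (simp add: zero_fun_def)
    moreover have "(\<Sum>e\<in>onb. c e *\<^sub>R E e p) (x j) = (\<Sum>i\<in>onb. c i * E i p (x j))"
      by (induction rule: finite_induct[OF finite_onb]) (auto simp: zero_fun_def plus_fun_def scaleR_fun_def)
    moreover have "\<dots> = (\<Sum>i\<in>onb. if i = j then c i else 0)"
      using coord \<open>p \<in> N\<close> j by (intro sum.cong) auto
    ultimately show "c j = 0" using j by simp
  qed
  ultimately show ?thesis by simp
qed

end

context nondegenerate_ap_manifold
begin

lemma metric_rank_eq: "metric_rank M p = card (onb :: 'e set)"
  unfolding metric_rank_def radical_annihilator_def
proof (rule dim_image_tangent)
  show "flat M p (a *\<^sub>R u + c *\<^sub>R v) = a *\<^sub>R flat M p u + c *\<^sub>R flat M p v"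
    if "u \<in> tangent M p" "v \<in> tangent M p" for u v a c
    using that by (intro ext) (simp add: flat_def scaleR_fun_apply metric_lincomb_left)
  show "v = 0" if v: "v \<in> tangent M p" and "flat M p v = 0" for v
  proof (rule metric_nondegenerate[OF v])
    show "metric M p v w = 0" if "w \<in> tangent M p" for w
      using fun_cong[OF \<open>flat M p v = 0\<close>, of w] that by (simp add: flat_def zero_fun_def)
  qed
qed

lemma regular_points_UNIV: "regular_points M = UNIV"
  by (auto simp: regular_points_def metric_rank_eq)

lemma contraction_eq_cometric:
  assumes co: "\<And>x. covector M x (\<omega> x)" "\<And>x. covector M x (\<tau> x)"
    and sm: "\<And>Z. Z \<in> vfields M \<Longrightarrow> (\<lambda>x. \<omega> x (Z x)) \<in> smooth M"
      "\<And>Z. Z \<in> vfields M \<Longrightarrow> (\<lambda>x. \<tau> x (Z x)) \<in> smooth M"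
  shows "contraction M \<omega> \<tau> p = cometric M p (\<omega> p) (\<tau> p)"
proof -
  have "(\<lambda>x. cometric M x (\<omega> x) (\<tau> x)) \<in> smooth M"
    using cometric_smooth[OF manifold_axioms _ continuous_on_id co sm] by simp
  then have "contraction M \<omega> \<tau> = (\<lambda>x. cometric M x (\<omega> x) (\<tau> x))"
    by (intro contraction_eqI) (simp_all add: regular_points_UNIV)
  then show ?thesis by simp
qed

end

section \<open>The Koszul form\<close>

context manifold
begin

lemma deriv_along_add: "X \<in> vector_fields A \<Longrightarrow> f \<in> smooth_functions A \<Longrightarrow> h \<in> smooth_functions A \<Longrightarrow>
    deriv_along X (\<lambda>p. f p + h p) p = deriv_along X f p + deriv_along X h p"
  and deriv_along_diff: "X \<in> vector_fields A \<Longrightarrow> f \<in> smooth_functions A \<Longrightarrow> h \<in> smooth_functions A \<Longrightarrow>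
    deriv_along X (\<lambda>p. f p - h p) p = deriv_along X f p - deriv_along X h p"
  and deriv_along_mult: "X \<in> vector_fields A \<Longrightarrow> f \<in> smooth_functions A \<Longrightarrow> h \<in> smooth_functions A \<Longrightarrow>
    deriv_along X (\<lambda>p. f p * h p) p = f p * deriv_along X h p + h p * deriv_along X f p"
  and deriv_along_const: "X \<in> vector_fields A \<Longrightarrow> deriv_along X (\<lambda>p. c) p = 0"
  by (simp_all add: deriv_along_def vector_field_tangent tangent_add[of _ p] tangent_diff[of _ p]
      tangent_mult[of _ p] tangent_const[of _ p])

lemma bracket_mult_right:
  assumes "X \<in> vector_fields A" "Y \<in> vector_fields A" "a \<in> smooth_functions A"
  shows "bracket X (\<lambda>p. a p *\<^sub>R Y p) p = a p *\<^sub>R bracket X Y p + X p a *\<^sub>R Y p"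
proof (rule tangent_eqI)
  show "bracket X (\<lambda>p. a p *\<^sub>R Y p) p \<in> tangent_space A p"
    using assms by (intro vector_field_tangent bracket_vector_field mult_vector_field)
  show "a p *\<^sub>R bracket X Y p + X p a *\<^sub>R Y p \<in> tangent_space A p"
    using assms by (intro add_tangent scaleR_tangent vector_field_tangent bracket_vector_field)
  fix f assume f: "f \<in> smooth_functions A"
  have "deriv_along (\<lambda>p. a p *\<^sub>R Y p) f = (\<lambda>p. a p * deriv_along Y f p)"
    by (simp add: deriv_along_def scaleR_fun_apply)
  then have "X p (deriv_along (\<lambda>p. a p *\<^sub>R Y p) f) = a p * X p (deriv_along Y f) + Y p f * X p a"
    using assms f tangent_mult[OF vector_field_tangent[OF assms(1)] assms(3) vector_field_smooth[OF assms(2) f], of p]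
    by (simp add: deriv_along_def)
  then show "bracket X (\<lambda>p. a p *\<^sub>R Y p) p f = (a p *\<^sub>R bracket X Y p + X p a *\<^sub>R Y p) f"
    by (simp add: bracket_def scaleR_fun_apply algebra_simps)
qed

lemma bracket_swap: "bracket Y X p = - bracket X Y p"
  by (simp add: bracket_def fun_eq_iff)

lemma bracket_add_right:
  assumes "X \<in> vector_fields A" "Y \<in> vector_fields A" "Z \<in> vector_fields A"
  shows "bracket X (\<lambda>p. Y p + Z p) p = bracket X Y p + bracket X Z p"
proof (rule tangent_eqI)
  show "bracket X (\<lambda>p. Y p + Z p) p \<in> tangent_space A p"
    using assms by (intro vector_field_tangent bracket_vector_field add_vector_field)
  show "bracket X Y p + bracket X Z p \<in> tangent_space A p"
    using assms by (intro add_tangent vector_field_tangent bracket_vector_field)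
  fix f assume f: "f \<in> smooth_functions A"
  have "deriv_along (\<lambda>p. Y p + Z p) f = (\<lambda>p. deriv_along Y f p + deriv_along Z f p)"
    by (simp add: deriv_along_def)
  then have "X p (deriv_along (\<lambda>p. Y p + Z p) f) = X p (deriv_along Y f) + X p (deriv_along Z f)"
    using tangent_add[OF vector_field_tangent[OF assms(1)] vector_field_smooth[OF assms(2) f]
        vector_field_smooth[OF assms(3) f]] by simp
  then show "bracket X (\<lambda>p. Y p + Z p) p f = (bracket X Y p + bracket X Z p) f"
    by (simp add: bracket_def algebra_simps)
qed

text \<open>A functional on vector fields that is linear over the smooth functions sees only the value of
  its argument at the point: near the point a field is a combination of the frame with smooth
  coefficients, and a cutoff makes that combination global.\<close>

lemma tensorial:
  assumes add: "\<And>Z Z'. Z \<in> vector_fields A \<Longrightarrow> Z' \<in> vector_fields A \<Longrightarrow> D (\<lambda>p. Z p + Z' p) = D Z + (D Z' :: real)"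
    and mult: "\<And>a Z. a \<in> smooth_functions A \<Longrightarrow> Z \<in> vector_fields A \<Longrightarrow> D (\<lambda>p. a p *\<^sub>R Z p) = a p * D Z"
    and Z: "Z \<in> vector_fields A" "Z' \<in> vector_fields A" "Z p = Z' p"
  shows "D Z = D Z'"
proof -
  obtain N x E where N: "open N" "p \<in> N" and xs: "\<forall>e. x e \<in> smooth_functions A"
    and E: "\<forall>e. E e \<in> vector_fields A"
    and frame: "\<forall>q\<in>N. \<forall>v\<in>tangent_space A q. v = (\<Sum>e\<in>onb. v (x e) *\<^sub>R E (e::'e) q)"
    using ex_frame[of p] by (elim exE conjE) (rule that)
  obtain \<theta> N' where \<theta>: "\<theta> \<in> smooth_functions A" "p \<in> N'" "\<forall>x\<in>N'. \<theta> x = 1" "\<forall>x. x \<notin> N \<longrightarrow> \<theta> x = 0"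
    using ex_bump[OF N] by (elim exE conjE) (rule that)
  have Dsum: "D (\<lambda>q. \<Sum>e\<in>J. c e q *\<^sub>R E e q) = (\<Sum>e\<in>J. c e p * D (E e))"
    if "finite J" "\<And>e. c e \<in> smooth_functions A" for c J
    using that(1)
  proof induction
    case empty
    show ?case using mult[OF smooth_const zero_vector_field, of 0] by (simp add: zero_fun_def)
  next
    case (insert e J)
    have "(\<lambda>q. \<Sum>e\<in>J. c e q *\<^sub>R E e q) \<in> vector_fields A"
      using that(2) E by (intro sum_vector_field mult_vector_field) auto
    note D1 = add[OF mult_vector_field[OF that(2)[of e] E[rule_format, of e]] this]
    show ?case
      unfolding sum.insert[OF insert(1,2)]
      by (simp only: D1 mult[OF that(2) E[rule_format]] insert.IH)
  qed
  have "D Z = (\<Sum>e\<in>onb. Z p (x e) * D (E e))" if Z: "Z \<in> vector_fields A" for Z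
  proof -
    have "D Z = D (\<lambda>q. \<theta> q *\<^sub>R Z q)" using mult[OF \<theta>(1) Z] \<theta>(2,3) by simp
    also have "(\<lambda>q. \<theta> q *\<^sub>R Z q) = (\<lambda>q. \<Sum>e\<in>onb. (\<theta> q * Z q (x e)) *\<^sub>R E e q)"
    proof
      fix q
      show "\<theta> q *\<^sub>R Z q = (\<Sum>e\<in>onb. (\<theta> q * Z q (x e)) *\<^sub>R E e q)"
      proof (cases "q \<in> N")
        case True
        then have "Z q = (\<Sum>e\<in>onb. Z q (x e) *\<^sub>R E e q)" using frame vector_field_tangent[OF Z] by blast
        then have "\<theta> q *\<^sub>R Z q = \<theta> q *\<^sub>R (\<Sum>e\<in>onb. Z q (x e) *\<^sub>R E e q)" by (rule arg_cong)
        then show ?thesis by (simp only: scaleR_sum_right scaleR_scaleR)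
      qed (simp add: \<theta>(4))
    qed
    also have "D \<dots> = (\<Sum>e\<in>onb. (\<theta> p * Z p (x e)) * D (E e))"
      using xs by (intro Dsum finite_onb smooth_mult \<theta>(1) vector_field_smooth'[OF Z]) auto
    finally show ?thesis using \<theta>(2,3) by simp
  qed
  from this[OF Z(1)] this[OF Z(2)] Z(3) show ?thesis by simp
qed

end

context ap_manifold
begin

lemma g_of_add_right: "X \<in> vfields M \<Longrightarrow> Y \<in> vfields M \<Longrightarrow> Z \<in> vfields M \<Longrightarrow>
    g_of M X (\<lambda>p. Y p + Z p) = (\<lambda>p. g_of M X Y p + g_of M X Z p)"
  and g_of_mult_right: "X \<in> vfields M \<Longrightarrow> Y \<in> vfields M \<Longrightarrow>
    g_of M X (\<lambda>p. a p *\<^sub>R Y p) = (\<lambda>p. a p * g_of M X Y p)"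
  and g_of_sym: "X \<in> vfields M \<Longrightarrow> Y \<in> vfields M \<Longrightarrow> g_of M X Y = g_of M Y X"
  using metric_lincomb_right[of "Y p" p "Z p" "X p" 1 1 for p]
    metric_lincomb_right[of "Y p" p "Y p" "X p" "a p" 0 for p]
  by (simp_all add: g_of_def fun_eq_iff vector_field_tangent metric_sym)

lemma J_of_add: "Y \<in> vfields M \<Longrightarrow> Z \<in> vfields M \<Longrightarrow>
    J_of M (\<lambda>p. Y p + Z p) = (\<lambda>p. J_of M Y p + J_of M Z p)"
  and J_of_mult: "Y \<in> vfields M \<Longrightarrow> J_of M (\<lambda>p. a p *\<^sub>R Y p) = (\<lambda>p. a p *\<^sub>R J_of M Y p)"
  and J_of_J_of: "Y \<in> vfields M \<Longrightarrow> J_of M (J_of M Y) = Y"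
  using endo_lincomb[of "Y p" p "Z p" 1 1 for p] endo_lincomb[of "Y p" p "Y p" "a p" 0 for p]
  by (simp_all add: J_of_def fun_eq_iff vector_field_tangent endo_endo)

lemma g_of_J_of: "X \<in> vfields M \<Longrightarrow> Y \<in> vfields M \<Longrightarrow> g_of M (J_of M X) (J_of M Y) = g_of M X Y"
  and g_of_J_of_left: "X \<in> vfields M \<Longrightarrow> Y \<in> vfields M \<Longrightarrow> g_of M (J_of M X) Y = g_of M X (J_of M Y)"
  by (simp_all add: g_of_def J_of_def fun_eq_iff vector_field_tangent metric_endo metric_endo_left)

lemma koszul_smooth:
  assumes "X \<in> vfields M" "Y \<in> vfields M" "Z \<in> vfields M"
  shows "koszul M X Y Z \<in> smooth M"
  unfolding koszul_def using assms
  by (intro smooth_mult smooth_add smooth_diff smooth_const vector_field_smooth g_of_smooth bracket_vector_field)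

lemma ap_koszul_smooth:
  assumes "X \<in> vfields M" "Y \<in> vfields M" "Z \<in> vfields M"
  shows "ap_koszul M X Y Z \<in> smooth M"
  unfolding ap_koszul_def using assms
  by (intro smooth_mult smooth_add smooth_const koszul_smooth J_of_vector_field)

lemma koszul_compat:
  assumes "X \<in> vfields M" "Y \<in> vfields M" "Z \<in> vfields M"
  shows "deriv_along X (g_of M Y Z) p = koszul M X Y Z p + koszul M X Z Y p"
proof -
  have b: "bracket Z Y = (\<lambda>p. (-1) *\<^sub>R bracket Y Z p)" "bracket Y X = (\<lambda>p. (-1) *\<^sub>R bracket X Y p)"
    "bracket X Z = (\<lambda>p. (-1) *\<^sub>R bracket Z X p)"
    by (simp_all add: fun_eq_iff bracket_def scaleR_fun_apply)
  note v = assms bracket_vector_field[OF assms(1,2)] bracket_vector_field[OF assms(2,3)]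
    bracket_vector_field[OF assms(3,1)]
  have eq: "koszul M X Z Y p = 1/2 * (deriv_along X (g_of M Y Z) p + deriv_along Z (g_of M X Y) p
    - deriv_along Y (g_of M Z X) p + g_of M X (bracket Y Z) p - g_of M Z (bracket X Y) p
    - g_of M Y (bracket Z X) p)"
    unfolding koszul_def b using v
    by (simp add: g_of_mult_right[where a = "\<lambda>_. -1", simplified] g_of_sym[of Z Y] g_of_sym[of Y X]
        g_of_sym[of X Z])
  show ?thesis unfolding eq by (simp add: koszul_def field_simps)
qed

lemma koszul_torsion:
  assumes "X \<in> vfields M" "Y \<in> vfields M" "Z \<in> vfields M"
  shows "g_of M (bracket X Y) Z p = koszul M X Y Z p - koszul M Y X Z p"
proof -
  have b: "bracket Z Y = (\<lambda>p. (-1) *\<^sub>R bracket Y Z p)" "bracket Y X = (\<lambda>p. (-1) *\<^sub>R bracket X Y p)"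
    "bracket X Z = (\<lambda>p. (-1) *\<^sub>R bracket Z X p)"
    by (simp_all add: fun_eq_iff bracket_def scaleR_fun_apply)
  note v = assms bracket_vector_field[OF assms(1,2)] bracket_vector_field[OF assms(2,3)]
    bracket_vector_field[OF assms(3,1)]
  have eq: "koszul M Y X Z p = 1/2 * (deriv_along Y (g_of M Z X) p + deriv_along X (g_of M Y Z) p
    - deriv_along Z (g_of M X Y) p + g_of M Y (bracket Z X) p - g_of M X (bracket Y Z) p
    - g_of M Z (bracket X Y) p)"
    unfolding koszul_def b using v
    by (simp add: g_of_mult_right[where a = "\<lambda>_. -1", simplified] g_of_sym[of Z Y] g_of_sym[of Y X]
        g_of_sym[of X Z])
  show ?thesis unfolding eq using v by (simp add: koszul_def g_of_sym[of "bracket X Y" Z] field_simps)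
qed

lemma koszul_add_third:
  assumes "X \<in> vfields M" "Y \<in> vfields M" "Z \<in> vfields M" "Z' \<in> vfields M"
  shows "koszul M X Y (\<lambda>p. Z p + Z' p) p = koszul M X Y Z p + koszul M X Y Z' p"
proof -
  note v = assms add_vector_field[OF assms(3,4)]
  have b: "bracket (\<lambda>p. Z p + Z' p) X = (\<lambda>p. bracket Z X p + bracket Z' X p)"
    using bracket_add_right[OF assms(1,3,4)]
    by (simp add: fun_eq_iff bracket_swap[of "\<lambda>p. Z p + Z' p" X] bracket_swap[of _ X])
  have b': "bracket Y (\<lambda>p. Z p + Z' p) = (\<lambda>p. bracket Y Z p + bracket Y Z' p)"
    using bracket_add_right[OF assms(2,3,4)] by auto
  show ?thesis
    unfolding koszul_def b b' using v
    by (simp add: g_of_add_right bracket_vector_field g_of_sym[of "\<lambda>p. Z p + Z' p"] deriv_along_add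
        g_of_smooth) (simp add: deriv_along_def g_of_sym[of Z] g_of_sym[of Z'] bracket_vector_field field_simps)
qed

text \<open>In \<open>2 * koszul M X Y (a Z)\<close> the derivatives of \<open>a\<close> enter
  once through the metric and once through the brackets, with opposite signs.\<close>

lemma koszul_mult_third:
  assumes "X \<in> vfields M" "Y \<in> vfields M" "Z \<in> vfields M" "a \<in> smooth M"
  shows "koszul M X Y (\<lambda>p. a p *\<^sub>R Z p) p = a p * koszul M X Y Z p"
proof -
  note v = assms mult_vector_field[OF assms(4,3)]
  have da: "(\<lambda>p. X p a) \<in> smooth M" "(\<lambda>p. Y p a) \<in> smooth M"
    using assms vector_field_smooth' by auto
  have b: "bracket (\<lambda>p. a p *\<^sub>R Z p) X = (\<lambda>p. a p *\<^sub>R bracket Z X p + (- X p a) *\<^sub>R Z p)"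
    using bracket_mult_right[OF assms(1,3,4)]
    by (simp add: fun_eq_iff bracket_swap[of "\<lambda>p. a p *\<^sub>R Z p" X] bracket_swap[of Z X] scaleR_fun_apply)
  have b': "bracket Y (\<lambda>p. a p *\<^sub>R Z p) = (\<lambda>p. a p *\<^sub>R bracket Y Z p + Y p a *\<^sub>R Z p)"
    using bracket_mult_right[OF assms(2,3,4)] by auto
  have g: "g_of M X (\<lambda>p. a p *\<^sub>R bracket Y Z p + Y p a *\<^sub>R Z p) p = a p * g_of M X (bracket Y Z) p + Y p a * g_of M X Z p"
    "g_of M Y (\<lambda>p. a p *\<^sub>R bracket Z X p + (- X p a) *\<^sub>R Z p) p = a p * g_of M Y (bracket Z X) p - X p a * g_of M Y Z p"
    using metric_lincomb_right[of "bracket Y Z p" p "Z p" "X p" "a p" "Y p a"]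
      metric_lincomb_right[of "bracket Z X p" p "Z p" "Y p" "a p" "- X p a"] assms
    by (simp_all add: g_of_def vector_field_tangent bracket_vector_field)
  have "deriv_along (\<lambda>p. a p *\<^sub>R Z p) (g_of M X Y) p = a p * deriv_along Z (g_of M X Y) p"
    by (simp add: deriv_along_def scaleR_fun_apply)
  moreover have "deriv_along X (g_of M Y (\<lambda>p. a p *\<^sub>R Z p)) p = a p * deriv_along X (g_of M Y Z) p + g_of M Y Z p * X p a"
    "deriv_along Y (g_of M (\<lambda>p. a p *\<^sub>R Z p) X) p = a p * deriv_along Y (g_of M Z X) p + g_of M X Z p * Y p a"
    using assms v(5) by (simp_all add: g_of_sym[of "\<lambda>p. a p *\<^sub>R Z p" X] g_of_sym[of Z X] g_of_mult_right
      deriv_along_mult g_of_smooth) (simp_all add: deriv_along_def)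
  moreover have "g_of M (\<lambda>p. a p *\<^sub>R Z p) (bracket X Y) p = a p * g_of M Z (bracket X Y) p"
    using assms v(5) by (simp add: g_of_sym[of _ "bracket X Y"] bracket_vector_field g_of_mult_right)
  ultimately show ?thesis
    unfolding koszul_def b b' g by (simp add: algebra_simps)
qed

lemma ap_koszul_add_third:
  assumes "X \<in> vfields M" "Y \<in> vfields M" "Z \<in> vfields M" "Z' \<in> vfields M"
  shows "ap_koszul M X Y (\<lambda>p. Z p + Z' p) p = ap_koszul M X Y Z p + ap_koszul M X Y Z' p"
  using assms by (simp add: ap_koszul_def J_of_add koszul_add_third J_of_vector_field algebra_simps)

lemma ap_koszul_mult_third:
  assumes "X \<in> vfields M" "Y \<in> vfields M" "Z \<in> vfields M" "a \<in> smooth M"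
  shows "ap_koszul M X Y (\<lambda>p. a p *\<^sub>R Z p) p = a p * ap_koszul M X Y Z p"
  using assms by (simp add: ap_koszul_def J_of_mult koszul_mult_third J_of_vector_field algebra_simps)

text \<open>By tensoriality the field that \<open>nabla_flat\<close> chooses to extend a vector
  may be replaced by any other.\<close>

lemma nabla_flat_eq:
  assumes "X \<in> vfields M" "Y \<in> vfields M" "Z \<in> vfields M"
  shows "nabla_flat M X Y p (Z p) = ap_koszul M X Y Z p"
proof -
  let ?Z = "SOME Z'. Z' \<in> vfields M \<and> Z' p = Z p"
  have "?Z \<in> vfields M \<and> ?Z p = Z p" by (rule someI[of _ Z]) (use assms in simp)
  then have Z: "?Z \<in> vfields M" "?Z p = Z p" by simp_all
  have "ap_koszul M X Y ?Z p = ap_koszul M X Y Z p"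
  proof (rule tensorial[where D = "\<lambda>Z. ap_koszul M X Y Z p", OF _ _ Z(1) assms(3) Z(2)])
    show "ap_koszul M X Y (\<lambda>p. Z p + Z' p) p = ap_koszul M X Y Z p + ap_koszul M X Y Z' p"
      if "Z \<in> vfields M" "Z' \<in> vfields M" for Z Z'
      by (rule ap_koszul_add_third[OF assms(1,2) that])
    show "ap_koszul M X Y (\<lambda>p. a p *\<^sub>R Z p) p = a p * ap_koszul M X Y Z p"
      if "a \<in> smooth M" "Z \<in> vfields M" for a Z
      by (rule ap_koszul_mult_third[OF assms(1,2) that(2,1)])
  qed
  then show ?thesis by (simp add: nabla_flat_def)
qed

lemma nabla_flat_smooth:
  assumes "X \<in> vfields M" "Y \<in> vfields M" "Z \<in> vfields M"
  shows "(\<lambda>p. nabla_flat M X Y p (Z p)) \<in> smooth M"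
  using assms by (simp add: nabla_flat_eq ap_koszul_smooth)

lemma covector_nabla_flat:
  assumes "X \<in> vfields M" "Y \<in> vfields M"
  shows "covector M p (nabla_flat M X Y p)"
  unfolding covector_def
proof (intro ballI allI)
  fix u v a c assume "u \<in> tangent M p" "v \<in> tangent M p"
  then obtain U V where U: "U \<in> vfields M" "U p = u" and V: "V \<in> vfields M" "V p = v"
    using ex_vector_field by blast
  have aU: "(\<lambda>p. a *\<^sub>R U p) \<in> vfields M" "(\<lambda>p. c *\<^sub>R V p) \<in> vfields M"
    using mult_vector_field[OF smooth_const] U V by blast+
  have "nabla_flat M X Y p ((\<lambda>p. a *\<^sub>R U p + c *\<^sub>R V p) p) = a * ap_koszul M X Y U p + c * ap_koszul M X Y V p"
    using nabla_flat_eq[OF assms add_vector_field[OF aU], of p] ap_koszul_add_third[OF assms aU, of p]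
      ap_koszul_mult_third[OF assms U(1) smooth_const, of a p]
      ap_koszul_mult_third[OF assms V(1) smooth_const, of c p] by simp
  then show "nabla_flat M X Y p (a *\<^sub>R u + c *\<^sub>R v) = a * nabla_flat M X Y p u + c * nabla_flat M X Y p v"
    using nabla_flat_eq[OF assms U(1), of p] nabla_flat_eq[OF assms V(1), of p] U V by simp
qed

lemma endo_sum:
  assumes "\<And>i. i \<in> I \<Longrightarrow> v i \<in> tangent M p" "finite I"
  shows "endo M p (\<Sum>i\<in>I. c i *\<^sub>R v i) = (\<Sum>i\<in>I. c i *\<^sub>R endo M p (v i))"
  using assms(2,1)
proof induction
  case empty
  have "endo M p (0 *\<^sub>R 0 + 0 *\<^sub>R 0) = 0 *\<^sub>R endo M p 0 + 0 *\<^sub>R endo M p 0"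
    by (rule endo_lincomb) (rule zero_tangent)+
  then show ?case by (simp only: sum.empty scaleR_zero_left add_0)
next
  case (insert i I)
  have "(\<Sum>i\<in>I. c i *\<^sub>R v i) \<in> tangent M p" using insert by (intro sum_tangent scaleR_tangent) auto
  then show ?case
    unfolding sum.insert[OF insert(1,2)]
    using insert endo_lincomb[of "v i" p "\<Sum>i\<in>I. c i *\<^sub>R v i" "c i" 1]
    by (simp only: scaleR_one insertI1 insert_iff simp_thms)
qed

end

section \<open>The twisted product is an almost product manifold\<close>

locale twisted =
  B: nondegenerate_ap_manifold B + F: nondegenerate_ap_manifold F
  for B :: "('m::{t2_space, second_countable_topology}, 'e::{real_inner, heine_borel}) almost_product"
    and F :: "('n::{t2_space, second_countable_topology}, 'f::{real_inner, heine_borel}) almost_product" +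
  fixes b :: "'m \<times> 'n \<Rightarrow> real"
  assumes b_smooth': "b \<in> smooth (twisted_product B F b)"
    and db_zero': "\<And>x v. b x = 0 \<Longrightarrow> v \<in> tangent (twisted_product B F b) x \<Longrightarrow> v b = 0"

sublocale twisted \<subseteq> manifold_product B F
  by unfold_locales

context twisted
begin

abbreviation "TP \<equiv> twisted_product B F b"

lemma atlas_TP [simp]: "atlas TP = atlas_prod B F"
  by (simp add: twisted_product_def)

lemma b_smooth: "b \<in> SP"
  and db_zero: "b x = 0 \<Longrightarrow> v \<in> tangent_space (atlas_prod B F) x \<Longrightarrow> v b = 0"
  using b_smooth' db_zero' by simp_all

lemma metric_TP: "metric TP x v w = metric B (fst x) (proj_fst v) (proj_fst w) +
    (b x)\<^sup>2 * metric F (snd x) (proj_snd v) (proj_snd w)"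
  by (simp add: twisted_product_def)

lemma endo_TP: "endo TP x v = incl_fst B F x (endo B (fst x) (proj_fst v)) +
    incl_snd B F x (endo F (snd x) (proj_snd v))"
  by (simp add: twisted_product_def)

text \<open>Near a point the projections of an arbitrary field to the factors are combinations of
  frame fields of the factors, with smooth coefficients on the product. Through this the metric
  and \<open>J\<close> of the product are seen to be smooth on fields that are not lifts.\<close>

lemma ex_proj_frame:
  "\<exists>N y E z G. open N \<and> x0 \<in> N \<and> (\<forall>e. y e \<in> smooth B) \<and> (\<forall>e. E e \<in> vfields B) \<and>
    (\<forall>e. z e \<in> smooth F) \<and> (\<forall>e. G e \<in> vfields F) \<and>
    (\<forall>x\<in>N. \<forall>v\<in>tangent_space (atlas_prod B F) x.
      proj_fst v = (\<Sum>e\<in>onb. v (\<lambda>u. y e (fst u)) *\<^sub>R E (e::'e) (fst x)) \<and>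
      proj_snd v = (\<Sum>e\<in>onb. v (\<lambda>u. z e (snd u)) *\<^sub>R G (e::'f) (snd x)))"
proof -
  obtain N1 y E where y: "open N1" "fst x0 \<in> N1" "\<forall>e. y e \<in> smooth B" "\<forall>e. E e \<in> vfields B"
    "\<forall>q\<in>N1. \<forall>v\<in>tangent B q. v = (\<Sum>e\<in>onb. v (y e) *\<^sub>R E (e::'e) q)"
    using B.ex_frame[of "fst x0"] by (elim exE conjE) (rule that)
  obtain N2 z G where z: "open N2" "snd x0 \<in> N2" "\<forall>e. z e \<in> smooth F" "\<forall>e. G e \<in> vfields F"
    "\<forall>q\<in>N2. \<forall>v\<in>tangent F q. v = (\<Sum>e\<in>onb. v (z e) *\<^sub>R G (e::'f) q)"
    using F.ex_frame[of "snd x0"] by (elim exE conjE) (rule that)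
  show ?thesis
  proof (rule exI[of _ "N1 \<times> N2"], rule exI[of _ y], rule exI[of _ E], rule exI[of _ z], rule exI[of _ G],
      intro conjI ballI)
    show "open (N1 \<times> N2)" using y z by (simp add: open_Times)
    show "x0 \<in> N1 \<times> N2" using y z by (simp add: mem_Times_iff)
    fix x v assume x: "x \<in> N1 \<times> N2" and v: "v \<in> tangent_space (atlas_prod B F) x"
    have "proj_fst v = (\<Sum>e\<in>onb. proj_fst v (y e) *\<^sub>R E e (fst x))"
      using y(5) x proj_fst_tangent[OF v] by auto
    moreover have "proj_fst v (y e) = v (\<lambda>u. y e (fst u))" for e
      using y(3) by (simp add: pushforward_def o_def)
    ultimately show "proj_fst v = (\<Sum>e\<in>onb. v (\<lambda>u. y e (fst u)) *\<^sub>R E e (fst x))" by simp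
    have "proj_snd v = (\<Sum>e\<in>onb. proj_snd v (z e) *\<^sub>R G e (snd x))"
      using z(5) x proj_snd_tangent[OF v] by auto
    moreover have "proj_snd v (z e) = v (\<lambda>u. z e (snd u))" for e
      using z(3) by (simp add: pushforward_def o_def)
    ultimately show "proj_snd v = (\<Sum>e\<in>onb. v (\<lambda>u. z e (snd u)) *\<^sub>R G e (snd x))" by simp
  qed (use y z in auto)
qed

lemma g_of_TP_smooth:
  assumes X: "X \<in> vector_fields (atlas_prod B F)" and Y: "Y \<in> vector_fields (atlas_prod B F)"
  shows "g_of TP X Y \<in> SP"
proof (rule P.smooth_functions_localI)
  fix x0
  obtain N y E z G where N: "open N" "x0 \<in> N" and y: "\<forall>e. y e \<in> smooth B" "\<forall>e. E e \<in> vfields B"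
    and z: "\<forall>e. z e \<in> smooth F" "\<forall>e. G e \<in> vfields F"
    and fr: "\<forall>x\<in>N. \<forall>v\<in>tangent_space (atlas_prod B F) x.
      proj_fst v = (\<Sum>e\<in>onb. v (\<lambda>u. y e (fst u)) *\<^sub>R E (e::'e) (fst x)) \<and>
      proj_snd v = (\<Sum>e\<in>onb. v (\<lambda>u. z e (snd u)) *\<^sub>R G (e::'f) (snd x))"
    using ex_proj_frame[of x0] by (elim exE conjE) (rule that)
  have Et: "E e p \<in> tangent B p" "G e' q \<in> tangent F q" for e p e' q
    using y(2) z(2) B.vector_field_tangent F.vector_field_tangent by auto
  let ?f = "\<lambda>x. (\<Sum>e\<in>onb. \<Sum>e'\<in>onb. X x (\<lambda>u. y e (fst u)) * (Y x (\<lambda>u. y e' (fst u)) * g_of B (E e) (E e') (fst x))) +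
    (b x)\<^sup>2 * (\<Sum>e\<in>onb. \<Sum>e'\<in>onb. X x (\<lambda>u. z e (snd u)) * (Y x (\<lambda>u. z e' (snd u)) * g_of F (G e) (G e') (snd x)))"
  have "?f \<in> SP"
    using y z
    by (intro P.smooth_add P.smooth_mult P.smooth_power P.smooth_sum b_smooth P.vector_field_smooth'[OF X]
        P.vector_field_smooth'[OF Y] smooth_pullback_fst smooth_pullback_snd B.g_of_smooth F.g_of_smooth) auto
  moreover have "g_of TP X Y x = ?f x" if x: "x \<in> N" for x
  proof -
    have *: "proj_fst (X x) = (\<Sum>e\<in>onb. X x (\<lambda>u. y e (fst u)) *\<^sub>R E e (fst x))"
      "proj_snd (X x) = (\<Sum>e\<in>onb. X x (\<lambda>u. z e (snd u)) *\<^sub>R G e (snd x))"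
      "proj_fst (Y x) = (\<Sum>e\<in>onb. Y x (\<lambda>u. y e (fst u)) *\<^sub>R E e (fst x))"
      "proj_snd (Y x) = (\<Sum>e\<in>onb. Y x (\<lambda>u. z e (snd u)) *\<^sub>R G e (snd x))"
      using fr x P.vector_field_tangent[OF X] P.vector_field_tangent[OF Y] by blast+
    have tB: "(\<Sum>e\<in>onb. c e *\<^sub>R E e (fst x)) \<in> tangent B (fst x)" for c
      by (intro B.sum_tangent B.scaleR_tangent Et)
    have tF: "(\<Sum>e\<in>onb. c e *\<^sub>R G e (snd x)) \<in> tangent F (snd x)" for c
      by (intro F.sum_tangent F.scaleR_tangent Et)
    have "metric B (fst x) (\<Sum>e\<in>onb. c e *\<^sub>R E e (fst x)) (\<Sum>e\<in>onb. d e *\<^sub>R E e (fst x)) =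
      (\<Sum>e\<in>onb. \<Sum>e'\<in>onb. c e * (d e' * g_of B (E e) (E e') (fst x)))" for c d
      by (subst B.covector_sum[OF B.covector_metric(2)[OF tB]])
        (simp_all add: Et B.covector_sum[OF B.covector_metric(1)[OF Et(1)]] g_of_def sum_distrib_left)
    moreover have "metric F (snd x) (\<Sum>e\<in>onb. c e *\<^sub>R G e (snd x)) (\<Sum>e\<in>onb. d e *\<^sub>R G e (snd x)) =
      (\<Sum>e\<in>onb. \<Sum>e'\<in>onb. c e * (d e' * g_of F (G e) (G e') (snd x)))" for c d
      by (subst F.covector_sum[OF F.covector_metric(2)[OF tF]])
        (simp_all add: Et F.covector_sum[OF F.covector_metric(1)[OF Et(2)]] g_of_def sum_distrib_left)
    ultimately show ?thesis
      by (simp only: g_of_def metric_TP *)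
  qed
  ultimately show "\<exists>N h. open N \<and> x0 \<in> N \<and> h \<in> SP \<and> (\<forall>x\<in>N. g_of TP X Y x = h x)"
    using N by (intro exI[of _ N] exI[of _ ?f]) blast
qed

lemma endo_TP_tangent:
  assumes v: "v \<in> tangent_space (atlas_prod B F) x"
  shows "endo TP x v \<in> tangent_space (atlas_prod B F) x"
  unfolding endo_TP
  by (intro P.add_tangent incl_fst_tangent incl_snd_tangent B.endo_tangent F.endo_tangent
      proj_fst_tangent proj_snd_tangent v)

lemma proj_endo_TP:
  assumes v: "v \<in> tangent_space (atlas_prod B F) x"
  shows "proj_fst (endo TP x v) = endo B (fst x) (proj_fst v)"
    and "proj_snd (endo TP x v) = endo F (snd x) (proj_snd v)"
  using B.endo_tangent[OF proj_fst_tangent[OF v]] F.endo_tangent[OF proj_snd_tangent[OF v]]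
  unfolding endo_TP proj_linear by (simp_all only: proj_incl add_0_right add_0_left)

lemma J_of_TP_vector_field:
  assumes X: "X \<in> vector_fields (atlas_prod B F)"
  shows "J_of TP X \<in> vector_fields (atlas_prod B F)"
proof (rule P.vector_fieldI)
  show "J_of TP X x \<in> tangent_space (atlas_prod B F) x" for x
    unfolding J_of_def by (rule endo_TP_tangent[OF P.vector_field_tangent[OF X]])
  fix f assume f: "f \<in> SP"
  show "(\<lambda>x. J_of TP X x f) \<in> SP"
  proof (rule P.smooth_functions_localI)
    fix x0
    obtain N y E z G where N: "open N" "x0 \<in> N" and y: "\<forall>e. y e \<in> smooth B" "\<forall>e. E e \<in> vfields B"
      and z: "\<forall>e. z e \<in> smooth F" "\<forall>e. G e \<in> vfields F"
      and fr: "\<forall>x\<in>N. \<forall>v\<in>tangent_space (atlas_prod B F) x.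
        proj_fst v = (\<Sum>e\<in>onb. v (\<lambda>u. y e (fst u)) *\<^sub>R E (e::'e) (fst x)) \<and>
        proj_snd v = (\<Sum>e\<in>onb. v (\<lambda>u. z e (snd u)) *\<^sub>R G (e::'f) (snd x))"
      using ex_proj_frame[of x0] by (elim exE conjE) (rule that)
    have Et: "E e p \<in> tangent B p" "G e' q \<in> tangent F q" for e p e' q
      using y(2) z(2) B.vector_field_tangent F.vector_field_tangent by auto
    let ?h = "\<lambda>x. (\<Sum>e\<in>onb. X x (\<lambda>u. y e (fst u)) * deriv_along (lB (J_of B (E e))) f x) +
      (\<Sum>e\<in>onb. X x (\<lambda>u. z e (snd u)) * deriv_along (lF (J_of F (G e))) f x)"
    have "?h \<in> SP"
      using y z
      by (intro P.smooth_add P.smooth_mult P.smooth_sum P.vector_field_smooth'[OF X] lift_fst_smooth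
          lift_snd_smooth smooth_pullback_fst smooth_pullback_snd B.J_of_vector_field F.J_of_vector_field f) auto
    moreover have "J_of TP X x f = ?h x" if x: "x \<in> N" for x
    proof -
      have *: "proj_fst (X x) = (\<Sum>e\<in>onb. X x (\<lambda>u. y e (fst u)) *\<^sub>R E e (fst x))"
        "proj_snd (X x) = (\<Sum>e\<in>onb. X x (\<lambda>u. z e (snd u)) *\<^sub>R G e (snd x))"
        using fr x P.vector_field_tangent[OF X] by blast+
      have sum1: "incl_fst B F x (\<Sum>e\<in>J. c e *\<^sub>R v e) f = (\<Sum>e\<in>J. c e * incl_fst B F x (v e) f)"
        if "finite J" for J :: "'e set" and c v
        using that
      proof induction
        case empty
        show ?case unfolding sum.empty incl_linear by simp
      next
        case (insert e J)
        show ?case unfolding sum.insert[OF insert(1,2)] incl_linear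
          by (simp only: plus_fun_apply scaleR_fun_apply real_scaleR_def insert.IH)
      qed
      have sum2: "incl_snd B F x (\<Sum>e\<in>J. c e *\<^sub>R v e) f = (\<Sum>e\<in>J. c e * incl_snd B F x (v e) f)"
        if "finite J" for J :: "'f set" and c v
        using that
      proof induction
        case empty
        show ?case unfolding sum.empty incl_linear by simp
      next
        case (insert e J)
        show ?case unfolding sum.insert[OF insert(1,2)] incl_linear
          by (simp only: plus_fun_apply scaleR_fun_apply real_scaleR_def insert.IH)
      qed
      show ?thesis
        unfolding J_of_def endo_TP * B.endo_sum[OF Et(1) finite_onb] F.endo_sum[OF Et(2) finite_onb]
        by (simp only: plus_fun_apply sum1[OF finite_onb] sum2[OF finite_onb] deriv_along_def
            lift_fst_def lift_snd_def)
    qed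
    ultimately show "\<exists>N h. open N \<and> x0 \<in> N \<and> h \<in> SP \<and> (\<forall>x\<in>N. J_of TP X x f = h x)"
      using N by (intro exI[of _ N] exI[of _ ?h]) blast
  qed
qed

lemma almost_product_manifold_TP: "almost_product_manifold TP"
  unfolding almost_product_manifold_def atlas_TP
proof (intro conjI allI ballI)
  show "smooth_atlas (atlas_prod B F)" by (rule smooth_atlas_prod)
  fix x
  show "metric TP x (a *\<^sub>R u + c *\<^sub>R v) w = a * metric TP x u w + c * metric TP x v w"
    if "u \<in> tangent_space (atlas_prod B F) x" "v \<in> tangent_space (atlas_prod B F) x"
      "w \<in> tangent_space (atlas_prod B F) x" for u v w a c
    unfolding metric_TP proj_linear
    using that by (simp add: B.metric_lincomb_left F.metric_lincomb_left proj_fst_tangent proj_snd_tangent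
        algebra_simps del: plus_fun_apply)
  show "metric TP x v w = metric TP x w v"
    if "v \<in> tangent_space (atlas_prod B F) x" "w \<in> tangent_space (atlas_prod B F) x" for v w
    using that by (simp add: metric_TP B.metric_sym[of "proj_fst v"] F.metric_sym[of "proj_snd v"]
        proj_fst_tangent proj_snd_tangent)
  show "endo TP x v \<in> tangent_space (atlas_prod B F) x" if "v \<in> tangent_space (atlas_prod B F) x" for v
    using that by (rule endo_TP_tangent)
  show "endo TP x (endo TP x v) = v" if v: "v \<in> tangent_space (atlas_prod B F) x" for v
  proof -
    have "endo TP x (endo TP x v) = incl_fst B F x (endo B (fst x) (proj_fst (endo TP x v))) +
        incl_snd B F x (endo F (snd x) (proj_snd (endo TP x v)))" by (rule endo_TP)
    also have "\<dots> = incl_fst B F x (proj_fst v) + incl_snd B F x (proj_snd v)"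
      by (simp only: proj_endo_TP[OF v] B.endo_endo[OF proj_fst_tangent[OF v]]
          F.endo_endo[OF proj_snd_tangent[OF v]])
    also have "\<dots> = v" by (rule tangent_prod_split[OF v, symmetric])
    finally show ?thesis .
  qed
  show "endo TP x (a *\<^sub>R v + c *\<^sub>R w) = a *\<^sub>R endo TP x v + c *\<^sub>R endo TP x w"
    if v: "v \<in> tangent_space (atlas_prod B F) x" and w: "w \<in> tangent_space (atlas_prod B F) x" for v w a c
    unfolding endo_TP proj_linear B.endo_lincomb[OF proj_fst_tangent[OF v] proj_fst_tangent[OF w]]
      F.endo_lincomb[OF proj_snd_tangent[OF v] proj_snd_tangent[OF w]] incl_linear
    by (simp only: scaleR_add_right ac_simps)
  show "metric TP x (endo TP x v) (endo TP x w) = metric TP x v w"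
    if v: "v \<in> tangent_space (atlas_prod B F) x" and w: "w \<in> tangent_space (atlas_prod B F) x" for v w
    by (simp only: metric_TP proj_endo_TP[OF v] proj_endo_TP[OF w]
        B.metric_endo[OF proj_fst_tangent[OF v] proj_fst_tangent[OF w]]
        F.metric_endo[OF proj_snd_tangent[OF v] proj_snd_tangent[OF w]])
qed (auto intro: g_of_TP_smooth J_of_TP_vector_field)

sublocale M: ap_manifold TP
  by unfold_locales (rule almost_product_manifold_TP)

section \<open>The metric and the Koszul form on lifted fields\<close>

lemma lift_vfields: "X \<in> vfields B \<Longrightarrow> lB X \<in> vfields TP" "V \<in> vfields F \<Longrightarrow> lF V \<in> vfields TP"
  by (simp_all add: lift_fst_vector_field lift_snd_vector_field)

lemma metric_incl:
  assumes "u \<in> tangent B (fst x)" "u' \<in> tangent B (fst x)" "w \<in> tangent F (snd x)" "w' \<in> tangent F (snd x)"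
  shows "metric TP x (incl_fst B F x u) (incl_fst B F x u') = metric B (fst x) u u'"
    "metric TP x (incl_fst B F x u) (incl_snd B F x w) = 0"
    "metric TP x (incl_snd B F x w) (incl_fst B F x u) = 0"
    "metric TP x (incl_snd B F x w) (incl_snd B F x w') = (b x)\<^sup>2 * metric F (snd x) w w'"
proof -
  have z: "metric B (fst x) 0 v = 0" "metric B (fst x) v 0 = 0" if "v \<in> tangent B (fst x)" for v
    using B.covector_zero[OF B.covector_metric(1)[OF that]] B.covector_zero[OF B.covector_metric(2)[OF that]]
    by simp_all
  have z': "metric F (snd x) 0 v = 0" "metric F (snd x) v 0 = 0" if "v \<in> tangent F (snd x)" for v
    using F.covector_zero[OF F.covector_metric(1)[OF that]] F.covector_zero[OF F.covector_metric(2)[OF that]]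
    by simp_all
  show "metric TP x (incl_fst B F x u) (incl_fst B F x u') = metric B (fst x) u u'"
    "metric TP x (incl_fst B F x u) (incl_snd B F x w) = 0"
    "metric TP x (incl_snd B F x w) (incl_fst B F x u) = 0"
    "metric TP x (incl_snd B F x w) (incl_snd B F x w') = (b x)\<^sup>2 * metric F (snd x) w w'"
    by (simp_all only: metric_TP proj_incl assms z z' B.zero_tangent F.zero_tangent mult_zero_right
        add_0_right add_0_left)
qed

lemma g_of_lift:
  "X \<in> vfields B \<Longrightarrow> Y \<in> vfields B \<Longrightarrow> g_of TP (lB X) (lB Y) = (\<lambda>x. g_of B X Y (fst x))"
  "X \<in> vfields B \<Longrightarrow> V \<in> vfields F \<Longrightarrow> g_of TP (lB X) (lF V) = (\<lambda>x. 0)"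
  "V \<in> vfields F \<Longrightarrow> X \<in> vfields B \<Longrightarrow> g_of TP (lF V) (lB X) = (\<lambda>x. 0)"
  "V \<in> vfields F \<Longrightarrow> W \<in> vfields F \<Longrightarrow> g_of TP (lF V) (lF W) = (\<lambda>x. (b x)\<^sup>2 * g_of F V W (snd x))"
  using metric_incl[OF B.vector_field_tangent B.vector_field_tangent F.zero_tangent F.zero_tangent]
    metric_incl[OF B.vector_field_tangent B.zero_tangent F.vector_field_tangent F.zero_tangent]
    metric_incl[OF B.zero_tangent B.zero_tangent F.vector_field_tangent F.vector_field_tangent]
  by (simp_all add: g_of_def lift_fst_def lift_snd_def)

lemma J_of_lift:
  "X \<in> vfields B \<Longrightarrow> J_of TP (lB X) = lB (J_of B X)"
  "V \<in> vfields F \<Longrightarrow> J_of TP (lF V) = lF (J_of F V)"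
proof -
  have e0: "endo B p 0 = 0" "endo F q 0 = 0" for p q
    by (rule B.endo_sum[of "{}" "\<lambda>_. 0" p "\<lambda>_. 0", unfolded sum.empty]; simp)
      (rule F.endo_sum[of "{}" "\<lambda>_. 0" q "\<lambda>_. 0", unfolded sum.empty]; simp)
  show "X \<in> vfields B \<Longrightarrow> J_of TP (lB X) = lB (J_of B X)"
    by (rule ext) (simp only: J_of_def endo_TP lift_fst_def proj_incl B.vector_field_tangent e0 incl_linear add_0_right)
  show "V \<in> vfields F \<Longrightarrow> J_of TP (lF V) = lF (J_of F V)"
    by (rule ext) (simp only: J_of_def endo_TP lift_snd_def proj_incl F.vector_field_tangent e0 incl_linear add_0_left)
qed

lemma g_of_zero: "g_of TP X (\<lambda>x. 0) = (\<lambda>x. 0)" if "X \<in> vector_fields (atlas_prod B F)"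
  using M.g_of_mult_right[of X X "\<lambda>_. 0"] that by (simp del: zero_fun_apply)

lemma bracket_lift_mixed': "X \<in> vfields B \<Longrightarrow> V \<in> vfields F \<Longrightarrow> bracket (lF V) (lB X) = (\<lambda>x. 0)"
  using bracket_lift_mixed[of X V] by (simp add: fun_eq_iff bracket_def)

lemma deriv_lift_db2:
  "X \<in> vfields B \<Longrightarrow> a \<in> smooth F \<Longrightarrow>
    deriv_along (lB X) (\<lambda>x. (b x)\<^sup>2 * a (snd x)) x = 2 * b x * deriv_along (lB X) b x * a (snd x)"
  "V \<in> vfields F \<Longrightarrow> a \<in> smooth F \<Longrightarrow>
    deriv_along (lF V) (\<lambda>x. (b x)\<^sup>2 * a (snd x)) x =
      2 * b x * deriv_along (lF V) b x * a (snd x) + (b x)\<^sup>2 * deriv_along V a (snd x)"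
  using b_smooth smooth_pullback_snd[of a]
  by (simp_all add: P.deriv_along_mult power2_eq_square P.smooth_mult lift_fst_vector_field
      lift_snd_vector_field deriv_lift_pullback algebra_simps)

lemma koszul_lift:
  "X \<in> vfields B \<Longrightarrow> Y \<in> vfields B \<Longrightarrow> Z \<in> vfields B \<Longrightarrow>
    koszul TP (lB X) (lB Y) (lB Z) x = koszul B X Y Z (fst x)"
  "X \<in> vfields B \<Longrightarrow> Y \<in> vfields B \<Longrightarrow> W \<in> vfields F \<Longrightarrow> koszul TP (lB X) (lB Y) (lF W) x = 0"
  "X \<in> vfields B \<Longrightarrow> Y \<in> vfields B \<Longrightarrow> W \<in> vfields F \<Longrightarrow> koszul TP (lB X) (lF W) (lB Y) x = 0"
  "X \<in> vfields B \<Longrightarrow> Y \<in> vfields B \<Longrightarrow> W \<in> vfields F \<Longrightarrow> koszul TP (lF W) (lB X) (lB Y) x = 0"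
  "X \<in> vfields B \<Longrightarrow> V \<in> vfields F \<Longrightarrow> W \<in> vfields F \<Longrightarrow>
    koszul TP (lB X) (lF V) (lF W) x = b x * deriv_along (lB X) b x * g_of F V W (snd x)"
  "X \<in> vfields B \<Longrightarrow> V \<in> vfields F \<Longrightarrow> W \<in> vfields F \<Longrightarrow>
    koszul TP (lF V) (lB X) (lF W) x = b x * deriv_along (lB X) b x * g_of F V W (snd x)"
  "X \<in> vfields B \<Longrightarrow> V \<in> vfields F \<Longrightarrow> W \<in> vfields F \<Longrightarrow>
    koszul TP (lF V) (lF W) (lB X) x = - (b x * deriv_along (lB X) b x * g_of F V W (snd x))"
  "U \<in> vfields F \<Longrightarrow> V \<in> vfields F \<Longrightarrow> W \<in> vfields F \<Longrightarrow>
    koszul TP (lF U) (lF V) (lF W) x = (b x)\<^sup>2 * koszul F U V W (snd x) +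
      b x * (deriv_along (lF U) b x * g_of F V W (snd x) + deriv_along (lF V) b x * g_of F U W (snd x)
        - deriv_along (lF W) b x * g_of F U V (snd x))"
  unfolding koszul_def
  by (simp_all add: g_of_lift bracket_lift_fst bracket_lift_snd bracket_lift_mixed bracket_lift_mixed'
      g_of_zero lift_fst_vector_field lift_snd_vector_field
      deriv_lift_pullback deriv_lift_const deriv_lift_db2 B.g_of_smooth F.g_of_smooth
      B.bracket_vector_field F.bracket_vector_field F.g_of_sym[of W V] F.g_of_sym[of W U])
    (simp_all add: field_simps)

end

section \<open>Bilinearity of the inverse metric\<close>

context ap_manifold
begin

lemma covector_add: "covector M p \<alpha> \<Longrightarrow> covector M p \<beta> \<Longrightarrow> covector M p (\<lambda>v. \<alpha> v + \<beta> v)"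
  by (simp add: covector_def algebra_simps del: plus_fun_apply)

lemma covector_cmult: "covector M p \<alpha> \<Longrightarrow> covector M p (\<lambda>v. c * \<alpha> v)"
  by (simp add: covector_def algebra_simps del: plus_fun_apply)

lemma covector_0: "covector M p (\<lambda>v. 0)"
  by (simp add: covector_def)

lemma covector_endo: "covector M p \<alpha> \<Longrightarrow> covector M p (\<lambda>v. \<alpha> (endo M p v))"
  by (simp add: covector_def endo_lincomb endo_tangent del: plus_fun_apply)

lemmas covector_intros = covector_add covector_cmult covector_0 covector_endo covector_metric(1)

lemma koszul_zero_first:
  assumes "Y \<in> vfields M" "Z \<in> vfields M"
  shows "koszul M (\<lambda>p. 0) Y Z p = 0"
proof -
  have 0: "(\<lambda>p. 0) \<in> vfields M" by (rule zero_vector_field)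
  have g: "g_of M W (\<lambda>p. 0) = (\<lambda>p. 0)" "g_of M (\<lambda>p. 0) W = (\<lambda>p. 0)" if "W \<in> vfields M" for W
    using g_of_mult_right[OF that that, of "\<lambda>_. 0"] g_of_sym[OF 0 that] by (simp_all del: zero_fun_apply)
  have b: "bracket W (\<lambda>p. 0) = (\<lambda>p. 0)" "bracket (\<lambda>p. 0) W = (\<lambda>p. 0)" if "W \<in> vfields M" for W
    using tangent_const[OF vector_field_tangent[OF that]]
    by (auto simp: bracket_def deriv_along_def fun_eq_iff)
  have d: "deriv_along (\<lambda>p. 0) f = (\<lambda>p. 0)" for f by (simp add: deriv_along_def)
  show ?thesis
    using assms by (simp add: koszul_def g b d bracket_vector_field deriv_along_const del: zero_fun_apply)
qed

lemma ap_koszul_zero_first: "Y \<in> vfields M \<Longrightarrow> Z \<in> vfields M \<Longrightarrow> ap_koszul M (\<lambda>p. 0) Y Z p = 0"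
  by (simp add: ap_koszul_def koszul_zero_first J_of_vector_field)

end

context nondegenerate_ap_manifold
begin

lemma cometric_add:
  assumes "covector M p \<alpha>" "covector M p \<beta>" "covector M p \<delta>"
  shows "cometric M p (\<lambda>v. \<alpha> v + \<beta> v) \<delta> = cometric M p \<alpha> \<delta> + cometric M p \<beta> \<delta>"
    and "cometric M p \<delta> (\<lambda>v. \<alpha> v + \<beta> v) = cometric M p \<delta> \<alpha> + cometric M p \<delta> \<beta>"
proof -
  obtain u v w where d: "metric_dual M p u \<alpha>" "metric_dual M p v \<beta>" "metric_dual M p w \<delta>"
    using assms ex_metric_dual by meson
  have s: "metric_dual M p (1 *\<^sub>R u + 1 *\<^sub>R v) (\<lambda>w. \<alpha> w + \<beta> w)"
    using metric_dual_lincomb[OF d(1,2), of 1 1] by simp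
  have t: "u \<in> tangent M p" "v \<in> tangent M p" "w \<in> tangent M p" using d by (auto simp: metric_dual_def)
  show "cometric M p (\<lambda>v. \<alpha> v + \<beta> v) \<delta> = cometric M p \<alpha> \<delta> + cometric M p \<beta> \<delta>"
    unfolding cometric_eq[OF s d(3)] cometric_eq[OF d(1,3)] cometric_eq[OF d(2,3)]
      metric_lincomb_left[OF t] by simp
  show "cometric M p \<delta> (\<lambda>v. \<alpha> v + \<beta> v) = cometric M p \<delta> \<alpha> + cometric M p \<delta> \<beta>"
    unfolding cometric_eq[OF d(3) s] cometric_eq[OF d(3,1)] cometric_eq[OF d(3,2)]
      metric_lincomb_right[OF t] by simp
qed

lemma cometric_cmult:
  assumes "covector M p \<alpha>" "covector M p \<delta>"
  shows "cometric M p (\<lambda>v. c * \<alpha> v) \<delta> = c * cometric M p \<alpha> \<delta>"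
    and "cometric M p \<delta> (\<lambda>v. c * \<alpha> v) = c * cometric M p \<delta> \<alpha>"
proof -
  obtain u w where d: "metric_dual M p u \<alpha>" "metric_dual M p w \<delta>"
    using assms ex_metric_dual by meson
  have s: "metric_dual M p (c *\<^sub>R u + 0 *\<^sub>R u) (\<lambda>w. c * \<alpha> w)"
    using metric_dual_lincomb[OF d(1,1), of c 0] by simp
  have t: "u \<in> tangent M p" "w \<in> tangent M p" using d by (auto simp: metric_dual_def)
  show "cometric M p (\<lambda>v. c * \<alpha> v) \<delta> = c * cometric M p \<alpha> \<delta>"
    unfolding cometric_eq[OF s d(2)] cometric_eq[OF d(1,2)] metric_lincomb_left[OF t(1,1,2)] by simp
  show "cometric M p \<delta> (\<lambda>v. c * \<alpha> v) = c * cometric M p \<delta> \<alpha>"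
    unfolding cometric_eq[OF d(2) s] cometric_eq[OF d(2,1)] metric_lincomb_right[OF t(1,1,2)] by simp
qed

lemma cometric_sym:
  assumes "covector M p \<alpha>" "covector M p \<delta>"
  shows "cometric M p \<alpha> \<delta> = cometric M p \<delta> \<alpha>"
proof -
  obtain u w where d: "metric_dual M p u \<alpha>" "metric_dual M p w \<delta>"
    using assms ex_metric_dual by meson
  then show ?thesis
    unfolding cometric_eq[OF d] cometric_eq[OF d(2,1)] by (intro metric_sym) (auto simp: metric_dual_def)
qed

lemma cometric_metric:
  assumes "u \<in> tangent M p" "covector M p \<alpha>"
  shows "cometric M p (metric M p u) \<alpha> = \<alpha> u" "cometric M p \<alpha> (metric M p u) = \<alpha> u"
proof -
  obtain v where v: "metric_dual M p v \<alpha>" using assms ex_metric_dual by meson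
  show "cometric M p (metric M p u) \<alpha> = \<alpha> u" using cometric_dual[OF metric_dual_metric[OF assms(1)] v] .
  then show "cometric M p \<alpha> (metric M p u) = \<alpha> u"
    using cometric_sym[OF covector_metric(1)[OF assms(1)] assms(2)] by simp
qed

lemma cometric_0:
  assumes "covector M p \<alpha>"
  shows "cometric M p (\<lambda>v. 0) \<alpha> = 0" "cometric M p \<alpha> (\<lambda>v. 0) = 0"
  using cometric_cmult[OF assms assms, of 0] by simp_all

lemmas cometric_simps = cometric_add cometric_cmult cometric_metric cometric_0

end

section \<open>Contraction on the twisted product\<close>

context twisted
begin

abbreviation "dbB x \<equiv> (\<lambda>v. incl_fst B F x v b)"
abbreviation "dbJB x \<equiv> (\<lambda>v. incl_fst B F x (endo B (fst x) v) b)"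
abbreviation "dbF x \<equiv> (\<lambda>v. incl_snd B F x v b)"
abbreviation "dbJF x \<equiv> (\<lambda>v. incl_snd B F x (endo F (snd x) v) b)"

lemma covector_db: "covector B (fst x) (dbB x)" "covector F (snd x) (dbF x)"
  unfolding covector_def incl_linear by (simp_all add: scaleR_fun_apply)

lemma covector_dbJ: "covector B (fst x) (dbJB x)" "covector F (snd x) (dbJF x)"
  using B.covector_endo[OF covector_db(1)] F.covector_endo[OF covector_db(2)] by simp_all

lemma db_apply: "dbB x (X (fst x)) = deriv_along (lB X) b x" "dbF x (V (snd x)) = deriv_along (lF V) b x"
  "dbJB x (X (fst x)) = deriv_along (lB (J_of B X)) b x" "dbJF x (V (snd x)) = deriv_along (lF (J_of F V)) b x"
  by (simp_all add: deriv_along_def lift_fst_def lift_snd_def J_of_def)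

text \<open>This is where the hypothesis on \<open>db\<close> enters; through it
  \<open>\<gamma>\<close> vanishes together with \<open>b\<close> in the decompositions
  below.\<close>

lemma deriv_b_zero: "b x = 0 \<Longrightarrow> X \<in> vfields B \<Longrightarrow> deriv_along (lB X) b x = 0"
    "b x = 0 \<Longrightarrow> V \<in> vfields F \<Longrightarrow> deriv_along (lF V) b x = 0"
    "b x = 0 \<Longrightarrow> w \<in> tangent F (snd x) \<Longrightarrow> incl_snd B F x w b = 0"
  using db_zero P.vector_field_tangent[OF lift_fst_vector_field] P.vector_field_tangent[OF lift_snd_vector_field]
    incl_snd_tangent by (auto simp: deriv_along_def)

text \<open>At a point with \<open>b \<noteq> 0\<close> the metric is nondegenerate; where \<open>b = 0\<close> its radical annihilator is
  the cotangent space of \<open>B\<close>. So the rank is locally constant off the boundary of the zero set.\<close>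

lemma metric_rank_TP:
  "metric_rank TP x = (if b x = 0 then card (onb :: 'e set) else card (onb :: ('e \<times> 'f) set))"
proof -
  have flat_lin: "flat TP x (a *\<^sub>R u + c *\<^sub>R v) = a *\<^sub>R flat TP x u + c *\<^sub>R flat TP x v"
    if "u \<in> tangent TP x" "v \<in> tangent TP x" for u v a c
    using that by (intro ext) (simp add: flat_def scaleR_fun_apply M.metric_lincomb_left[unfolded atlas_TP] del: atlas_TP[symmetric])
  have split: "v = incl_fst B F x (proj_fst v) + incl_snd B F x (proj_snd v)"
    if "v \<in> tangent_space (atlas_prod B F) x" for v by (rule tangent_prod_split[OF that])
  note t0 = B.zero_tangent F.zero_tangent
  show ?thesis
  proof (cases "b x = 0")
    case True
    let ?L = "\<lambda>u. flat TP x (incl_fst B F x u)"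
    have "flat TP x v = ?L (proj_fst v)" if v: "v \<in> tangent_space (atlas_prod B F) x" for v
    proof
      fix w
      show "flat TP x v w = ?L (proj_fst v) w"
        using True by (simp add: flat_def metric_TP proj_incl proj_fst_tangent[OF v])
    qed
    moreover have "?L u \<in> flat TP x ` tangent_space (atlas_prod B F) x" if "u \<in> tangent B (fst x)" for u
      using incl_fst_tangent[OF that] by blast
    ultimately have "radical_annihilator TP x = ?L ` tangent B (fst x)"
      unfolding radical_annihilator_def atlas_TP using proj_fst_tangent by (intro equalityI image_subsetI) auto
    moreover have "dim (?L ` tangent B (fst x)) = card (onb :: 'e set)"
    proof (rule B.dim_image_tangent)
      show "?L (a *\<^sub>R u + c *\<^sub>R v) = a *\<^sub>R ?L u + c *\<^sub>R ?L v"
        if "u \<in> tangent B (fst x)" "v \<in> tangent B (fst x)" for u v a c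
        unfolding incl_linear by (rule flat_lin) (simp_all add: incl_fst_tangent that)
      show "u = 0" if u: "u \<in> tangent B (fst x)" and "?L u = 0" for u
      proof (rule B.metric_nondegenerate[OF u])
        fix w assume w: "w \<in> tangent B (fst x)"
        show "metric B (fst x) u w = 0"
          using fun_cong[OF \<open>?L u = 0\<close>, of "incl_fst B F x w"] metric_incl(1)[OF u w t0(2,2)] incl_fst_tangent[OF w]
          by (simp add: flat_def)
      qed
    qed
    ultimately show ?thesis using True by (simp add: metric_rank_def)
  next
    case False
    have "dim (flat TP x ` tangent_space (atlas_prod B F) x) = card (onb :: ('e \<times> 'f) set)"
    proof (rule P.dim_image_tangent)
      show "flat TP x (a *\<^sub>R u + c *\<^sub>R v) = a *\<^sub>R flat TP x u + c *\<^sub>R flat TP x v"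
        if "u \<in> tangent_space (atlas_prod B F) x" "v \<in> tangent_space (atlas_prod B F) x" for u v a c
        by (rule flat_lin) (simp_all add: that)
      fix v assume v: "v \<in> tangent_space (atlas_prod B F) x" and fl: "flat TP x v = 0"
      note pv = proj_fst_tangent[OF v] proj_snd_tangent[OF v]
      have 0: "metric TP x v w = 0" if "w \<in> tangent_space (atlas_prod B F) x" for w
        using fun_cong[OF fl, of w] that by (simp add: flat_def)
      have z: "metric B (fst x) (proj_fst v) 0 = 0" "metric F (snd x) (proj_snd v) 0 = 0"
        using B.covector_zero[OF B.covector_metric(1)[OF pv(1)]] F.covector_zero[OF F.covector_metric(1)[OF pv(2)]] .
      have "proj_fst v = 0"
      proof (rule B.metric_nondegenerate[OF pv(1)])
        fix w assume w: "w \<in> tangent B (fst x)"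
        show "metric B (fst x) (proj_fst v) w = 0"
          using 0[OF incl_fst_tangent[OF w]] by (simp add: metric_TP proj_incl w z)
      qed
      moreover have "proj_snd v = 0"
      proof (rule F.metric_nondegenerate[OF pv(2)])
        fix w assume w: "w \<in> tangent F (snd x)"
        show "metric F (snd x) (proj_snd v) w = 0"
          using 0[OF incl_snd_tangent[OF w]] False by (simp add: metric_TP proj_incl w z)
      qed
      ultimately show "v = 0" using split[OF v] by (simp only: incl_linear add_0_right)
    qed
    then show ?thesis using False by (simp add: metric_rank_def radical_annihilator_def)
  qed
qed

lemma regular_points_dense: "closure (regular_points TP) = UNIV"
proof -
  let ?O = "{x. b x \<noteq> 0}"
  have cont: "continuous_on UNIV b" by (rule P.smooth_functions_continuous[OF b_smooth])
  have "open ?O" using cont by (intro open_Collect_neq) auto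
  have "x \<in> regular_points TP" if "x \<in> ?O" for x
    unfolding regular_points_def metric_rank_TP using that \<open>open ?O\<close> by (intro CollectI exI[of _ ?O]) auto
  moreover have "x \<in> regular_points TP" if x: "x \<in> interior (- ?O)" for x
  proof -
    have "b y = 0" if "y \<in> interior (- ?O)" for y using interior_subset that by auto
    then show ?thesis
      unfolding regular_points_def metric_rank_TP using x by (intro CollectI exI[of _ "interior (- ?O)"]) auto
  qed
  ultimately have "?O \<union> interior (- ?O) \<subseteq> regular_points TP" by blast
  then have "closure ?O \<union> interior (- ?O) \<subseteq> closure (regular_points TP)"
    using closure_mono[of ?O "regular_points TP"] closure_subset[of "regular_points TP"] by blast
  then show ?thesis by (auto simp: interior_complement)
qed

text \<open>The covector \<open>\<omega> x\<close> restricts to \<open>\<alpha> x\<close> on \<open>TB\<close> and to \<open>b \<gamma> x\<close> on \<open>TF\<close>. Splitting off the factor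
  \<open>b\<close> is what makes the contraction of two such forms smooth: the inverse metric on \<open>TF\<close> contributes
  \<open>1 / b\<^sup>2\<close>.\<close>

definition splits ::
    "('m \<times> 'n \<Rightarrow> ('m \<times> 'n) tvec \<Rightarrow> real) \<Rightarrow> ('m \<times> 'n \<Rightarrow> 'm tvec \<Rightarrow> real) \<Rightarrow> ('m \<times> 'n \<Rightarrow> 'n tvec \<Rightarrow> real) \<Rightarrow> bool"
  where "splits \<omega> \<alpha> \<gamma> \<longleftrightarrow> (\<forall>x. covector TP x (\<omega> x) \<and> covector B (fst x) (\<alpha> x) \<and> covector F (snd x) (\<gamma> x) \<and>
    (\<forall>u\<in>tangent B (fst x). \<omega> x (incl_fst B F x u) = \<alpha> x u) \<and>
    (\<forall>w\<in>tangent F (snd x). \<omega> x (incl_snd B F x w) = b x * \<gamma> x w \<and> (b x = 0 \<longrightarrow> \<gamma> x w = 0))) \<and>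
    (\<forall>X\<in>vfields B. (\<lambda>x. \<alpha> x (X (fst x))) \<in> SP) \<and> (\<forall>V\<in>vfields F. (\<lambda>x. \<gamma> x (V (snd x))) \<in> SP)"

lemma splitsD:
  assumes "splits \<omega> \<alpha> \<gamma>"
  shows "covector TP x (\<omega> x)" "covector B (fst x) (\<alpha> x)" "covector F (snd x) (\<gamma> x)"
    "u \<in> tangent B (fst x) \<Longrightarrow> \<omega> x (incl_fst B F x u) = \<alpha> x u"
    "w \<in> tangent F (snd x) \<Longrightarrow> \<omega> x (incl_snd B F x w) = b x * \<gamma> x w"
    "w \<in> tangent F (snd x) \<Longrightarrow> b x = 0 \<Longrightarrow> \<gamma> x w = 0"
    "X \<in> vfields B \<Longrightarrow> (\<lambda>x. \<alpha> x (X (fst x))) \<in> SP" "V \<in> vfields F \<Longrightarrow> (\<lambda>x. \<gamma> x (V (snd x))) \<in> SP"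
  using assms unfolding splits_def by blast+

text \<open>The dual vector is \<open>u + w / b\<close>: the factor \<open>b\<^sup>2\<close> of
  the fibre metric turns \<open>w / b\<close> into \<open>b w\<close>. Where \<open>b = 0\<close>
  the convention \<open>1 / 0 = 0\<close> gives \<open>u\<close>, which is right, since \<open>b
  \<gamma>\<close> vanishes there.\<close>

lemma metric_dual_split:
  assumes s: "splits \<omega> \<alpha> \<gamma>" and u: "metric_dual B (fst x) u (\<alpha> x)" and w: "metric_dual F (snd x) w (\<gamma> x)"
  shows "metric_dual TP x (incl_fst B F x u + incl_snd B F x ((1 / b x) *\<^sub>R w)) (\<omega> x)"
  unfolding metric_dual_def atlas_TP
proof (intro conjI ballI)
  have t: "u \<in> tangent B (fst x)" "w \<in> tangent F (snd x)" using u w by (simp_all add: metric_dual_def)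
  note t' = t F.scaleR_tangent[OF t(2)]
  show "incl_fst B F x u + incl_snd B F x ((1 / b x) *\<^sub>R w) \<in> tangent_space (atlas_prod B F) x"
    by (intro P.add_tangent incl_fst_tangent incl_snd_tangent t')
  fix v assume v: "v \<in> tangent_space (atlas_prod B F) x"
  note pv = proj_fst_tangent[OF v] proj_snd_tangent[OF v]
  have cov: "covector TP x (\<omega> x)" by (rule splitsD(1)[OF s])
  have "metric TP x (incl_fst B F x u + incl_snd B F x ((1 / b x) *\<^sub>R w)) v =
      metric B (fst x) u (proj_fst v) + (b x)\<^sup>2 * metric F (snd x) ((1 / b x) *\<^sub>R w) (proj_snd v)"
    by (simp only: metric_TP proj_linear proj_incl t' add_0_right add_0_left)
  also have "metric F (snd x) ((1 / b x) *\<^sub>R w) (proj_snd v) = 1 / b x * metric F (snd x) w (proj_snd v)"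
    using F.metric_lincomb_left[OF t(2) t(2) pv(2), of "1 / b x" 0] by simp
  also have "metric B (fst x) u (proj_fst v) + (b x)\<^sup>2 * (1 / b x * metric F (snd x) w (proj_snd v)) =
      \<alpha> x (proj_fst v) + b x * \<gamma> x (proj_snd v)"
    using u w pv by (simp add: metric_dual_def power2_eq_square)
  also have "\<dots> = \<omega> x (incl_fst B F x (proj_fst v)) + \<omega> x (incl_snd B F x (proj_snd v))"
    by (simp only: splitsD(4)[OF s pv(1)] splitsD(5)[OF s pv(2)])
  also have "\<dots> = \<omega> x (1 *\<^sub>R incl_fst B F x (proj_fst v) + 1 *\<^sub>R incl_snd B F x (proj_snd v))"
    by (subst M.covector_lincomb[OF cov]) (simp_all add: incl_fst_tangent incl_snd_tangent pv)
  also have "\<dots> = \<omega> x v" using tangent_prod_split[OF v] by (simp only: scaleR_one)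
  finally show "metric TP x (incl_fst B F x u + incl_snd B F x ((1 / b x) *\<^sub>R w)) v = \<omega> x v" .
qed

lemma cometric_split:
  assumes s: "splits \<omega> \<alpha> \<gamma>" "splits \<tau> \<alpha>' \<gamma>'"
  shows "cometric TP x (\<omega> x) (\<tau> x) = cometric B (fst x) (\<alpha> x) (\<alpha>' x) + cometric F (snd x) (\<gamma> x) (\<gamma>' x)"
proof -
  obtain u where u: "metric_dual B (fst x) u (\<alpha> x)" using B.ex_metric_dual[OF splitsD(2)[OF s(1)]] by blast
  obtain u' where u': "metric_dual B (fst x) u' (\<alpha>' x)" using B.ex_metric_dual[OF splitsD(2)[OF s(2)]] by blast
  obtain w where w: "metric_dual F (snd x) w (\<gamma> x)" using F.ex_metric_dual[OF splitsD(3)[OF s(1)]] by blast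
  obtain w' where w': "metric_dual F (snd x) w' (\<gamma>' x)" using F.ex_metric_dual[OF splitsD(3)[OF s(2)]] by blast
  have t: "u \<in> tangent B (fst x)" "w \<in> tangent F (snd x)" "u' \<in> tangent B (fst x)" "w' \<in> tangent F (snd x)"
    using u u' w w' by (simp_all add: metric_dual_def)
  have cov: "covector TP x (\<tau> x)" by (rule splitsD(1)[OF s(2)])
  have "cometric TP x (\<omega> x) (\<tau> x) = \<tau> x (incl_fst B F x u + incl_snd B F x ((1 / b x) *\<^sub>R w))"
    by (rule M.cometric_dual[OF metric_dual_split[OF s(1) u w] metric_dual_split[OF s(2) u' w']])
  also have "\<dots> = \<tau> x (1 *\<^sub>R incl_fst B F x u + (1 / b x) *\<^sub>R incl_snd B F x w)"
    by (simp only: incl_linear scaleR_one)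
  also have "\<dots> = 1 * \<tau> x (incl_fst B F x u) + 1 / b x * \<tau> x (incl_snd B F x w)"
    by (rule M.covector_lincomb[OF cov]) (simp_all add: incl_fst_tangent incl_snd_tangent t)
  also have "\<dots> = \<alpha>' x u + \<gamma>' x w"
    unfolding splitsD(4)[OF s(2) t(1)] splitsD(5)[OF s(2) t(2)]
    using splitsD(6)[OF s(2) t(2)] by (cases "b x = 0") auto
  finally show ?thesis
    unfolding B.cometric_dual[OF u u'] F.cometric_dual[OF w w'] .
qed

lemma contraction_split:
  assumes s: "splits \<omega> \<alpha> \<gamma>" "splits \<tau> \<alpha>' \<gamma>'"
  shows "contraction TP \<omega> \<tau> x = cometric B (fst x) (\<alpha> x) (\<alpha>' x) + cometric F (snd x) (\<gamma> x) (\<gamma>' x)"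
proof -
  have "(\<lambda>x. cometric B (fst x) (\<alpha> x) (\<alpha>' x)) \<in> SP"
    by (rule B.cometric_smooth[OF P.manifold_axioms smooth_pullback_fst continuous_on_fst[OF continuous_on_id]
          splitsD(2)[OF s(1)] splitsD(2)[OF s(2)] splitsD(7)[OF s(1)] splitsD(7)[OF s(2)]])
  moreover have "(\<lambda>x. cometric F (snd x) (\<gamma> x) (\<gamma>' x)) \<in> SP"
    by (rule F.cometric_smooth[OF P.manifold_axioms smooth_pullback_snd continuous_on_snd[OF continuous_on_id]
          splitsD(3)[OF s(1)] splitsD(3)[OF s(2)] splitsD(8)[OF s(1)] splitsD(8)[OF s(2)]])
  ultimately have "(\<lambda>x. cometric B (fst x) (\<alpha> x) (\<alpha>' x) + cometric F (snd x) (\<gamma> x) (\<gamma>' x)) \<in> SP"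
    by (rule P.smooth_add)
  then have "contraction TP \<omega> \<tau> = (\<lambda>x. cometric B (fst x) (\<alpha> x) (\<alpha>' x) + cometric F (snd x) (\<gamma> x) (\<gamma>' x))"
    by (intro P.contraction_eqI) (simp_all add: regular_points_dense cometric_split[OF s])
  then show ?thesis by simp
qed

text \<open>Vectors extend to fields, so it is enough to compare forms on lifted fields.\<close>

lemma splits_nabla_flatI:
  assumes A: "A \<in> vfields TP" "C \<in> vfields TP"
    and co: "\<And>x. covector B (fst x) (\<alpha> x)" "\<And>x. covector F (snd x) (\<gamma> x)"
    and B: "\<And>X x. X \<in> vfields B \<Longrightarrow> ap_koszul TP A C (lB X) x = \<alpha> x (X (fst x))"
    and F: "\<And>V x. V \<in> vfields F \<Longrightarrow> ap_koszul TP A C (lF V) x = b x * \<gamma> x (V (snd x))"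
    and zero: "\<And>V x. V \<in> vfields F \<Longrightarrow> b x = 0 \<Longrightarrow> \<gamma> x (V (snd x)) = 0"
    and sm: "\<And>X. X \<in> vfields B \<Longrightarrow> (\<lambda>x. \<alpha> x (X (fst x))) \<in> SP"
      "\<And>V. V \<in> vfields F \<Longrightarrow> (\<lambda>x. \<gamma> x (V (snd x))) \<in> SP"
  shows "splits (nabla_flat TP A C) \<alpha> \<gamma>"
  unfolding splits_def
proof (intro conjI allI ballI impI)
  fix x
  show "covector TP x (nabla_flat TP A C x)" by (rule M.covector_nabla_flat[OF A])
  show "nabla_flat TP A C x (incl_fst B F x u) = \<alpha> x u" if u: "u \<in> tangent B (fst x)" for u
  proof -
    obtain X where X: "X \<in> vfields B" "X (fst x) = u" using B.ex_vector_field[OF u] by blast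
    then show ?thesis
      using M.nabla_flat_eq[OF A lift_vfields(1)[OF X(1)], of x] B[OF X(1)] by (simp add: lift_fst_def)
  qed
  fix w assume "w \<in> tangent F (snd x)"
  then obtain V where V: "V \<in> vfields F" "V (snd x) = w" using F.ex_vector_field by blast
  then show "nabla_flat TP A C x (incl_snd B F x w) = b x * \<gamma> x w"
    using M.nabla_flat_eq[OF A lift_vfields(2)[OF V(1)], of x] F[OF V(1)] by (simp add: lift_snd_def)
  show "\<gamma> x w = 0" if "b x = 0" using zero[OF V(1) that] V(2) by simp
qed (use co sm in auto)

section \<open>The almost product Koszul form on lifted fields\<close>

lemma ap_koszul_lift:
  "X \<in> vfields B \<Longrightarrow> Y \<in> vfields B \<Longrightarrow> Z \<in> vfields B \<Longrightarrow>
    ap_koszul TP (lB X) (lB Y) (lB Z) = (\<lambda>x. ap_koszul B X Y Z (fst x))"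
  "X \<in> vfields B \<Longrightarrow> Y \<in> vfields B \<Longrightarrow> W \<in> vfields F \<Longrightarrow> ap_koszul TP (lB X) (lB Y) (lF W) = (\<lambda>x. 0)"
  "X \<in> vfields B \<Longrightarrow> Y \<in> vfields B \<Longrightarrow> W \<in> vfields F \<Longrightarrow> ap_koszul TP (lB X) (lF W) (lB Y) = (\<lambda>x. 0)"
  "X \<in> vfields B \<Longrightarrow> Y \<in> vfields B \<Longrightarrow> W \<in> vfields F \<Longrightarrow> ap_koszul TP (lF W) (lB X) (lB Y) = (\<lambda>x. 0)"
  "X \<in> vfields B \<Longrightarrow> V \<in> vfields F \<Longrightarrow> W \<in> vfields F \<Longrightarrow>
    ap_koszul TP (lB X) (lF V) (lF W) = (\<lambda>x. b x * deriv_along (lB X) b x * g_of F V W (snd x))"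
  "X \<in> vfields B \<Longrightarrow> V \<in> vfields F \<Longrightarrow> W \<in> vfields F \<Longrightarrow>
    ap_koszul TP (lF V) (lB X) (lF W) = (\<lambda>x. 1/2 * (b x * deriv_along (lB X) b x * g_of F V W (snd x) +
      b x * deriv_along (lB (J_of B X)) b x * g_of F V (J_of F W) (snd x)))"
  "X \<in> vfields B \<Longrightarrow> V \<in> vfields F \<Longrightarrow> W \<in> vfields F \<Longrightarrow>
    ap_koszul TP (lF V) (lF W) (lB X) = (\<lambda>x. - 1/2 * (b x * deriv_along (lB X) b x * g_of F V W (snd x) +
      b x * deriv_along (lB (J_of B X)) b x * g_of F V (J_of F W) (snd x)))"
  "U \<in> vfields F \<Longrightarrow> V \<in> vfields F \<Longrightarrow> W \<in> vfields F \<Longrightarrow>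
    ap_koszul TP (lF U) (lF V) (lF W) = (\<lambda>x. (b x)\<^sup>2 * ap_koszul F U V W (snd x) +
      1/2 * b x * (2 * deriv_along (lF U) b x * g_of F V W (snd x) + deriv_along (lF V) b x * g_of F U W (snd x)
        - deriv_along (lF W) b x * g_of F U V (snd x)
        + deriv_along (lF (J_of F V)) b x * g_of F U (J_of F W) (snd x)
        - deriv_along (lF (J_of F W)) b x * g_of F U (J_of F V) (snd x)))"
  by (simp_all add: ap_koszul_def fun_eq_iff J_of_lift koszul_lift B.J_of_vector_field F.J_of_vector_field
      F.g_of_J_of field_simps)

lemma splits_BB:
  assumes "X \<in> vfields B" "Y \<in> vfields B"
  shows "splits (nabla_flat TP (lB X) (lB Y)) (\<lambda>x. nabla_flat B X Y (fst x)) (\<lambda>x v. 0)"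
  using assms
  by (intro splits_nabla_flatI lift_vfields B.covector_nabla_flat F.covector_0)
    (simp_all add: ap_koszul_lift B.nabla_flat_eq smooth_pullback_fst B.ap_koszul_smooth)

lemma splits_BF:
  assumes "X \<in> vfields B" "V \<in> vfields F"
  shows "splits (nabla_flat TP (lB X) (lF V)) (\<lambda>x v. 0)
    (\<lambda>x v. deriv_along (lB X) b x * metric F (snd x) (V (snd x)) v)"
proof (rule splits_nabla_flatI)
  have m: "metric F q (V q) (W q) = g_of F V W q" for W q by (simp add: g_of_def)
  show "covector F (snd x) (\<lambda>v. deriv_along (lB X) b x * metric F (snd x) (V (snd x)) v)" for x
    using assms by (intro F.covector_intros F.vector_field_tangent)
  show "(\<lambda>x. deriv_along (lB X) b x * metric F (snd x) (V (snd x)) (W (snd x))) \<in> SP" if "W \<in> vfields F" for W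
    unfolding m using assms that
    by (intro P.smooth_intros lift_fst_smooth b_smooth smooth_pullback_snd F.g_of_smooth)
  show "ap_koszul TP (lB X) (lF V) (lF W) x =
      b x * (deriv_along (lB X) b x * metric F (snd x) (V (snd x)) (W (snd x)))" if "W \<in> vfields F" for W x
    unfolding m using assms that by (simp add: ap_koszul_lift)
qed (use assms in \<open>simp_all add: lift_fst_vector_field lift_snd_vector_field B.covector_0 ap_koszul_lift deriv_b_zero\<close>)

lemma splits_FB:
  assumes "X \<in> vfields B" "V \<in> vfields F"
  shows "splits (nabla_flat TP (lF V) (lB X)) (\<lambda>x v. 0)
    (\<lambda>x v. 1/2 * deriv_along (lB X) b x * metric F (snd x) (V (snd x)) v +
      1/2 * deriv_along (lB (J_of B X)) b x * metric F (snd x) (J_of F V (snd x)) v)"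
    (is "splits _ _ ?\<gamma>")
proof (rule splits_nabla_flatI)
  note J = B.J_of_vector_field[OF assms(1)] F.J_of_vector_field[OF assms(2)]
  have m: "metric F q (V q) (W q) = g_of F V W q" "metric F q (J_of F V q) (W q) = g_of F (J_of F V) W q" for W q
    by (simp_all add: g_of_def)
  show "covector F (snd x) (?\<gamma> x)" for x
    using assms J by (intro F.covector_intros F.vector_field_tangent)
  show "(\<lambda>x. ?\<gamma> x (W (snd x))) \<in> SP" if "W \<in> vfields F" for W
    unfolding m using assms that J
    by (intro P.smooth_intros lift_fst_smooth b_smooth smooth_pullback_snd F.g_of_smooth)
  show "ap_koszul TP (lF V) (lB X) (lF W) x = b x * ?\<gamma> x (W (snd x))" if "W \<in> vfields F" for W x
    unfolding m using assms that by (simp add: ap_koszul_lift F.g_of_J_of_left algebra_simps)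
  show "?\<gamma> x (W (snd x)) = 0" if "b x = 0" for W x
    using assms that J by (simp add: deriv_b_zero)
qed (use assms in \<open>simp_all add: lift_fst_vector_field lift_snd_vector_field B.covector_0 ap_koszul_lift\<close>)

lemma splits_FF:
  assumes "U \<in> vfields F" "V \<in> vfields F"
  shows "splits (nabla_flat TP (lF U) (lF V))
    (\<lambda>x v. - 1/2 * b x * g_of F U V (snd x) * dbB x v + - 1/2 * b x * g_of F U (J_of F V) (snd x) * dbJB x v)
    (\<lambda>x v. b x * nabla_flat F U V (snd x) v + (deriv_along (lF U) b x * metric F (snd x) (V (snd x)) v +
      (1/2 * deriv_along (lF V) b x * metric F (snd x) (U (snd x)) v +
      (- 1/2 * g_of F U V (snd x) * dbF x v +
      (1/2 * deriv_along (lF (J_of F V)) b x * metric F (snd x) (J_of F U (snd x)) v +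
       - 1/2 * g_of F U (J_of F V) (snd x) * dbJF x v)))))"
    (is "splits _ ?\<alpha> ?\<gamma>")
proof (rule splits_nabla_flatI)
  note J = F.J_of_vector_field[OF assms(1)] F.J_of_vector_field[OF assms(2)]
  have m: "metric F q (V q) (W q) = g_of F V W q" "metric F q (U q) (W q) = g_of F U W q"
    "metric F q (J_of F U q) (W q) = g_of F (J_of F U) W q" for W q
    by (simp_all add: g_of_def)
  show "covector B (fst x) (?\<alpha> x)" for x
    by (intro B.covector_add B.covector_cmult covector_db covector_dbJ)
  show "covector F (snd x) (?\<gamma> x)" for x
    using assms J
    by (intro F.covector_add F.covector_cmult covector_db covector_dbJ F.covector_metric(1)
        F.vector_field_tangent F.covector_nabla_flat)
  show "(\<lambda>x. ?\<alpha> x (X (fst x))) \<in> SP" if "X \<in> vfields B" for X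
    unfolding db_apply using assms that J
    by (intro P.smooth_add P.smooth_mult P.smooth_const lift_fst_smooth b_smooth smooth_pullback_snd F.g_of_smooth
        B.J_of_vector_field)
  show "(\<lambda>x. ?\<gamma> x (W (snd x))) \<in> SP" if "W \<in> vfields F" for W
    unfolding m db_apply F.nabla_flat_eq[OF assms that] using assms that J
    by (intro P.smooth_add P.smooth_mult P.smooth_const lift_snd_smooth b_smooth smooth_pullback_snd F.g_of_smooth
        F.J_of_vector_field F.ap_koszul_smooth)
  show "ap_koszul TP (lF U) (lF V) (lB X) x = ?\<alpha> x (X (fst x))" if "X \<in> vfields B" for X x
    unfolding db_apply using assms that by (simp add: ap_koszul_lift algebra_simps)
  show "ap_koszul TP (lF U) (lF V) (lF W) x = b x * ?\<gamma> x (W (snd x))" if W: "W \<in> vfields F" for W x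
    unfolding m db_apply F.nabla_flat_eq[OF assms W] ap_koszul_lift(8)[OF assms W]
      F.g_of_J_of_left[OF assms(1) W]
    by (simp add: algebra_simps power2_eq_square)
  show "?\<gamma> x (W (snd x)) = 0" if W: "W \<in> vfields F" and b: "b x = 0" for W x
  proof -
    note d = deriv_b_zero(2)[OF b assms(1)] deriv_b_zero(2)[OF b assms(2)] deriv_b_zero(2)[OF b W]
      deriv_b_zero(2)[OF b J(2)] deriv_b_zero(2)[OF b F.J_of_vector_field[OF W]]
    show ?thesis unfolding db_apply d b by simp
  qed
qed (use assms in \<open>simp_all add: lift_snd_vector_field\<close>)

end

section \<open>The curvature of the twisted product\<close>

context ap_manifold
begin

text \<open>Oriented as rewrite rules, these bring every value of the metric on \<open>C\<close>,
  \<open>D\<close> and their images under \<open>J\<close> to one of the two forms \<open>g C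
  D\<close> and \<open>g C (J D)\<close>.\<close>

lemma g_of_normalize:
  assumes "C \<in> vfields M" "D \<in> vfields M"
  shows "g_of M D C = g_of M C D" "g_of M (J_of M C) D = g_of M C (J_of M D)"
    "g_of M (J_of M D) C = g_of M C (J_of M D)" "g_of M D (J_of M C) = g_of M C (J_of M D)"
    "g_of M (J_of M C) (J_of M D) = g_of M C D" "g_of M (J_of M D) (J_of M C) = g_of M C D"
  using assms g_of_sym[of D "J_of M C"] g_of_sym[of "J_of M D" C] g_of_sym[of D C]
  by (simp_all add: g_of_J_of_left J_of_vector_field J_of_J_of)

lemma ap_koszul_apply: "ap_koszul M X Y Z p = 1/2 * (koszul M X Y Z p + koszul M X (J_of M Y) (J_of M Z) p)"
  by (simp add: ap_koszul_def)

text \<open>The metric is invariant under \<open>J\<close>, hence so is its derivative.\<close>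

lemma koszul_compat_J_of:
  assumes "X \<in> vfields M" "Y \<in> vfields M" "Z \<in> vfields M"
  shows "koszul M X (J_of M Z) (J_of M Y) p =
      koszul M X Y Z p + koszul M X Z Y p - koszul M X (J_of M Y) (J_of M Z) p"
    and "koszul M X (J_of M Z) Y p =
      koszul M X (J_of M Y) Z p + koszul M X Z (J_of M Y) p - koszul M X Y (J_of M Z) p"
  using koszul_compat[OF assms, of p] koszul_compat[of X "J_of M Y" "J_of M Z" p]
    koszul_compat[of X "J_of M Y" Z p] koszul_compat[of X Y "J_of M Z" p] assms
  by (simp_all add: J_of_vector_field g_of_J_of_left J_of_J_of)

end

context twisted
begin

lemma deriv_lift_b2:
  "X \<in> vfields B \<Longrightarrow> deriv_along (lB X) (\<lambda>x. (b x)\<^sup>2) x = 2 * b x * deriv_along (lB X) b x"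
  "V \<in> vfields F \<Longrightarrow> deriv_along (lF V) (\<lambda>x. (b x)\<^sup>2) x = 2 * b x * deriv_along (lF V) b x"
  by (simp_all add: power2_eq_square P.deriv_along_mult b_smooth lift_fst_vector_field lift_snd_vector_field)

lemmas deriv_simps = P.deriv_along_add P.deriv_along_diff P.deriv_along_mult
  P.deriv_along_const deriv_lift_const deriv_lift_pullback deriv_lift_b2

lemmas vector_field_simps = lift_fst_vector_field lift_snd_vector_field B.J_of_vector_field
  F.J_of_vector_field B.bracket_vector_field F.bracket_vector_field B.vector_field_tangent F.vector_field_tangent
  B.J_of_J_of F.J_of_J_of

lemmas smooth_simps = P.smooth_add P.smooth_mult P.smooth_const P.smooth_diff P.smooth_uminus P.smooth_power
  lift_fst_smooth lift_snd_smooth b_smooth smooth_pullback_fst smooth_pullback_snd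
  B.ap_koszul_smooth F.ap_koszul_smooth F.g_of_smooth

lemmas covector_simps = B.covector_intros F.covector_intros B.covector_nabla_flat F.covector_nabla_flat
  covector_db covector_dbJ

lemma deriv_lift_bracket:
  "X \<in> vfields B \<Longrightarrow> Y \<in> vfields B \<Longrightarrow> deriv_along (lB (bracket X Y)) f x =
    deriv_along (lB X) (deriv_along (lB Y) f) x - deriv_along (lB Y) (deriv_along (lB X) f) x"
  "V \<in> vfields F \<Longrightarrow> W \<in> vfields F \<Longrightarrow> deriv_along (lF (bracket V W)) f x =
    deriv_along (lF V) (deriv_along (lF W) f) x - deriv_along (lF W) (deriv_along (lF V) f) x"
  by (simp_all add: bracket_lift_fst[symmetric] bracket_lift_snd[symmetric] bracket_apply[symmetric])
    (simp_all add: deriv_along_def)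

lemma metric_field: "metric F (snd x) (V (snd x)) (W (snd x)) = g_of F V W (snd x)"
  by (simp add: g_of_def)

lemmas curvature_simps = ap_koszul_lift deriv_simps vector_field_simps smooth_simps covector_simps
  bracket_lift_fst bracket_lift_snd bracket_lift_mixed bracket_lift_mixed' deriv_lift_bracket
  M.ap_koszul_zero_first[unfolded atlas_TP] B.cometric_simps F.cometric_simps metric_field db_apply B.nabla_flat_eq F.nabla_flat_eq

text \<open>Each formula follows by evaluating the forms on lifted fields, differentiating with
  the Leibniz rule, and contracting componentwise; the rest is commutative algebra.\<close>

lemma curvature_BBBB:
  assumes "X \<in> vfields B" "Y \<in> vfields B" "Z \<in> vfields B" "T \<in> vfields B"
  shows "ap_curvature TP (lB X) (lB Y) (lB Z) (lB T) x = ap_curvature B X Y Z T (fst x)"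
  unfolding ap_curvature_def
    contraction_split[OF splits_BB[OF assms(1,3)] splits_BB[OF assms(2,4)]]
    contraction_split[OF splits_BB[OF assms(2,3)] splits_BB[OF assms(1,4)]]
  by (simp only: assms curvature_simps B.contraction_eq_cometric B.nabla_flat_smooth)

lemma curvature_BBBF:
  assumes "X \<in> vfields B" "Y \<in> vfields B" "Z \<in> vfields B" "W \<in> vfields F"
  shows "ap_curvature TP (lB X) (lB Y) (lB Z) (lF W) x = 0"
  unfolding ap_curvature_def
    contraction_split[OF splits_BB[OF assms(1,3)] splits_BF[OF assms(2,4)]]
    contraction_split[OF splits_BB[OF assms(2,3)] splits_BF[OF assms(1,4)]]
  by (simp only: assms curvature_simps )

lemma curvature_BFBB:
  assumes "X \<in> vfields B" "Y \<in> vfields B" "Z \<in> vfields B" "W \<in> vfields F"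
  shows "ap_curvature TP (lB Z) (lF W) (lB X) (lB Y) x = 0"
  unfolding ap_curvature_def
    contraction_split[OF splits_BB[OF assms(3,1)] splits_FB[OF assms(2,4)]]
    contraction_split[OF splits_FB[OF assms(1,4)] splits_BB[OF assms(3,2)]]
  by (simp only: assms curvature_simps )

lemma curvature_BBFF:
  assumes "X \<in> vfields B" "Y \<in> vfields B" "V \<in> vfields F" "W \<in> vfields F"
  shows "ap_curvature TP (lB X) (lB Y) (lF V) (lF W) x = 0"
  unfolding ap_curvature_def
    contraction_split[OF splits_BF[OF assms(1,3)] splits_BF[OF assms(2,4)]]
    contraction_split[OF splits_BF[OF assms(2,3)] splits_BF[OF assms(1,4)]]
  by (simp only: assms curvature_simps F.g_of_normalize[OF assms(3,4)])
    (simp add: field_simps)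

lemma curvature_FFBB:
  assumes "X \<in> vfields B" "Y \<in> vfields B" "V \<in> vfields F" "W \<in> vfields F"
  shows "ap_curvature TP (lF V) (lF W) (lB X) (lB Y) x = 0"
  unfolding ap_curvature_def
    contraction_split[OF splits_FB[OF assms(1,3)] splits_FB[OF assms(2,4)]]
    contraction_split[OF splits_FB[OF assms(1,4)] splits_FB[OF assms(2,3)]]
  by (simp only: assms curvature_simps F.g_of_normalize[OF assms(3,4)])

lemma curvature_BFBF:
  assumes "X \<in> vfields B" "Y \<in> vfields B" "V \<in> vfields F" "W \<in> vfields F"
  shows "ap_curvature TP (lB X) (lF V) (lB Y) (lF W) x =
         1/2 * b x * deriv_along (lB X) (deriv_along (lB Y) b) x * g_of F V W (snd x)
         - 1/2 * b x * cometric B (fst x) (nabla_flat B X Y (fst x)) (dbB x) * g_of F V W (snd x)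
         + 1/2 * b x * deriv_along (lB X) (deriv_along (lB (J_of B Y)) b) x
           * g_of F V (J_of F W) (snd x)
         - 1/2 * b x * cometric B (fst x) (nabla_flat B X Y (fst x)) (dbJB x)
           * g_of F V (J_of F W) (snd x)"
  unfolding ap_curvature_def
    contraction_split[OF splits_BB[OF assms(1,2)] splits_FF[OF assms(3,4)]]
    contraction_split[OF splits_FB[OF assms(2,3)] splits_BF[OF assms(1,4)]]
  by (simp only: assms curvature_simps F.g_of_normalize[OF assms(3,4)])
    (simp add: field_simps)

text \<open>The forms \<open>ap_koszul F V W U\<close> and \<open>ap_koszul F V U W\<close> add up
  to the derivative of \<open>g\<^sub>F(W, U)\<close> along \<open>V\<close>, which
  cancels.\<close>

lemma curvature_BFFF:
  assumes "X \<in> vfields B" "V \<in> vfields F" "W \<in> vfields F" "U \<in> vfields F"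
  shows "ap_curvature TP (lB X) (lF V) (lF W) (lF U) x =
         - 1/2 * (deriv_along (lB X) b x * deriv_along (lF W) b x - b x
           * deriv_along (lB X) (deriv_along (lF W) b) x) * g_of F V U (snd x)
         - 1/2 * (deriv_along (lB X) b x * deriv_along (lF (J_of F W)) b x - b x
           * deriv_along (lB X) (deriv_along (lF (J_of F W)) b) x) * g_of F V (J_of F U) (snd x)
         + 1/2 * (deriv_along (lB X) b x * deriv_along (lF U) b x - b x
           * deriv_along (lB X) (deriv_along (lF U) b) x) * g_of F V W (snd x)
         + 1/2 * (deriv_along (lB X) b x * deriv_along (lF (J_of F U)) b x - b x
           * deriv_along (lB X) (deriv_along (lF (J_of F U)) b) x) * g_of F V (J_of F W) (snd x)"
  unfolding ap_curvature_def
    contraction_split[OF splits_BF[OF assms(1,3)] splits_FF[OF assms(2,4)]]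
    contraction_split[OF splits_FF[OF assms(2,3)] splits_BF[OF assms(1,4)]]
  by (simp only: assms curvature_simps deriv_lift_commute F.g_of_normalize[OF assms(2,3)] F.g_of_normalize[OF assms(2,4)] F.g_of_normalize[OF assms(3,4)])
    (simp add: F.ap_koszul_apply F.koszul_compat F.koszul_compat_J_of(1)[OF assms(2,3,4)] assms field_simps)

text \<open>Here the derivatives of the metric and the bracket of \<open>W\<close> and
  \<open>U\<close> do not cancel; they are rewritten through the Koszul form of
  \<open>F\<close>.\<close>

lemma curvature_FFBF:
  assumes "X \<in> vfields B" "W \<in> vfields F" "U \<in> vfields F" "V \<in> vfields F"
  shows "ap_curvature TP (lF W) (lF U) (lB X) (lF V) x =
         1/4 * (2 * b x * deriv_along (lF W) (deriv_along (lB X) b) x - deriv_along (lB X) b x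
           * deriv_along (lF W) b x
                - deriv_along (lB (J_of B X)) b x * deriv_along (lF (J_of F W)) b x)
                  * g_of F U V (snd x)
         + 1/4 * (2 * b x * deriv_along (lF W) (deriv_along (lB (J_of B X)) b) x
           - deriv_along (lB X) b x * deriv_along (lF (J_of F W)) b x
                - deriv_along (lB (J_of B X)) b x * deriv_along (lF W) b x)
                  * g_of F U (J_of F V) (snd x)
         - 1/4 * (2 * b x * deriv_along (lF U) (deriv_along (lB X) b) x - deriv_along (lB X) b x
           * deriv_along (lF U) b x
                - deriv_along (lB (J_of B X)) b x * deriv_along (lF (J_of F U)) b x)
                  * g_of F W V (snd x)
         - 1/4 * (2 * b x * deriv_along (lF U) (deriv_along (lB (J_of B X)) b) x
           - deriv_along (lB X) b x * deriv_along (lF (J_of F U)) b x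
                - deriv_along (lB (J_of B X)) b x * deriv_along (lF U) b x)
                  * g_of F W (J_of F V) (snd x)
         - 1/4 * b x * deriv_along (lB X) b x *
             (koszul F U V W (snd x) - koszul F W V U (snd x)
               - koszul F U (J_of F V) (J_of F W) (snd x) + koszul F W (J_of F V) (J_of F U) (snd x))
         + 1/4 * b x * deriv_along (lB (J_of B X)) b x *
             (koszul F U V (J_of F W) (snd x) - koszul F W V (J_of F U) (snd x)
               - koszul F U (J_of F V) W (snd x) + koszul F W (J_of F V) U (snd x))"
  unfolding ap_curvature_def
    contraction_split[OF splits_FB[OF assms(1,2)] splits_FF[OF assms(3,4)]]
    contraction_split[OF splits_FB[OF assms(1,3)] splits_FF[OF assms(2,4)]]
  by (simp only: assms curvature_simps F.koszul_compat F.koszul_torsion F.g_of_normalize[OF assms(2,3)] F.g_of_normalize[OF assms(2,4)] F.g_of_normalize[OF assms(3,4)])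
    (simp add: F.ap_koszul_apply field_simps F.J_of_J_of assms)

end

section \<open>The curvature on four vertical fields\<close>

context twisted
begin

text \<open>The two components of the form \<open>nabla_flat TP (lF U) (lF V)\<close>, the vertical one after division
  by \<open>b\<close>.\<close>

definition horizontal :: "'n vfield \<Rightarrow> 'n vfield \<Rightarrow> 'm \<times> 'n \<Rightarrow> 'm tvec \<Rightarrow> real" where
  "horizontal U V x = (\<lambda>v. - 1/2 * b x * g_of F U V (snd x) * dbB x v +
    - 1/2 * b x * g_of F U (J_of F V) (snd x) * dbJB x v)"

definition vertical :: "'n vfield \<Rightarrow> 'n vfield \<Rightarrow> 'm \<times> 'n \<Rightarrow> 'n tvec \<Rightarrow> real" where
  "vertical U V x = (\<lambda>v. b x * nabla_flat F U V (snd x) v + (deriv_along (lF U) b x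
    * metric F (snd x) (V (snd x)) v +
      (1/2 * deriv_along (lF V) b x * metric F (snd x) (U (snd x)) v +
      (- 1/2 * g_of F U V (snd x) * dbF x v +
      (1/2 * deriv_along (lF (J_of F V)) b x * metric F (snd x) (J_of F U (snd x)) v +
       - 1/2 * g_of F U (J_of F V) (snd x) * dbJF x v)))))"

lemma splits_horizontal_vertical: "U \<in> vfields F
  \<Longrightarrow> V \<in> vfields F
  \<Longrightarrow> splits (nabla_flat TP (lF U) (lF V)) (horizontal U V) (vertical U V)"
  using splits_FF unfolding horizontal_def[abs_def] vertical_def[abs_def] .

lemma cometric_horizontal:
  "cometric B (fst x) (horizontal U W x) (horizontal V Q x) = 1/4 * (b x)\<^sup>2 *
    (g_of F U W (snd x) * g_of F V Q (snd x) * cometric B (fst x) (dbB x) (dbB x) +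
     (g_of F U W (snd x) * g_of F V (J_of F Q) (snd x) + g_of F U (J_of F W) (snd x)
       * g_of F V Q (snd x))
       * cometric B (fst x) (dbJB x) (dbB x) +
     g_of F U (J_of F W) (snd x) * g_of F V (J_of F Q) (snd x) * cometric B (fst x) (dbJB x) (dbJB x))"
proof -
  note c = covector_db(1)[of x] covector_dbJ(1)[of x]
  note c' = B.covector_cmult[OF c(1)] B.covector_cmult[OF c(2)]
  note c'' = B.covector_add[OF c']
  have s: "cometric B (fst x) (dbB x) (dbJB x)
    = cometric B (fst x) (dbJB x) (dbB x)" by (rule B.cometric_sym[OF c])
  show ?thesis
    unfolding horizontal_def B.cometric_add(1)[OF c' c''] B.cometric_add(2)[OF c' c'(1)] B.cometric_add(2)[OF c' c'(2)]
      B.cometric_cmult(1)[OF c(1) c'(1)] B.cometric_cmult(1)[OF c(1) c'(2)]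
      B.cometric_cmult(1)[OF c(2) c'(1)] B.cometric_cmult(1)[OF c(2) c'(2)]
      B.cometric_cmult(2)[OF c(1) c(1)] B.cometric_cmult(2)[OF c(1) c(2)]
      B.cometric_cmult(2)[OF c(2) c(1)] B.cometric_cmult(2)[OF c(2) c(2)] s
    by (simp add: field_simps power2_eq_square)
qed

lemma covector_vertical:
  assumes "U \<in> vfields F" "V \<in> vfields F"
  shows "covector F (snd x) (vertical U V x)"
  using splitsD(3)[OF splits_horizontal_vertical[OF assms]] .

lemma vertical_apply:
  assumes "U \<in> vfields F" "V \<in> vfields F" "W \<in> vfields F"
  shows "vertical U V x (W (snd x)) = b x * ap_koszul F U V W (snd x) + (deriv_along (lF U) b x
    * g_of F V W (snd x) +
      (1/2 * deriv_along (lF V) b x * g_of F U W (snd x) +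
      (- 1/2 * g_of F U V (snd x) * deriv_along (lF W) b x +
      (1/2 * deriv_along (lF (J_of F V)) b x * g_of F (J_of F U) W (snd x) +
       - 1/2 * g_of F U (J_of F V) (snd x) * deriv_along (lF (J_of F W)) b x))))"
  unfolding vertical_def metric_field db_apply F.nabla_flat_eq[OF assms] ..

lemma cometric_vertical:
  assumes V: "U \<in> vfields F" "V \<in> vfields F" and d: "covector F (snd x) \<delta>"
  shows "cometric F (snd x) (vertical U V x) \<delta> =
      b x * cometric F (snd x) (nabla_flat F U V (snd x)) \<delta> + (deriv_along (lF U) b x
        * \<delta> (V (snd x)) +
      (1/2 * deriv_along (lF V) b x * \<delta> (U (snd x)) +
      (- 1/2 * g_of F U V (snd x) * cometric F (snd x) (dbF x) \<delta> +
      (1/2 * deriv_along (lF (J_of F V)) b x * \<delta> (J_of F U (snd x)) +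
       - 1/2 * g_of F U (J_of F V) (snd x) * cometric F (snd x) (dbJF x) \<delta>))))"
proof -
  note t = F.vector_field_tangent[OF V(1)] F.vector_field_tangent[OF V(2)]
    F.vector_field_tangent[OF F.J_of_vector_field[OF V(1)]]
  note c = F.covector_nabla_flat[OF V] F.covector_metric(1)[OF t(2)] F.covector_metric(1)[OF t(1)]
    covector_db(2)[of x] F.covector_metric(1)[OF t(3)] covector_dbJ(2)[of x]
  note m1 = F.covector_cmult[OF c(1)] and m2 = F.covector_cmult[OF c(2)] and m3
    = F.covector_cmult[OF c(3)]
    and m4 = F.covector_cmult[OF c(4)] and m5 = F.covector_cmult[OF c(5)] and m6
      = F.covector_cmult[OF c(6)]
  note a5 = F.covector_add[OF m5 m6]
  note a4 = F.covector_add[OF m4 a5]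
  note a3 = F.covector_add[OF m3 a4]
  note a2 = F.covector_add[OF m2 a3]
  show ?thesis
    unfolding vertical_def F.cometric_add(1)[OF m1 a2 d] F.cometric_add(1)[OF m2 a3 d] F.cometric_add(1)[OF m3 a4 d]
      F.cometric_add(1)[OF m4 a5 d] F.cometric_add(1)[OF m5 m6 d]
      F.cometric_cmult(1)[OF c(1) d] F.cometric_cmult(1)[OF c(2) d] F.cometric_cmult(1)[OF c(3) d]
      F.cometric_cmult(1)[OF c(4) d] F.cometric_cmult(1)[OF c(5) d] F.cometric_cmult(1)[OF c(6) d]
      F.cometric_metric(1)[OF t(1) d] F.cometric_metric(1)[OF t(2) d] F.cometric_metric(1)[OF t(3) d] ..
qed

lemma cometric_vertical':
  assumes V: "U \<in> vfields F" "V \<in> vfields F" and d: "covector F (snd x) \<delta>"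
  shows "cometric F (snd x) \<delta> (vertical U V x) =
      b x * cometric F (snd x) (nabla_flat F U V (snd x)) \<delta> + (deriv_along (lF U) b x
        * \<delta> (V (snd x)) +
      (1/2 * deriv_along (lF V) b x * \<delta> (U (snd x)) +
      (- 1/2 * g_of F U V (snd x) * cometric F (snd x) (dbF x) \<delta> +
      (1/2 * deriv_along (lF (J_of F V)) b x * \<delta> (J_of F U (snd x)) +
       - 1/2 * g_of F U (J_of F V) (snd x) * cometric F (snd x) (dbJF x) \<delta>))))"
  using cometric_vertical[OF assms] F.cometric_sym[OF d covector_vertical[OF V]] by simp

text \<open>Pairing with a metric dual is evaluation, so of the pairings of the two sixfold sums
  only those between covariant derivatives and differentials of \<open>b\<close> survive as values
  of the inverse metric.\<close>

lemma cometric_vertical_vertical: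
  fixes x :: "'m \<times> 'n"
  assumes V: "U \<in> vfields F" "W \<in> vfields F" "V \<in> vfields F" "Q \<in> vfields F"
  defines "n \<equiv> \<lambda>U W. nabla_flat F U W (snd x)" and "h \<equiv> cometric F (snd x)"
    and "g \<equiv> \<lambda>U W. g_of F U W (snd x)" and "d \<equiv> \<lambda>U. deriv_along (lF U) b x"
    and "k \<equiv> \<lambda>U V W. ap_koszul F U V W (snd x)" and "J \<equiv> J_of F"
  shows "h (vertical U W x) (vertical V Q x) =
    b x * (b x * h (n V Q) (n U W) + (d V * k U W Q + (1/2 * d Q * k U W V + (- 1/2 * g V Q
      * h (n U W) (dbF x) +
      (1/2 * d (J Q) * k U W (J V) + - 1/2 * g V (J Q) * h (n U W) (dbJF x)))))) +
    (d U * vertical V Q x (W (snd x)) + (1/2 * d W * vertical V Q x (U (snd x)) +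
    (- 1/2 * g U W * (b x * h (n V Q) (dbF x) + (d V * d Q + (1/2 * d Q * d V + (- 1/2 * g V Q
      * h (dbF x) (dbF x) +
      (1/2 * d (J Q) * d (J V) + - 1/2 * g V (J Q) * h (dbJF x) (dbF x)))))) +
    (1/2 * d (J W) * vertical V Q x (J U (snd x)) +
    - 1/2 * g U (J W) * (b x * h (n V Q) (dbJF x) + (d V * d (J Q) + (1/2 * d Q * d (J V)
      + (- 1/2 * g V Q * h (dbJF x) (dbF x) +
      (1/2 * d (J Q) * d V + - 1/2 * g V (J Q) * h (dbJF x) (dbJF x))))))))))"
proof -
  note J = F.J_of_vector_field[OF V(3)]
  note cn = F.covector_nabla_flat[OF V(1,2), of "snd x"] and cd = covector_db(2)[of x] and cJ
    = covector_dbJ(2)[of x]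
  note cV = F.covector_nabla_flat[OF V(3,4), of "snd x"]
  show ?thesis
    unfolding n_def h_def g_def d_def k_def J_def cometric_vertical[OF V(1,2) covector_vertical[OF V(3,4)]]
      cometric_vertical'[OF V(3,4) cn] cometric_vertical'[OF V(3,4) cd] cometric_vertical'[OF V(3,4) cJ]
      F.nabla_flat_eq[OF V(1,2,4)] F.nabla_flat_eq[OF V(1,2,3)] F.nabla_flat_eq[OF V(1,2) J]
      db_apply F.J_of_J_of[OF V(3)] F.cometric_sym[OF cd cn] F.cometric_sym[OF cJ cn] F.cometric_sym[OF cd cJ]
    ..
qed

end

context twisted
begin

text \<open>After expansion, the derivatives of the metric and the bracket are expressed by the
  Koszul form of \<open>F\<close>, and the relations that the invariance of the metric under
  \<open>J\<close> imposes on that form are used to eliminate dependent values. The two sides then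
  agree as polynomials.\<close>

lemma curvature_FFFF:
  assumes "U \<in> vfields F" "V \<in> vfields F" "W \<in> vfields F" "Q \<in> vfields F"
  shows "ap_curvature TP (lF U) (lF V) (lF W) (lF Q) x =
         (b x)\<^sup>2 * ap_curvature F U V W Q (snd x)
         + 1/4 * ((b x)\<^sup>2 * cometric B (fst x) (dbB x) (dbB x)
           + cometric F (snd x) (dbF x) (dbF x)) *
             (g_of F U W (snd x) * g_of F V Q (snd x) - g_of F V W (snd x) * g_of F U Q (snd x))
         + 1/4 * ((b x)\<^sup>2 * cometric B (fst x) (dbJB x) (dbJB x)
           + cometric F (snd x) (dbJF x) (dbJF x)) *
             (g_of F U (J_of F W) (snd x) * g_of F V (J_of F Q) (snd x)
               - g_of F V (J_of F W) (snd x) * g_of F U (J_of F Q) (snd x))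
         + 1/4 * ((b x)\<^sup>2 * cometric B (fst x) (dbJB x) (dbB x)
           + cometric F (snd x) (dbJF x) (dbF x)) *
             (g_of F U (J_of F W) (snd x) * g_of F V Q (snd x) - g_of F V (J_of F W) (snd x)
               * g_of F U Q (snd x)
              + g_of F U W (snd x) * g_of F V (J_of F Q) (snd x) - g_of F V W (snd x)
                * g_of F U (J_of F Q) (snd x))
         - 1/4 * (3 * deriv_along (lF U) b x * deriv_along (lF W) b x - 2 * b x
           * deriv_along (lF U) (deriv_along (lF W) b) x
                  + deriv_along (lF (J_of F U)) b x * deriv_along (lF (J_of F W)) b x + 2 * b x
                    * cometric F (snd x) (nabla_flat F U W (snd x)) (dbF x)) * g_of F V Q (snd x)
         - 1/4 * (3 * deriv_along (lF U) b x * deriv_along (lF (J_of F W)) b x - 2 * b x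
           * deriv_along (lF U) (deriv_along (lF (J_of F W)) b) x
                  + deriv_along (lF (J_of F U)) b x * deriv_along (lF W) b x + 2 * b x
                    * cometric F (snd x) (nabla_flat F U W (snd x)) (dbJF x))
                    * g_of F V (J_of F Q) (snd x)
         - 1/4 * (3 * deriv_along (lF V) b x * deriv_along (lF Q) b x - 2 * b x
           * deriv_along (lF V) (deriv_along (lF Q) b) x
                  + deriv_along (lF (J_of F V)) b x * deriv_along (lF (J_of F Q)) b x + 2 * b x
                    * cometric F (snd x) (nabla_flat F V Q (snd x)) (dbF x)) * g_of F U W (snd x)
         - 1/4 * (3 * deriv_along (lF V) b x * deriv_along (lF (J_of F Q)) b x - 2 * b x
           * deriv_along (lF V) (deriv_along (lF (J_of F Q)) b) x
                  + deriv_along (lF (J_of F V)) b x * deriv_along (lF Q) b x + 2 * b x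
                    * cometric F (snd x) (nabla_flat F V Q (snd x)) (dbJF x))
                    * g_of F U (J_of F W) (snd x)
         + 1/4 * (3 * deriv_along (lF V) b x * deriv_along (lF W) b x - 2 * b x
           * deriv_along (lF V) (deriv_along (lF W) b) x
                  + deriv_along (lF (J_of F V)) b x * deriv_along (lF (J_of F W)) b x + 2 * b x
                    * cometric F (snd x) (nabla_flat F V W (snd x)) (dbF x)) * g_of F U Q (snd x)
         + 1/4 * (3 * deriv_along (lF V) b x * deriv_along (lF (J_of F W)) b x - 2 * b x
           * deriv_along (lF V) (deriv_along (lF (J_of F W)) b) x
                  + deriv_along (lF (J_of F V)) b x * deriv_along (lF W) b x + 2 * b x
                    * cometric F (snd x) (nabla_flat F V W (snd x)) (dbJF x))
                    * g_of F U (J_of F Q) (snd x)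
         + 1/4 * (3 * deriv_along (lF U) b x * deriv_along (lF Q) b x - 2 * b x
           * deriv_along (lF U) (deriv_along (lF Q) b) x
                  + deriv_along (lF (J_of F U)) b x * deriv_along (lF (J_of F Q)) b x + 2 * b x
                    * cometric F (snd x) (nabla_flat F U Q (snd x)) (dbF x)) * g_of F V W (snd x)
         + 1/4 * (3 * deriv_along (lF U) b x * deriv_along (lF (J_of F Q)) b x - 2 * b x
           * deriv_along (lF U) (deriv_along (lF (J_of F Q)) b) x
                  + deriv_along (lF (J_of F U)) b x * deriv_along (lF Q) b x + 2 * b x
                    * cometric F (snd x) (nabla_flat F U Q (snd x)) (dbJF x))
                    * g_of F V (J_of F W) (snd x)
         + 1/4 * b x * deriv_along (lF Q) b x *
             (koszul F V W U (snd x) - koszul F U W V (snd x)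
               - koszul F V (J_of F W) (J_of F U) (snd x) + koszul F U (J_of F W) (J_of F V) (snd x))
         - 1/4 * b x * deriv_along (lF (J_of F Q)) b x *
             (koszul F V W (J_of F U) (snd x) - koszul F U W (J_of F V) (snd x)
               - koszul F V (J_of F W) U (snd x) + koszul F U (J_of F W) V (snd x))
         - 1/4 * b x * deriv_along (lF W) b x *
             (koszul F V Q U (snd x) - koszul F U Q V (snd x)
               - koszul F V (J_of F Q) (J_of F U) (snd x) + koszul F U (J_of F Q) (J_of F V) (snd x))
         + 1/4 * b x * deriv_along (lF (J_of F W)) b x *
             (koszul F V Q (J_of F U) (snd x) - koszul F U Q (J_of F V) (snd x)
               - koszul F V (J_of F Q) U (snd x) + koszul F U (J_of F Q) V (snd x))"
proof -
  note J = assms[THEN F.J_of_vector_field]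
  note s = F.cometric_sym[OF F.covector_nabla_flat[OF assms(2,4)] F.covector_nabla_flat[OF assms(1,3)], of "snd x"]
    F.cometric_sym[OF F.covector_nabla_flat[OF assms(2,3)] F.covector_nabla_flat[OF assms(1,4)], of "snd x"]
  show ?thesis
    unfolding ap_curvature_def
      contraction_split[OF splits_horizontal_vertical[OF assms(1,3)] splits_horizontal_vertical[OF assms(2,4)]]
      contraction_split[OF splits_horizontal_vertical[OF assms(2,3)] splits_horizontal_vertical[OF assms(1,4)]]
    by (simp only: assms J ap_koszul_lift deriv_simps smooth_simps vector_field_simps
          bracket_lift_snd deriv_lift_bracket cometric_horizontal cometric_vertical_vertical vertical_apply
          F.contraction_eq_cometric F.covector_nabla_flat F.nabla_flat_smooth,
        simp only: assms J F.J_of_J_of F.koszul_torsion F.ap_koszul_apply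
          F.g_of_normalize[OF assms(1,2)] F.g_of_normalize[OF assms(1,3)]
          F.g_of_normalize[OF assms(1,4)] F.g_of_normalize[OF assms(2,3)]
          F.g_of_normalize[OF assms(2,4)] F.g_of_normalize[OF assms(3,4)],
        simp only: assms J F.J_of_J_of F.koszul_compat,
        simp only: assms J F.J_of_J_of F.koszul_compat_J_of[OF assms(1,2,3)]
          F.koszul_compat_J_of[OF assms(1,2,4)] F.koszul_compat_J_of[OF assms(1,3,4)]
          F.koszul_compat_J_of[OF assms(2,1,3)] F.koszul_compat_J_of[OF assms(2,1,4)]
          F.koszul_compat_J_of[OF assms(2,3,4)],
        simp add: s algebra_simps power2_eq_square add_divide_distrib diff_divide_distrib)
qed

end

theorem theorem7p4:
  fixes B :: "('m::{t2_space, second_countable_topology}, 'e::{real_inner, heine_borel}) almost_product"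
    and F :: "('n::{t2_space, second_countable_topology}, 'f::{real_inner, heine_borel}) almost_product"
    and b :: "'m \<times> 'n \<Rightarrow> real"
    and X Y Z T :: "'m vfield"
    and U V W Q :: "'n vfield"
    and p :: 'm and q :: 'n
  assumes "almost_product_manifold B" and "nondegenerate B"
    and "almost_product_manifold F" and "nondegenerate F"
    and "b \<in> smooth (twisted_product B F b)"
    and "\<forall>x. b x = 0 \<longrightarrow> (\<forall>v\<in>tangent (twisted_product B F b) x. v b = 0)"
    and "X \<in> vfields B" "Y \<in> vfields B" "Z \<in> vfields B" "T \<in> vfields B"
    and "U \<in> vfields F" "V \<in> vfields F" "W \<in> vfields F" "Q \<in> vfields F"
  shows
    "let x = (p, q);
         R = (\<lambda>A C D E. ap_curvature (twisted_product B F b) A C D E x);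
         lB = lift_fst B F;
         lF = lift_snd B F;
         dB = (\<lambda>A f. deriv_along (lB A) f);
         dF = (\<lambda>A f. deriv_along (lF A) f);
         JB = J_of B;
         JF = J_of F;
         gF = (\<lambda>A C. g_of F A C q);
         KF = (\<lambda>A C D. koszul F A C D q);
         gB' = cometric B p;
         gF' = cometric F q;
         nB = (\<lambda>A C. nabla_flat B A C p);
         nF = (\<lambda>A C. nabla_flat F A C q);
         dbB = (\<lambda>v. incl_fst B F x v b);
         dbJB = (\<lambda>v. incl_fst B F x (endo B p v) b);
         dbF = (\<lambda>v. incl_snd B F x v b);
         dbJF = (\<lambda>v. incl_snd B F x (endo F q v) b)
     in
       \<comment> \<open>(1)\<close>
       R (lB X) (lB Y) (lB Z) (lB T) = ap_curvature B X Y Z T p \<and>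
       \<comment> \<open>(2)\<close>
       R (lB X) (lB Y) (lB Z) (lF W) = 0 \<and> R (lB Z) (lF W) (lB X) (lB Y) = 0 \<and>
       \<comment> \<open>(3)\<close>
       R (lB X) (lB Y) (lF V) (lF W) = 0 \<and> R (lF V) (lF W) (lB X) (lB Y) = 0 \<and>
       \<comment> \<open>(4)\<close>
       R (lB X) (lF V) (lB Y) (lF W) =
         1/2 * b x * dB X (dB Y b) x * gF V W
         - 1/2 * b x * gB' (nB X Y) dbB * gF V W
         + 1/2 * b x * dB X (dB (JB Y) b) x * gF V (JF W)
         - 1/2 * b x * gB' (nB X Y) dbJB * gF V (JF W) \<and>
       \<comment> \<open>(5)\<close>
       R (lB X) (lF V) (lF W) (lF U) =
         - 1/2 * (dB X b x * dF W b x - b x * dB X (dF W b) x) * gF V U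
         - 1/2 * (dB X b x * dF (JF W) b x - b x * dB X (dF (JF W) b) x) * gF V (JF U)
         + 1/2 * (dB X b x * dF U b x - b x * dB X (dF U b) x) * gF V W
         + 1/2 * (dB X b x * dF (JF U) b x - b x * dB X (dF (JF U) b) x) * gF V (JF W) \<and>
       \<comment> \<open>(6)\<close>
       R (lF W) (lF U) (lB X) (lF V) =
         1/4 * (2 * b x * dF W (dB X b) x - dB X b x * dF W b x
                - dB (JB X) b x * dF (JF W) b x) * gF U V
         + 1/4 * (2 * b x * dF W (dB (JB X) b) x - dB X b x * dF (JF W) b x
                - dB (JB X) b x * dF W b x) * gF U (JF V)
         - 1/4 * (2 * b x * dF U (dB X b) x - dB X b x * dF U b x
                - dB (JB X) b x * dF (JF U) b x) * gF W V
         - 1/4 * (2 * b x * dF U (dB (JB X) b) x - dB X b x * dF (JF U) b x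
                - dB (JB X) b x * dF U b x) * gF W (JF V)
         - 1/4 * b x * dB X b x *
             (KF U V W - KF W V U - KF U (JF V) (JF W) + KF W (JF V) (JF U))
         + 1/4 * b x * dB (JB X) b x *
             (KF U V (JF W) - KF W V (JF U) - KF U (JF V) W + KF W (JF V) U) \<and>
       \<comment> \<open>(7)\<close>
       R (lF U) (lF V) (lF W) (lF Q) =
         (b x)\<^sup>2 * ap_curvature F U V W Q q
         + 1/4 * ((b x)\<^sup>2 * gB' dbB dbB + gF' dbF dbF) *
             (gF U W * gF V Q - gF V W * gF U Q)
         + 1/4 * ((b x)\<^sup>2 * gB' dbJB dbJB + gF' dbJF dbJF) *
             (gF U (JF W) * gF V (JF Q) - gF V (JF W) * gF U (JF Q))
         + 1/4 * ((b x)\<^sup>2 * gB' dbJB dbB + gF' dbJF dbF) *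
             (gF U (JF W) * gF V Q - gF V (JF W) * gF U Q
              + gF U W * gF V (JF Q) - gF V W * gF U (JF Q))
         - 1/4 * (3 * dF U b x * dF W b x - 2 * b x * dF U (dF W b) x
                  + dF (JF U) b x * dF (JF W) b x + 2 * b x * gF' (nF U W) dbF) * gF V Q
         - 1/4 * (3 * dF U b x * dF (JF W) b x - 2 * b x * dF U (dF (JF W) b) x
                  + dF (JF U) b x * dF W b x + 2 * b x * gF' (nF U W) dbJF) * gF V (JF Q)
         - 1/4 * (3 * dF V b x * dF Q b x - 2 * b x * dF V (dF Q b) x
                  + dF (JF V) b x * dF (JF Q) b x + 2 * b x * gF' (nF V Q) dbF) * gF U W
         - 1/4 * (3 * dF V b x * dF (JF Q) b x - 2 * b x * dF V (dF (JF Q) b) x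
                  + dF (JF V) b x * dF Q b x + 2 * b x * gF' (nF V Q) dbJF) * gF U (JF W)
         + 1/4 * (3 * dF V b x * dF W b x - 2 * b x * dF V (dF W b) x
                  + dF (JF V) b x * dF (JF W) b x + 2 * b x * gF' (nF V W) dbF) * gF U Q
         + 1/4 * (3 * dF V b x * dF (JF W) b x - 2 * b x * dF V (dF (JF W) b) x
                  + dF (JF V) b x * dF W b x + 2 * b x * gF' (nF V W) dbJF) * gF U (JF Q)
         + 1/4 * (3 * dF U b x * dF Q b x - 2 * b x * dF U (dF Q b) x
                  + dF (JF U) b x * dF (JF Q) b x + 2 * b x * gF' (nF U Q) dbF) * gF V W
         + 1/4 * (3 * dF U b x * dF (JF Q) b x - 2 * b x * dF U (dF (JF Q) b) x
                  + dF (JF U) b x * dF Q b x + 2 * b x * gF' (nF U Q) dbJF) * gF V (JF W)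
         + 1/4 * b x * dF Q b x *
             (KF V W U - KF U W V - KF V (JF W) (JF U) + KF U (JF W) (JF V))
         - 1/4 * b x * dF (JF Q) b x *
             (KF V W (JF U) - KF U W (JF V) - KF V (JF W) U + KF U (JF W) V)
         - 1/4 * b x * dF W b x *
             (KF V Q U - KF U Q V - KF V (JF Q) (JF U) + KF U (JF Q) (JF V))
         + 1/4 * b x * dF (JF W) b x *
             (KF V Q (JF U) - KF U Q (JF V) - KF V (JF Q) U + KF U (JF Q) V)"
proof -
  have "twisted B F b"
    using assms(1-6) by unfold_locales blast+
  then interpret twisted B F b .
  note formulas =
    curvature_BBBB[OF assms(7-10), of "(p, q)"]
    curvature_BBBF[OF assms(7-9) assms(13), of "(p, q)"]
    curvature_BFBB[OF assms(7-9) assms(13), of "(p, q)"]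
    curvature_BBFF[OF assms(7,8,12,13), of "(p, q)"]
    curvature_FFBB[OF assms(7,8,12,13), of "(p, q)"]
    curvature_BFBF[OF assms(7,8,12,13), of "(p, q)"]
    curvature_BFFF[OF assms(7,12,13,11), of "(p, q)"]
    curvature_FFBF[OF assms(7,13,11,12), of "(p, q)"]
    curvature_FFFF[OF assms(11-14), of "(p, q)"]
  show ?thesis
    unfolding Let_def by (intro conjI) (rule formulas[unfolded fst_conv snd_conv])+
qed

end
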